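(* Let $G$ be a flower graph with $|E|\ge2$ and let $\alpha\in\mathbb{R}\setminus\{1/2,1\}$. Then the functional $\overline{\lambda_1}^{(\alpha)}(\cdot,\cdot)$ does not have any extremal pair. Consequently, $\overline{\lambda_1}^{(\alpha)}(\cdot,\cdot)$ does not have any minimiser on $\mathcal{A}_+(G)$.
   Context: A flower graph is a finite graph with exactly one vertex, all of whose edges are loops at that vertex. A metric on $G=(V,E)$ is a vector $g=(g_e)_{e\in E}\in\mathbb{R}_+^{|E|}$ of positive numbers; the edge $e$ has length $\ell_e=\sqrt{g_e}$ and is identified with $[0,\ell_e]$, making $(G,g)$ a compact metric graph. $G_0$ denotes $G$ with all edge lengths $1$, with coordinate $x\in[0,1]$ on each edge; functions on $(G,g)$ are identified with functions on $G_0$ by linear rescaling of each edge. $\mathcal{C}_+(G)$ is the set of densities: functions $\rho$, positive and smooth on each closed edge $[0,1]$ of $G_0$ (smooth up to the endpoints; no continuity across vertices required). $\mathcal{A}_+(G)=\mathbb{R}_+^{|E|}\times\mathcal{C}_+(G)$. For $(g,\rho)\in\mathcal{A}_+(G)$, $0=\lambda_0(g,\rho)<\lambda_1(g,\rho)\le\lambda_2(g,\rho)\le\cdots$ are the eigenvalues (with multiplicity) of: $-f''=\lambda\rho f$ on edges (derivatives in arclength of $(G,g)$); $f$ continuous on $(G,g)$; and at the vertex $v$ the sum of the derivatives of $f$ at $v$ in the directions pointing out of $v$ into the edges vanishes (each loop contributes both its ends). For $\alpha\in\mathbb{R}$, $$\overline{\lambda_1}^{(\alpha)}(g,\rho)=\lambda_1(g,\rho)\left(\sum_{e\in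 E}g_e^{1-\alpha}\right)\left(\sum_{e\in E}g_e^{\alpha}\int_0^1\rho_e\,dx\right).$$ A minimiser is a pair in $\mathcal{A}_+(G)$ at which the infimum over $\mathcal{A}_+(G)$ is attained. A pair $(g_*,\rho_* )\in\mathcal{A}_+(G)$ is extremal for $F:\mathcal{A}_+(G)\to\mathbb{R}$ if for every smooth one-parameter family $(g(t),\rho(t))\in\mathcal{A}_+(G)$ ($t$ in an open interval around $0$) with $(g(0),\rho(0))=(g_*,\rho_* )$, one has either $F(g(t),\rho(t))\le F(g_*,\rho_* )+o(t)$ as $t\to0$, or $F(g(t),\rho(t))\ge F(g_*,\rho_* )+o(t)$ as $t\to0$. *)

theory Defs
  imports
    "HOL-Analysis.Analysis"
    "HOL-Library.Landau_Symbols"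
    "Graph_Theory.Digraph"
begin

text \<open>
  A finite graph, with loops and multiple edges allowed, is represented by a \<^locale>\<open>fin_digraph\<close>:
  every arc is one undirected edge, and its orientation only records which end of the edge is
  \<open>x = 0\<close> (the tail) and which is \<open>x = 1\<close> (the head). With a single vertex, well-formedness
  makes every arc a loop.
\<close>

definition flower_graph :: "('v, 'e) pre_digraph \<Rightarrow> bool" where
  "flower_graph G \<longleftrightarrow> fin_digraph G \<and> (\<exists>v. verts G = {v})"

text \<open>
  Derivatives of all orders within \<open>S\<close>; on a compact interval this means smooth up to the
  endpoints.
\<close>

definition smooth_within :: "real set \<Rightarrow> (real \<Rightarrow> real) \<Rightarrow> bool" where
  "smooth_within S f \<longleftrightarrow>
     (\<exists>D :: nat \<Rightarrow> real \<Rightarrow> real.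
        (\<forall>x\<in>S. D 0 x = f x) \<and>
        (\<forall>n. \<forall>x\<in>S. (D n has_real_derivative D (Suc n) x) (at x within S)))"

text \<open>
  Joint smoothness on \<open>S \<times> T\<close>: \<open>D i j\<close> is the mixed partial derivative of order \<open>i\<close> in the first
  and \<open>j\<close> in the second variable.
\<close>

definition smooth2_within :: "real set \<Rightarrow> real set \<Rightarrow> (real \<Rightarrow> real \<Rightarrow> real) \<Rightarrow> bool" where
  "smooth2_within S T f \<longleftrightarrow>
     (\<exists>D :: nat \<Rightarrow> nat \<Rightarrow> real \<Rightarrow> real \<Rightarrow> real.
        (\<forall>t\<in>S. \<forall>x\<in>T. D 0 0 t x = f t x) \<and>
        (\<forall>i j. continuous_on (S \<times> T) (\<lambda>(t, x). D i j t x)) \<and>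
        (\<forall>i j. \<forall>t\<in>S. \<forall>x\<in>T.
           ((\<lambda>s. D i j s x) has_real_derivative D (Suc i) j t x) (at t within S) \<and>
           ((\<lambda>y. D i j t y) has_real_derivative D i (Suc j) t x) (at x within T)))"

text \<open>
  Metrics and densities are total functions whose values off the arcs of \<open>G\<close> and off \<open>[0, 1]\<close>
  are irrelevant.
\<close>

definition metrics :: "('v, 'e) pre_digraph \<Rightarrow> ('e \<Rightarrow> real) set" where
  "metrics G = {g. \<forall>e\<in>arcs G. g e > 0}"

definition densities :: "('v, 'e) pre_digraph \<Rightarrow> ('e \<Rightarrow> real \<Rightarrow> real) set" where
  "densities G = {\<rho>. \<forall>e\<in>arcs G. smooth_within {0..1} (\<rho> e) \<and> (\<forall>x\<in>{0..1}. \<rho> e x > 0)}"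

definition admissible :: "('v, 'e) pre_digraph \<Rightarrow> (('e \<Rightarrow> real) \<times> ('e \<Rightarrow> real \<Rightarrow> real)) set" where
  "admissible G = metrics G \<times> densities G"

definition edge_length :: "('e \<Rightarrow> real) \<Rightarrow> 'e \<Rightarrow> real" where
  "edge_length g e = sqrt (g e)"

text \<open>
  A function on the metric graph is given by \<open>u e s\<close> with \<open>s\<close> the arclength on the edge \<open>e\<close>, so
  the density at that point is \<open>\<rho> e (s / edge_length g e)\<close>. Continuity at the vertices is the
  existence of the vertex values \<open>w\<close>, and \<open>u'\<close> is the arclength derivative; at the head of an
  edge the derivative pointing into the edge is \<open>- u'\<close>. For \<open>lam\<close> not an eigenvalue, only \<open>u\<close>
  vanishing on all edges qualify. An isolated vertex would not be seen by \<open>u\<close>, but there is none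
  in a connected graph with an edge.
\<close>

definition eigenspace ::
  "('v, 'e) pre_digraph \<Rightarrow> ('e \<Rightarrow> real) \<Rightarrow> ('e \<Rightarrow> real \<Rightarrow> real) \<Rightarrow> real \<Rightarrow> ('e \<Rightarrow> real \<Rightarrow> real) set" where
  "eigenspace G g \<rho> lam =
     {u. \<exists>u' w.
        (\<forall>e\<in>arcs G. \<forall>s\<in>{0..edge_length g e}.
           (u e has_real_derivative u' e s) (at s within {0..edge_length g e}) \<and>
           (u' e has_real_derivative - (lam * \<rho> e (s / edge_length g e) * u e s))
             (at s within {0..edge_length g e})) \<and>
        (\<forall>e\<in>arcs G. u e 0 = w (tail G e) \<and> u e (edge_length g e) = w (head G e)) \<and>
        (\<forall>v\<in>verts G.
           (\<Sum>e\<in>out_arcs G v. u' e 0) + (\<Sum>e\<in>in_arcs G v. - u' e (edge_length g e)) = 0)}"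

text \<open>Linear independence of \<open>u 0, \<dots>, u (n - 1)\<close> as functions on the metric graph.\<close>

definition lin_indep_on_graph ::
  "('v, 'e) pre_digraph \<Rightarrow> ('e \<Rightarrow> real) \<Rightarrow> nat \<Rightarrow> (nat \<Rightarrow> 'e \<Rightarrow> real \<Rightarrow> real) \<Rightarrow> bool" where
  "lin_indep_on_graph G g n u \<longleftrightarrow>
     (\<forall>c :: nat \<Rightarrow> real.
        (\<forall>e\<in>arcs G. \<forall>s\<in>{0..edge_length g e}. (\<Sum>i<n. c i * u i e s) = 0) \<longrightarrow>
        (\<forall>i<n. c i = 0))"

text \<open>
  The \<open>k\<close>-th eigenvalue, counted from \<open>k = 0\<close> with multiplicity: the least \<open>lam\<close> for which the
  dimensions of the eigenspaces of the eigenvalues up to \<open>lam\<close> add up to at least \<open>k + 1\<close>.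
  Eigenfunctions of distinct eigenvalues are linearly independent, so this says that there are
  \<open>k + 1\<close> linearly independent eigenfunctions with eigenvalues up to \<open>lam\<close>. The spectrum is
  discrete and nonnegative, so the infimum is a minimum.
\<close>

definition eigenvalue ::
  "('v, 'e) pre_digraph \<Rightarrow> nat \<Rightarrow> ('e \<Rightarrow> real) \<Rightarrow> ('e \<Rightarrow> real \<Rightarrow> real) \<Rightarrow> real" where
  "eigenvalue G k g \<rho> =
     Inf {lam. \<exists>u. lin_indep_on_graph G g (Suc k) u \<and>
                   (\<forall>i<Suc k. \<exists>\<mu>\<le>lam. u i \<in> eigenspace G g \<rho> \<mu>)}"

definition normalized_eigenvalue ::
  "('v, 'e) pre_digraph \<Rightarrow> nat \<Rightarrow> real \<Rightarrow> ('e \<Rightarrow> real) \<times> ('e \<Rightarrow> real \<Rightarrow> real) \<Rightarrow> real" where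
  "normalized_eigenvalue G k \<alpha> = (\<lambda>(g, \<rho>).
     eigenvalue G k g \<rho> * (\<Sum>e\<in>arcs G. g e powr (1 - \<alpha>)) *
     (\<Sum>e\<in>arcs G. g e powr \<alpha> * integral {0..1} (\<rho> e)))"

definition smooth_family ::
  "('v, 'e) pre_digraph \<Rightarrow> real set \<Rightarrow> (real \<Rightarrow> ('e \<Rightarrow> real) \<times> ('e \<Rightarrow> real \<Rightarrow> real)) \<Rightarrow> bool" where
  "smooth_family G I \<gamma> \<longleftrightarrow>
     (\<forall>t\<in>I. \<gamma> t \<in> admissible G) \<and>
     (\<forall>e\<in>arcs G. smooth_within I (\<lambda>t. fst (\<gamma> t) e) \<and>
                  smooth2_within I {0..1} (\<lambda>t. snd (\<gamma> t) e))"

definition extremal ::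
  "('v, 'e) pre_digraph \<Rightarrow> (('e \<Rightarrow> real) \<times> ('e \<Rightarrow> real \<Rightarrow> real) \<Rightarrow> real) \<Rightarrow>
   ('e \<Rightarrow> real) \<times> ('e \<Rightarrow> real \<Rightarrow> real) \<Rightarrow> bool" where
  "extremal G F p \<longleftrightarrow>
     p \<in> admissible G \<and>
     (\<forall>a b \<gamma>. a < 0 \<and> 0 < b \<and> smooth_family G {a<..<b} \<gamma> \<and> \<gamma> 0 = p \<longrightarrow>
        (\<exists>r. r \<in> o[at 0](\<lambda>t. t) \<and> (\<forall>\<^sub>F t in at 0. F (\<gamma> t) \<le> F p + r t)) \<or>
        (\<exists>r. r \<in> o[at 0](\<lambda>t. t) \<and> (\<forall>\<^sub>F t in at 0. F (\<gamma> t) \<ge> F p + r t)))"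

end

(* Only the density has to be varied. Let lambda_1 = 1/M, where M is the top eigenvalue of the Green
   operator on functions of mean zero. If a variation h of the density preserves the volume term and
   the integral of h u^2 is negative for every nonzero lambda_1-eigenfunction u, then lambda_1 of
   rho + t h grows at least linearly for t > 0 (almost maximising sequences of the Green form are
   precompact) and falls at least linearly for t < 0 (test function u), so the pair is not extremal.

   To find h, move mass from rho to the vertex end of one edge: this is negative on eigenfunctions that
   vanish at the vertex, with an error of at most C u(v)^2. If some eigenfunction f does not vanish at
   the vertex, the error is compensated on an edge where all eigenfunctions that vanish at the vertex
   are zero: there u = u(v) f, f^2 is not constant, and some k of mean zero has
   integral of k f^2 = -C. Such an edge exists: by the Wronskian with f, an eigenfunction with
   u(v) = 0 that is nonzero on an edge has equal slopes at both ends, hence an interior zero. With two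
   such edges, a combination of one nodal domain from each has mean zero and Rayleigh quotient
   lambda_1, so it is an eigenfunction vanishing on an interval, contradicting uniqueness. *)

theory Submission
  imports Defs "HOL-Complex_Analysis.Great_Picard"
begin

section \<open>Weighted inner products on a family of edges\<close>

text \<open>The obstacle is multiplicity. If lambda_1 is multiple, it need not be differentiable
  along a line of densities; its one-sided slopes are the two extreme values of - lambda_1 times the
  integral of h u^2 over normalised eigenfunctions. A sign of h on the whole eigenspace makes both
  slopes positive, and such a function lies neither below nor above its value at 0 up to o(t). The
  variational problem is posed for the inverse operator because that operator smooths. For a nearly
  maximising f, M f is close to the Green image of f, and Green images are precompact by
  Arzela-Ascoli, so the argument never leaves continuous functions. The single vertex enters through
  the Green operator: a function with one common vertex value is a constant plus a function
  vanishing at all edge ends, so the operator is built edge by edge with zero end values, and the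
  slopes at the vertex balance exactly when the source has mean zero.\<close>

lemma discriminant_le_0:
  fixes a b c :: real
  assumes "\<And>t. 0 \<le> a + 2 * t * b + t\<^sup>2 * c" and "0 \<le> c"
  shows "b\<^sup>2 \<le> a * c"
proof (cases "c = 0")
  case True
  have "b = 0"
  proof (rule ccontr)
    assume "b \<noteq> 0"
    then show False
      using assms(1)[of "- (a + 1) / (2 * b)"] True by (simp add: field_simps)
  qed
  then show ?thesis using True by simp
next
  case False
  then have "c > 0" using assms(2) by simp
  have "0 \<le> c * (a + 2 * (- b / c) * b + (- b / c)\<^sup>2 * c)"
    using assms(1)[of "- b / c"] \<open>c > 0\<close> by (intro mult_nonneg_nonneg) auto
  also have "\<dots> = a * c - b\<^sup>2"
    using \<open>c > 0\<close> by (simp add: field_simps power2_eq_square)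
  finally show ?thesis by simp
qed

text \<open>Gronwall for \<open>u^2 + u'^2\<close>, whose derivative is in absolute value at most
  \<open>c\<close> times itself. The zero may lie anywhere in the interval, so one exponential
  factor serves the points to its right and the reciprocal one those to its left.\<close>

lemma linear_second_order_zero:
  fixes u u' k :: "real \<Rightarrow> real"
  assumes ode: "\<And>s. s \<in> {a..b} \<Longrightarrow> (u has_real_derivative u' s) (at s within {a..b})"
      "\<And>s. s \<in> {a..b} \<Longrightarrow> (u' has_real_derivative k s * u s) (at s within {a..b})"
    and k: "continuous_on {a..b} k"
    and z: "z \<in> {a..b}" "u z = 0" "u' z = 0" and x: "x \<in> {a..b}"
  shows "u x = 0 \<and> u' x = 0"
proof -
  obtain B where B: "\<And>s. s \<in> {a..b} \<Longrightarrow> \<bar>k s\<bar> \<le> B" and "B \<ge> 0"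
  proof -
    have "bounded (k ` {a..b})"
      using k compact_continuous_image compact_imp_bounded by blast
    then obtain B0 where "\<forall>y\<in>k ` {a..b}. norm y \<le> B0"
      unfolding bounded_iff by blast
    then have B0: "\<bar>k s\<bar> \<le> B0" if "s \<in> {a..b}" for s
      using that by auto
    show ?thesis
      using that[of B0] B0 order_trans[OF abs_ge_zero B0[OF z(1)]] by blast
  qed
  define c where "c = 1 + B"
  define N where "N = (\<lambda>s. (u s)\<^sup>2 + (u' s)\<^sup>2)"
  define N' where "N' = (\<lambda>s. 2 * u s * u' s + 2 * u' s * (k s * u s))"
  have N: "(N has_real_derivative N' s) (at s within {a..b})" if "s \<in> {a..b}" for s
    unfolding N_def N'_def using that
    by (auto intro!: derivative_eq_intros ode)
  have N': "\<bar>N' s\<bar> \<le> c * N s" if "s \<in> {a..b}" for s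
  proof -
    have "N' s = 2 * u s * u' s * (1 + k s)"
      unfolding N'_def by (simp add: algebra_simps)
    then have "\<bar>N' s\<bar> = (2 * \<bar>u s\<bar> * \<bar>u' s\<bar>) * \<bar>1 + k s\<bar>"
      by (simp add: abs_mult)
    also have "\<dots> \<le> N s * c"
    proof (rule mult_mono)
      show "2 * \<bar>u s\<bar> * \<bar>u' s\<bar> \<le> N s"
        unfolding N_def using sum_squares_bound[of "\<bar>u s\<bar>" "\<bar>u' s\<bar>"] by simp
      show "\<bar>1 + k s\<bar> \<le> c" using B[OF that] unfolding c_def by linarith
    qed (auto simp: N_def)
    finally show ?thesis by (simp add: mult.commute)
  qed
  have Nz: "N z = 0" using z by (simp add: N_def)
  have "N x \<le> 0"
  proof (cases "z \<le> x")
    case True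
    define P where "P = (\<lambda>s. N s * exp (- c * s))"
    have "P x \<le> P z"
    proof (rule DERIV_nonpos_imp_decreasing_open[OF True])
      fix s assume s: "z < s" "s < x"
      then have s': "s \<in> {a<..<b}" using z(1) x by auto
      have at: "at s within {a..b} = at s" using s' by (simp add: at_within_Icc_at)
      have "(P has_real_derivative (N' s - c * N s) * exp (- c * s)) (at s)"
        unfolding P_def using N[of s] s' at
        by (auto intro!: derivative_eq_intros simp: algebra_simps)
      moreover have "(N' s - c * N s) * exp (- c * s) \<le> 0"
        using N'[of s] s' by (intro mult_nonpos_nonneg) auto
      ultimately show "\<exists>y. (P has_real_derivative y) (at s) \<and> y \<le> 0" by blast
    next
      have "continuous_on {a..b} N"
        using N by (meson DERIV_continuous continuous_on_eq_continuous_within)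
      then show "continuous_on {z..x} P"
        unfolding P_def using z(1) x
        by (intro continuous_intros) (auto elim: continuous_on_subset)
    qed
    then show ?thesis by (simp add: P_def Nz mult_le_0_iff not_le)
  next
    case False
    then have xz: "x \<le> z" by simp
    define P where "P = (\<lambda>s. N s * exp (c * s))"
    have "P x \<le> P z"
    proof (rule DERIV_nonneg_imp_increasing_open[OF xz])
      fix s assume s: "x < s" "s < z"
      then have s': "s \<in> {a<..<b}" using z(1) x by auto
      have at: "at s within {a..b} = at s" using s' by (simp add: at_within_Icc_at)
      have "(P has_real_derivative (N' s + c * N s) * exp (c * s)) (at s)"
        unfolding P_def using N[of s] s' at
        by (auto intro!: derivative_eq_intros simp: algebra_simps)
      moreover have "(N' s + c * N s) * exp (c * s) \<ge> 0"
        using N'[of s] s' by (intro mult_nonneg_nonneg) auto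
      ultimately show "\<exists>y. (P has_real_derivative y) (at s) \<and> 0 \<le> y" by blast
    next
      have "continuous_on {a..b} N"
        using N by (meson DERIV_continuous continuous_on_eq_continuous_within)
      then show "continuous_on {x..z} P"
        unfolding P_def using z(1) x
        by (intro continuous_intros) (auto elim: continuous_on_subset)
    qed
    then show ?thesis by (simp add: P_def Nz mult_le_0_iff not_le)
  qed
  moreover have "(u x)\<^sup>2 + (u' x)\<^sup>2 \<ge> 0" by simp
  ultimately show ?thesis
    unfolding N_def by (simp add: sum_power2_le_zero_iff)
qed

text \<open>The end terms are kept because test functions need only agree at the vertex: summed over
  the edges, these terms become the vertex condition or the total integral of the source.\<close>

lemma integral_by_parts_vanishing:
  fixes v v' F \<phi> \<phi>' :: "real \<Rightarrow> real"
  assumes "a \<le> b"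
    and v: "\<And>s. s \<in> {a..b} \<Longrightarrow> (v' has_real_derivative F s) (at s within {a..b})"
    and phi: "\<And>s. s \<in> {a..b} \<Longrightarrow> (\<phi> has_real_derivative \<phi>' s) (at s within {a..b})"
    and cont: "continuous_on {a..b} \<phi>'" "continuous_on {a..b} F"
  shows "integral {a..b} (\<lambda>s. v' s * \<phi>' s)
       = v' b * \<phi> b - v' a * \<phi> a - integral {a..b} (\<lambda>s. F s * \<phi> s)"
proof -
  have c: "continuous_on {a..b} v'" "continuous_on {a..b} \<phi>"
    using v phi by (meson DERIV_continuous continuous_on_eq_continuous_within)+
  have "((\<lambda>s. F s * \<phi> s + v' s * \<phi>' s) has_integral (v' b * \<phi> b - v' a * \<phi> a)) {a..b}"
    using \<open>a \<le> b\<close> 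
    by (intro fundamental_theorem_of_calculus)
       (auto simp: has_real_derivative_iff_has_vector_derivative[symmetric] algebra_simps
             intro!: derivative_eq_intros v phi)
  then have "integral {a..b} (\<lambda>s. F s * \<phi> s + v' s * \<phi>' s) = v' b * \<phi> b - v' a * \<phi> a"
    by (rule integral_unique)
  moreover have "integral {a..b} (\<lambda>s. F s * \<phi> s + v' s * \<phi>' s)
     = integral {a..b} (\<lambda>s. F s * \<phi> s) + integral {a..b} (\<lambda>s. v' s * \<phi>' s)"
    by (intro integral_add integrable_continuous_interval continuous_intros c cont)
  ultimately show ?thesis by simp
qed

text \<open>Induction over the edges, thinning the sequence once per edge; heredity of
  \<open>P\<close> under thinning preserves what was reached for earlier edges.\<close>

lemma finite_common_subsequence:
  fixes P :: "'e \<Rightarrow> (nat \<Rightarrow> nat) \<Rightarrow> bool"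
  assumes "finite E"
    and "\<And>e (r :: nat \<Rightarrow> nat). e \<in> E \<Longrightarrow> strict_mono r \<Longrightarrow> \<exists>k. strict_mono k \<and> P e (r \<circ> k)"
    and "\<And>e r (k :: nat \<Rightarrow> nat). e \<in> E \<Longrightarrow> P e r \<Longrightarrow> strict_mono k \<Longrightarrow> P e (r \<circ> k)"
  shows "\<exists>r. strict_mono r \<and> (\<forall>e\<in>E. P e r)"
  using assms
proof (induction E rule: finite_induct)
  case empty
  show ?case by (intro exI[of _ "\<lambda>n. n"]) (auto simp: strict_mono_def)
next
  case (insert e E)
  then obtain r where r: "strict_mono r" "\<forall>e\<in>E. P e r" by auto
  obtain k where k: "strict_mono k" "P e (r \<circ> k)"
    using insert.prems(1)[OF insertI1 r(1)] by blast
  then have "strict_mono (r \<circ> k)" using r(1) by (simp add: strict_mono_o)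
  then show ?case
    using k r insert.prems(2) by blast
qed

section \<open>Quadratic forms with a variable weight\<close>

locale edge_family =
  fixes E :: "'e set" and L :: "'e \<Rightarrow> real"
  assumes finite_E: "finite E" and E_nonempty: "E \<noteq> {}"
    and L_pos: "\<And>e. e \<in> E \<Longrightarrow> 0 < L e"
begin

definition edge_cont :: "('e \<Rightarrow> real \<Rightarrow> real) \<Rightarrow> bool" where
  "edge_cont f \<longleftrightarrow> (\<forall>e\<in>E. continuous_on {0..L e} (f e))"

text \<open>One form in three roles: with the density as weight it is the L2 product, with weight
  \<open>one\<close> and derivatives it is the Dirichlet energy, and with a variation
  \<open>h\<close> of the density it is the first-order change of the squared norm. The weight may
  therefore change sign, and positivity is assumed lemma by lemma.\<close>

definition W :: "('e \<Rightarrow> real \<Rightarrow> real) \<Rightarrow> ('e \<Rightarrow> real \<Rightarrow> real) \<Rightarrow> ('e \<Rightarrow> real \<Rightarrow> real) \<Rightarrow> real" where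
  "W k f g = (\<Sum>e\<in>E. integral {0..L e} (\<lambda>s. k e s * (f e s * g e s)))"

abbreviation one :: "'e \<Rightarrow> real \<Rightarrow> real" where "one \<equiv> \<lambda>e s. 1"

lemma edge_contD: "edge_cont f \<Longrightarrow> e \<in> E \<Longrightarrow> continuous_on {0..L e} (f e)"
  by (simp add: edge_cont_def)

lemma edge_cont_const [simp]: "edge_cont (\<lambda>e s. c)"
  by (simp add: edge_cont_def)

lemma edge_cont_lincomb:
  "edge_cont f \<Longrightarrow> edge_cont g \<Longrightarrow> edge_cont (\<lambda>e s. a * f e s + b * g e s)"
  unfolding edge_cont_def by (auto intro!: continuous_intros)

lemma edge_cont_diff: "edge_cont f \<Longrightarrow> edge_cont g \<Longrightarrow> edge_cont (\<lambda>e s. f e s - g e s)"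
  unfolding edge_cont_def by (auto intro!: continuous_intros)

lemma edge_cont_cmult: "edge_cont f \<Longrightarrow> edge_cont (\<lambda>e s. a * f e s)"
  unfolding edge_cont_def by (auto intro!: continuous_intros)

lemma W_commute: "W k f g = W k g f"
  unfolding W_def by (simp add: mult.commute)

lemma W_cong:
  assumes "\<And>e s. e \<in> E \<Longrightarrow> s \<in> {0..L e} \<Longrightarrow> k e s * (f e s * g e s) = k' e s * (f' e s * g' e s)"
  shows "W k f g = W k' f' g'"
  unfolding W_def using assms by (intro sum.cong integral_cong) auto

lemma W_lincomb_left:
  assumes "edge_cont k" "edge_cont f" "edge_cont g" "edge_cont h"
  shows "W k (\<lambda>e s. a * f e s + b * g e s) h = a * W k f h + b * W k g h"
proof -
  have "integral {0..L e} (\<lambda>s. k e s * ((a * f e s + b * g e s) * h e s))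
      = a * integral {0..L e} (\<lambda>s. k e s * (f e s * h e s)) +
        b * integral {0..L e} (\<lambda>s. k e s * (g e s * h e s))" if "e \<in> E" for e
  proof -
    have i: "(\<lambda>s. k e s * (f e s * h e s)) integrable_on {0..L e}"
            "(\<lambda>s. k e s * (g e s * h e s)) integrable_on {0..L e}"
      using assms[THEN edge_contD, OF that]
      by (auto intro!: integrable_continuous_interval continuous_on_mult)
    have "integral {0..L e} (\<lambda>s. k e s * ((a * f e s + b * g e s) * h e s))
        = integral {0..L e} (\<lambda>s. a * (k e s * (f e s * h e s)) + b * (k e s * (g e s * h e s)))"
      by (simp add: algebra_simps)
    also have "\<dots> = a * integral {0..L e} (\<lambda>s. k e s * (f e s * h e s)) +
        b * integral {0..L e} (\<lambda>s. k e s * (g e s * h e s))"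
      using i by (simp add: integral_add integrable_on_mult_right)
    finally show ?thesis .
  qed
  then show ?thesis
    unfolding W_def by (simp add: sum.distrib sum_distrib_left)
qed

lemma W_lincomb_right:
  assumes "edge_cont k" "edge_cont f" "edge_cont g" "edge_cont h"
  shows "W k h (\<lambda>e s. a * f e s + b * g e s) = a * W k h f + b * W k h g"
  using W_lincomb_left[OF assms] by (simp add: W_commute)

text \<open>The integrand is a product of three functions, so the weight can trade places with an
  argument, and linearity in an argument gives linearity in the weight.\<close>

lemma W_lincomb_weight:
  assumes "edge_cont k" "edge_cont k'" "edge_cont f" "edge_cont g"
  shows "W (\<lambda>e s. a * k e s + b * k' e s) f g = a * W k f g + b * W k' f g"
proof -
  have "W (\<lambda>e s. a * k e s + b * k' e s) f g
      = W g (\<lambda>e s. a * k e s + b * k' e s) f"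
    by (rule W_cong) (simp add: algebra_simps)
  also have "\<dots> = a * W g k f + b * W g k' f"
    using assms by (intro W_lincomb_left)
  also have "W g k f = W k f g" by (rule W_cong) simp
  also have "W g k' f = W k' f g" by (rule W_cong) simp
  finally show ?thesis .
qed

lemma W_lincomb_square:
  assumes "edge_cont k" "edge_cont f" "edge_cont g"
  shows "W k (\<lambda>e s. a * f e s + b * g e s) (\<lambda>e s. a * f e s + b * g e s)
       = a\<^sup>2 * W k f f + 2 * a * b * W k f g + b\<^sup>2 * W k g g"
  using assms
  by (simp add: W_lincomb_left W_lincomb_right edge_cont_lincomb W_commute[of k g f]
      algebra_simps power2_eq_square)

lemma W_cmult_left: "W k (\<lambda>e s. a * f e s) g = a * W k f g"
proof -
  have "W k (\<lambda>e s. a * f e s) g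
      = (\<Sum>e\<in>E. integral {0..L e} (\<lambda>s. a * (k e s * (f e s * g e s))))"
    unfolding W_def by (simp add: algebra_simps)
  then show ?thesis unfolding W_def by (simp add: sum_distrib_left)
qed

lemma W_cmult_square: "W k (\<lambda>e s. a * f e s) (\<lambda>e s. a * f e s) = a\<^sup>2 * W k f f"
  using W_cmult_left[of k a f "\<lambda>e s. a * f e s"] W_cmult_left[of k a f f]
    W_commute[of k f "\<lambda>e s. a * f e s"]
  by (simp add: power2_eq_square)

lemma W_mono_weight:
  assumes "edge_cont k" "edge_cont k'" "edge_cont f"
    and "\<And>e s. e \<in> E \<Longrightarrow> s \<in> {0..L e} \<Longrightarrow> k e s \<le> k' e s"
  shows "W k f f \<le> W k' f f"
  unfolding W_def
proof (rule sum_mono)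
  fix e assume e: "e \<in> E"
  show "integral {0..L e} (\<lambda>s. k e s * (f e s * f e s)) \<le> integral {0..L e} (\<lambda>s. k' e s * (f e s * f e s))"
    using assms(4)[OF e] assms(1-3)[THEN edge_contD, OF e]
    by (intro integral_le integrable_continuous_interval continuous_on_mult)
       (auto intro!: mult_right_mono)
qed

lemma W_nonneg:
  assumes "edge_cont k" "edge_cont f" "\<And>e s. e \<in> E \<Longrightarrow> s \<in> {0..L e} \<Longrightarrow> 0 \<le> k e s"
  shows "0 \<le> W k f f"
proof -
  have "W (\<lambda>e s. 0) f f \<le> W k f f"
    using assms by (intro W_mono_weight) auto
  then show ?thesis by (simp add: W_def)
qed

lemma W_eq_0D:
  assumes k: "edge_cont k" and f: "edge_cont f"
    and pos: "\<And>e s. e \<in> E \<Longrightarrow> s \<in> {0..L e} \<Longrightarrow> 0 < k e s"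
    and W0: "W k f f = 0" and e: "e \<in> E" and s: "s \<in> {0..L e}"
  shows "f e s = 0"
proof -
  have nn: "0 \<le> integral {0..L e} (\<lambda>s. k e s * (f e s * f e s))" if "e \<in> E" for e
    using pos[OF that] edge_contD[OF k that] edge_contD[OF f that]
    by (intro Henstock_Kurzweil_Integration.integral_nonneg
          integrable_continuous_interval continuous_on_mult)
       (auto intro!: mult_nonneg_nonneg simp: less_imp_le)
  have "integral {0..L e} (\<lambda>s. k e s * (f e s * f e s)) = 0"
    using W0 nn e unfolding W_def by (simp add: sum_nonneg_eq_0_iff finite_E)
  then have "\<forall>s\<in>{0..L e}. k e s * (f e s * f e s) = 0"
    using pos[OF e] edge_contD[OF k e] edge_contD[OF f e] L_pos[OF e]
    by (subst (asm) integral_eq_0_iff)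
       (auto intro!: continuous_on_mult mult_nonneg_nonneg simp: less_imp_le)
  then have "k e s * (f e s * f e s) = 0" using s by blast
  then show ?thesis using pos[OF e s] by auto
qed

lemma W_pos:
  assumes "edge_cont k" "edge_cont f"
    "\<And>e s. e \<in> E \<Longrightarrow> s \<in> {0..L e} \<Longrightarrow> 0 < k e s"
    and "e \<in> E" "s \<in> {0..L e}" "f e s \<noteq> 0"
  shows "0 < W k f f"
  using W_nonneg[of k f] W_eq_0D[of k f e s] assms by (force simp: less_le)

lemma W_Cauchy_Schwarz:
  assumes "edge_cont k" "edge_cont f" "edge_cont g"
    "\<And>e s. e \<in> E \<Longrightarrow> s \<in> {0..L e} \<Longrightarrow> 0 \<le> k e s"
  shows "(W k f g)\<^sup>2 \<le> W k f f * W k g g"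
proof (rule discriminant_le_0)
  fix t
  have "0 \<le> W k (\<lambda>e s. 1 * f e s + t * g e s) (\<lambda>e s. 1 * f e s + t * g e s)"
    using assms by (intro W_nonneg edge_cont_lincomb) auto
  then show "0 \<le> W k f f + 2 * t * W k f g + t\<^sup>2 * W k g g"
    unfolding W_lincomb_square[OF assms(1-3)] by simp
next
  show "0 \<le> W k g g" using assms by (intro W_nonneg) auto
qed

text \<open>Expansion around \<open>x\<close> leaves the form of the difference and a cross term,
  which Cauchy-Schwarz bounds by the root of the former. \<open>W_signed_continuous\<close> reduces
  signed weights to this case.\<close>

lemma W_square_continuous:
  assumes k: "edge_cont k" "\<And>e s. e \<in> E \<Longrightarrow> s \<in> {0..L e} \<Longrightarrow> 0 \<le> k e s"
    and f: "\<And>n::nat. edge_cont (f n)" and x: "edge_cont x"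
    and lim: "(\<lambda>n. W k (\<lambda>e s. f n e s - x e s) (\<lambda>e s. f n e s - x e s)) \<longlonglongrightarrow> 0"
  shows "(\<lambda>n. W k (f n) (f n)) \<longlonglongrightarrow> W k x x"
proof -
  define d where "d n e s = f n e s - x e s" for n e s
  have d: "edge_cont (d n)" for n
    unfolding d_def using f x by (intro edge_cont_diff)
  have split: "W k (f n) (f n) = W k (d n) (d n) + 2 * W k (d n) x + W k x x" for n
  proof -
    have "f n = (\<lambda>e s. 1 * d n e s + 1 * x e s)" by (simp add: d_def)
    then show ?thesis using W_lincomb_square[OF k(1) d[of n] x, of 1 1] by simp
  qed
  have "(\<lambda>n. W k (d n) x) \<longlonglongrightarrow> 0"
  proof (rule Lim_null_comparison)
    show "\<forall>\<^sub>F n in sequentially. norm (W k (d n) x) \<le> sqrt (W k (d n) (d n) * W k x x)"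
    proof (rule eventuallyI)
      fix n
      show "norm (W k (d n) x) \<le> sqrt (W k (d n) (d n) * W k x x)"
        using W_Cauchy_Schwarz[OF k(1) d x k(2)] by (simp add: real_le_rsqrt)
    qed
    have "(\<lambda>n. sqrt (W k (d n) (d n) * W k x x)) \<longlonglongrightarrow> sqrt (0 * W k x x)"
      using lim unfolding d_def by (intro tendsto_intros)
    then show "(\<lambda>n. sqrt (W k (d n) (d n) * W k x x)) \<longlonglongrightarrow> 0" by simp
  qed
  then have "(\<lambda>n. W k (d n) (d n) + 2 * W k (d n) x + W k x x) \<longlonglongrightarrow> 0 + 2 * 0 + W k x x"
    using lim unfolding d_def by (intro tendsto_intros)
  then show ?thesis by (simp add: split)
qed

end

section \<open>The Green operator of a flower graph\<close>

context edge_family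
begin

text \<open>Trial functions for the Rayleigh quotient. The loops share one vertex, so continuity
  there is a single number \<open>w\<close> taken at both ends of every edge.\<close>

definition vertex_C1 ::
    "('e \<Rightarrow> real \<Rightarrow> real) \<Rightarrow> ('e \<Rightarrow> real \<Rightarrow> real) \<Rightarrow> real \<Rightarrow> bool" where
  "vertex_C1 u u' w \<longleftrightarrow> edge_cont u' \<and>
     (\<forall>e\<in>E. (\<forall>s\<in>{0..L e}. (u e has_real_derivative u' e s) (at s within {0..L e})) \<and>
             u e 0 = w \<and> u e (L e) = w)"

lemma vertex_C1_edge_cont: "vertex_C1 u u' w \<Longrightarrow> edge_cont u"
  unfolding vertex_C1_def edge_cont_def
  by (meson DERIV_continuous continuous_on_eq_continuous_within)

lemma vertex_C1_lincomb:
  assumes "vertex_C1 u u' w" "vertex_C1 v v' z"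
  shows "vertex_C1 (\<lambda>e s. a * u e s + b * v e s) (\<lambda>e s. a * u' e s + b * v' e s) (a * w + b * z)"
  using assms unfolding vertex_C1_def
  by (auto intro!: edge_cont_lincomb derivative_eq_intros)

lemma vertex_C1_const: "vertex_C1 (\<lambda>e s. c) (\<lambda>e s. 0) c"
  unfolding vertex_C1_def by auto

end

text \<open>The density is a locale parameter so that the whole theory can be instantiated again at
  a perturbed density on the same edges.\<close>

locale weighted_edges = edge_family +
  fixes \<sigma> :: "'a \<Rightarrow> real \<Rightarrow> real"
  assumes \<sigma>_cont: "edge_cont \<sigma>"
    and \<sigma>_pos: "\<And>e s. e \<in> E \<Longrightarrow> s \<in> {0..L e} \<Longrightarrow> 0 < \<sigma> e s"
begin

lemma \<sigma>_nonneg: "e \<in> E \<Longrightarrow> s \<in> {0..L e} \<Longrightarrow> 0 \<le> \<sigma> e s"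
  using \<sigma>_pos by (simp add: less_imp_le)

definition prim1 where "prim1 f e s = integral {0..s} (\<lambda>y. \<sigma> e y * f e y)"
definition prim2 where "prim2 f e s = integral {0..s} (prim1 f e)"

text \<open>The solution of \<open>- v'' = \<sigma> f\<close> vanishing at the vertex, and its derivative.\<close>

definition green where "green f e s = s / L e * prim2 f e (L e) - prim2 f e s"
definition green' where "green' f e s = prim2 f e (L e) / L e - prim1 f e s"

lemma prim1_deriv:
  assumes "edge_cont f" "e \<in> E" "s \<in> {0..L e}"
  shows "(prim1 f e has_real_derivative \<sigma> e s * f e s) (at s within {0..L e})"
  unfolding prim1_def
  using integral_has_real_derivative[of 0 "L e" "\<lambda>y. \<sigma> e y * f e y" s] assms \<sigma>_cont
  by (auto intro!: continuous_on_mult edge_contD simp del: has_field_derivative_def)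

lemma prim1_cont: "edge_cont f \<Longrightarrow> edge_cont (prim1 f)"
  unfolding edge_cont_def[of "prim1 f"] using prim1_deriv
  by (meson DERIV_continuous continuous_on_eq_continuous_within)

lemma prim2_deriv:
  assumes "edge_cont f" "e \<in> E" "s \<in> {0..L e}"
  shows "(prim2 f e has_real_derivative prim1 f e s) (at s within {0..L e})"
  unfolding prim2_def
  using integral_has_real_derivative[of 0 "L e" "prim1 f e" s] assms edge_contD[OF prim1_cont]
  by auto

lemma green_deriv:
  assumes "edge_cont f" "e \<in> E" "s \<in> {0..L e}"
  shows "(green f e has_real_derivative green' f e s) (at s within {0..L e})"
  unfolding green_def green'_def using L_pos[OF assms(2)]
  by (auto intro!: derivative_eq_intros prim2_deriv assms)

lemma green'_deriv:
  assumes "edge_cont f" "e \<in> E" "s \<in> {0..L e}"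
  shows "(green' f e has_real_derivative - (\<sigma> e s * f e s)) (at s within {0..L e})"
  unfolding green'_def by (auto intro!: derivative_eq_intros prim1_deriv assms)

lemma green'_cont: "edge_cont f \<Longrightarrow> edge_cont (green' f)"
  unfolding edge_cont_def[of "green' f"] using green'_deriv
  by (meson DERIV_continuous continuous_on_eq_continuous_within)

lemma green_vertex: "e \<in> E \<Longrightarrow> green f e 0 = 0 \<and> green f e (L e) = 0"
  using L_pos[of e] by (simp add: green_def prim2_def)

lemma vertex_C1_green: "edge_cont f \<Longrightarrow> vertex_C1 (green f) (green' f) 0"
  unfolding vertex_C1_def using green'_cont green_deriv green_vertex by auto

lemma green_cont: "edge_cont f \<Longrightarrow> edge_cont (green f)"
  using vertex_C1_green vertex_C1_edge_cont by blast

lemma prim1_lincomb: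
  assumes "edge_cont f" "edge_cont g" "e \<in> E" "s \<in> {0..L e}"
  shows "prim1 (\<lambda>e s. a * f e s + b * g e s) e s = a * prim1 f e s + b * prim1 g e s"
proof -
  have sub: "{0..s} \<subseteq> {0..L e}" using assms(4) by auto
  have i: "(\<lambda>y. \<sigma> e y * h e y) integrable_on {0..s}" if "edge_cont h" for h
    using continuous_on_subset[OF edge_contD[OF \<sigma>_cont assms(3)] sub]
      continuous_on_subset[OF edge_contD[OF that assms(3)] sub]
    by (auto intro!: integrable_continuous_interval continuous_on_mult)
  have "prim1 (\<lambda>e s. a * f e s + b * g e s) e s
      = integral {0..s} (\<lambda>y. a * (\<sigma> e y * f e y) + b * (\<sigma> e y * g e y))"
    unfolding prim1_def by (simp add: algebra_simps)
  also have "\<dots> = a * prim1 f e s + b * prim1 g e s"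
    unfolding prim1_def using i[OF assms(1)] i[OF assms(2)]
    by (simp add: integral_add integrable_on_mult_right)
  finally show ?thesis .
qed

lemma prim2_lincomb:
  assumes "edge_cont f" "edge_cont g" "e \<in> E" "s \<in> {0..L e}"
  shows "prim2 (\<lambda>e s. a * f e s + b * g e s) e s = a * prim2 f e s + b * prim2 g e s"
proof -
  have sub: "{0..s} \<subseteq> {0..L e}" using assms(4) by auto
  have i: "prim1 h e integrable_on {0..s}" if "edge_cont h" for h
    using continuous_on_subset[OF edge_contD[OF prim1_cont[OF that] assms(3)] sub]
    by (rule integrable_continuous_interval)
  have "prim2 (\<lambda>e s. a * f e s + b * g e s) e s
      = integral {0..s} (\<lambda>y. a * prim1 f e y + b * prim1 g e y)"
    unfolding prim2_def using sub
    by (intro integral_cong prim1_lincomb assms) auto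
  also have "\<dots> = a * prim2 f e s + b * prim2 g e s"
    unfolding prim2_def using i[OF assms(1)] i[OF assms(2)]
    by (simp add: integral_add integrable_on_mult_right)
  finally show ?thesis .
qed

lemma green'_lincomb:
  assumes "edge_cont f" "edge_cont g" "e \<in> E" "s \<in> {0..L e}"
  shows "green' (\<lambda>e s. a * f e s + b * g e s) e s = a * green' f e s + b * green' g e s"
  using prim1_lincomb[OF assms] prim2_lincomb[OF assms(1-3), of "L e"] L_pos[OF assms(3)]
  unfolding green'_def by (simp add: field_simps)

lemma prim1_L: "W \<sigma> f one = (\<Sum>e\<in>E. prim1 f e (L e))"
  unfolding W_def prim1_def by simp

text \<open>Integration by parts on each edge. The slope of \<open>green f\<close> drops along an
  edge by the integral of \<open>\<sigma> f\<close> over it, so with the common end value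
  \<open>w\<close> the end terms add up to \<open>- w\<close> times the total integral. For a source
  of mean zero this vanishes: the slopes at the vertex balance by themselves.\<close>

lemma green_identity:
  assumes f: "edge_cont f" and u: "vertex_C1 u u' w"
  shows "W one (green' f) u' = W \<sigma> f u - w * W \<sigma> f one"
proof -
  have "integral {0..L e} (\<lambda>s. green' f e s * u' e s)
     = integral {0..L e} (\<lambda>s. \<sigma> e s * (f e s * u e s)) - w * prim1 f e (L e)" if e: "e \<in> E" for e
  proof -
    have "integral {0..L e} (\<lambda>s. green' f e s * u' e s)
        = green' f e (L e) * u e (L e) - green' f e 0 * u e 0
          - integral {0..L e} (\<lambda>s. - (\<sigma> e s * f e s) * u e s)"
    proof (rule integral_by_parts_vanishing)
      show "0 \<le> L e" using L_pos[OF e] by simp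
      show "(green' f e has_real_derivative - (\<sigma> e s * f e s)) (at s within {0..L e})"
        if "s \<in> {0..L e}" for s using green'_deriv[OF f e that] .
      show "(u e has_real_derivative u' e s) (at s within {0..L e})"
        if "s \<in> {0..L e}" for s using u e that by (auto simp: vertex_C1_def)
      show "continuous_on {0..L e} (u' e)"
        using u e by (auto simp: vertex_C1_def edge_cont_def)
      show "continuous_on {0..L e} (\<lambda>s. - (\<sigma> e s * f e s))"
        using edge_contD[OF \<sigma>_cont e] edge_contD[OF f e]
        by (intro continuous_intros)
    qed
    also have "\<dots> = - w * prim1 f e (L e) + integral {0..L e} (\<lambda>s. \<sigma> e s * (f e s * u e s))"
      using u e unfolding vertex_C1_def green'_def
      by (simp add: algebra_simps) (simp add: prim1_def)
    finally show ?thesis by simp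
  qed
  then show ?thesis
    unfolding prim1_L by (simp add: W_def sum_subtractf sum_distrib_left)
qed

section \<open>Mean-zero functions and the Green form\<close>

definition mass where "mass = W \<sigma> one one"

lemma mass_pos: "0 < mass"
proof -
  obtain e where "e \<in> E" using E_nonempty by auto
  then show ?thesis
    unfolding mass_def using W_pos[OF \<sigma>_cont _ \<sigma>_pos, of one e 0] L_pos[of e] by auto
qed

definition mean_zero where "mean_zero f \<longleftrightarrow> edge_cont f \<and> W \<sigma> f one = 0"

definition center where "center f e s = f e s - W \<sigma> f one / mass"

lemma center_eq: "center f = (\<lambda>e s. 1 * f e s + (- (W \<sigma> f one / mass)) * one e s)"
  by (simp add: center_def fun_eq_iff)

lemma mean_zero_center: "edge_cont f \<Longrightarrow> mean_zero (center f)"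
  unfolding mean_zero_def center_eq using mass_pos
  by (subst W_lincomb_left) (auto intro!: edge_cont_diff simp: \<sigma>_cont mass_def[symmetric])

lemma mean_zero_lincomb:
  "mean_zero f \<Longrightarrow> mean_zero g \<Longrightarrow> mean_zero (\<lambda>e s. a * f e s + b * g e s)"
  unfolding mean_zero_def by (auto intro!: edge_cont_lincomb simp: W_lincomb_left \<sigma>_cont)

lemma W_center_left:
  assumes "edge_cont f" "mean_zero g"
  shows "W \<sigma> (center f) g = W \<sigma> f g"
proof -
  have "W \<sigma> one g = 0" using assms by (simp add: mean_zero_def W_commute)
  then show ?thesis
    unfolding center_eq using assms
    by (subst W_lincomb_left) (auto simp: \<sigma>_cont mean_zero_def)
qed

text \<open>Variance formula. In the perturbation argument the subtracted square is of second order,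
  which keeps recentring harmless.\<close>

lemma W_center_square:
  assumes "edge_cont f"
  shows "W \<sigma> (center f) (center f) = W \<sigma> f f - (W \<sigma> f one)\<^sup>2 / mass"
  unfolding center_eq using assms mass_pos
  by (subst W_lincomb_square) (auto simp: \<sigma>_cont mass_def[symmetric] field_simps power2_eq_square)

definition form where "form f g = W one (green' f) (green' g)"

text \<open>\<open>green_identity\<close> with the test function \<open>green f\<close>, whose
  vertex value is 0. On mean-zero functions \<open>green\<close> followed by \<open>center\<close>
  is thus a symmetric operator with quadratic form \<open>form\<close>; the centring is what maps
  this space into itself.\<close>

lemma form_eq:
  assumes "mean_zero f" "mean_zero g"
  shows "form f g = W \<sigma> (center (green f)) g"
proof -
  have "form f g = W one (green' g) (green' f)" by (simp add: form_def W_commute)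
  also have "\<dots> = W \<sigma> g (green f)"
    using green_identity[of g "green f" "green' f" 0] vertex_C1_green assms
    by (simp add: mean_zero_def)
  also have "\<dots> = W \<sigma> (center (green f)) g"
    using W_center_left[of "green f" g] assms green_cont
    by (simp add: W_commute mean_zero_def)
  finally show ?thesis .
qed

lemma form_lincomb_square:
  assumes "edge_cont f" "edge_cont g"
  shows "form (\<lambda>e s. a * f e s + b * g e s) (\<lambda>e s. a * f e s + b * g e s)
       = a\<^sup>2 * form f f + 2 * a * b * form f g + b\<^sup>2 * form g g"
proof -
  have "form (\<lambda>e s. a * f e s + b * g e s) (\<lambda>e s. a * f e s + b * g e s)
     = W one (\<lambda>e s. a * green' f e s + b * green' g e s) (\<lambda>e s. a * green' f e s + b * green' g e s)"
    unfolding form_def by (rule W_cong) (simp add: green'_lincomb assms)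
  then show ?thesis
    unfolding form_def using assms by (simp add: W_lincomb_square green'_cont)
qed

lemma form_nonneg: "edge_cont f \<Longrightarrow> 0 \<le> form f f"
  unfolding form_def by (intro W_nonneg green'_cont) auto

section \<open>A priori bounds for Green images\<close>

lemma W_bound:
  assumes "edge_cont f" "\<And>e s. e \<in> E \<Longrightarrow> s \<in> {0..L e} \<Longrightarrow> \<bar>f e s\<bar> \<le> B"
  shows "W \<sigma> f f \<le> B\<^sup>2 * mass"
proof -
  have "W \<sigma> f f = W (\<lambda>e s. \<sigma> e s * (f e s)\<^sup>2) one one"
    by (rule W_cong) (simp add: power2_eq_square)
  also have "\<dots> \<le> W (\<lambda>e s. B\<^sup>2 * \<sigma> e s + 0 * \<sigma> e s) one one"
  proof (rule W_mono_weight)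
    show "edge_cont (\<lambda>e s. \<sigma> e s * (f e s)\<^sup>2)"
      using assms(1) \<sigma>_cont unfolding edge_cont_def by (auto intro!: continuous_intros)
    fix e s assume es: "e \<in> E" "s \<in> {0..L e}"
    have "(f e s)\<^sup>2 \<le> B\<^sup>2"
      using power_mono[OF assms(2)[OF es], of 2] by simp
    then show "\<sigma> e s * (f e s)\<^sup>2 \<le> B\<^sup>2 * \<sigma> e s + 0 * \<sigma> e s"
      using \<sigma>_nonneg[OF es] by (simp add: mult.commute mult_left_mono)
  qed (auto intro!: edge_cont_cmult \<sigma>_cont)
  also have "\<dots> = B\<^sup>2 * mass"
    by (subst W_lincomb_weight) (auto simp: \<sigma>_cont mass_def)
  finally show ?thesis .
qed

lemma W_one_bound:
  assumes "edge_cont f" "\<And>e s. e \<in> E \<Longrightarrow> s \<in> {0..L e} \<Longrightarrow> \<bar>f e s\<bar> \<le> B" "0 \<le> B"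
  shows "\<bar>W \<sigma> f one\<bar> \<le> B * mass"
proof (rule power2_le_imp_le)
  have "\<bar>W \<sigma> f one\<bar>\<^sup>2 \<le> W \<sigma> f f * W \<sigma> one one"
    using W_Cauchy_Schwarz[OF \<sigma>_cont assms(1) _ \<sigma>_nonneg, of one] by simp
  also have "\<dots> \<le> (B\<^sup>2 * mass) * mass"
    unfolding mass_def[symmetric] using W_bound[OF assms(1,2)] mass_pos
    by (intro mult_right_mono) auto
  finally show "\<bar>W \<sigma> f one\<bar>\<^sup>2 \<le> (B * mass)\<^sup>2" by (simp add: power2_eq_square algebra_simps)
  show "0 \<le> B * mass" using assms(3) mass_pos by simp
qed

text \<open>Cauchy-Schwarz against the constant 1: the weighted L2 norm controls a supremum. This
  gain makes the Green images of a normalised sequence equicontinuous.\<close>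

lemma prim1_bound:
  assumes f: "edge_cont f" and e: "e \<in> E" and s: "s \<in> {0..L e}"
  shows "\<bar>prim1 f e s\<bar> \<le> sqrt (mass * W \<sigma> f f)"
proof -
  define a where "a e s = \<bar>f e s\<bar>" for e s
  have a: "edge_cont a"
    using f unfolding a_def edge_cont_def by (auto intro!: continuous_intros)
  have sub: "{0..s} \<subseteq> {0..L e}" using s by auto
  have c: "continuous_on {0..L e} (\<lambda>y. \<sigma> e y * a e y)" "continuous_on {0..L e} (\<lambda>y. \<sigma> e y * f e y)"
    using edge_contD[OF \<sigma>_cont e] edge_contD[OF a e] edge_contD[OF f e]
    by (auto intro!: continuous_on_mult)
  have "\<bar>prim1 f e s\<bar> \<le> integral {0..s} (\<lambda>y. \<sigma> e y * a e y)"
    unfolding prim1_def real_norm_def[symmetric]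
  proof (rule integral_norm_bound_integral)
    show "norm (\<sigma> e y * f e y) \<le> \<sigma> e y * a e y" if "y \<in> {0..s}" for y
      using \<sigma>_nonneg[OF e, of y] that sub by (auto simp: a_def abs_mult)
  qed (auto intro!: integrable_continuous_interval continuous_on_subset[OF _ sub] c)
  also have "\<dots> \<le> integral {0..L e} (\<lambda>y. \<sigma> e y * a e y)"
    using sub c \<sigma>_nonneg[OF e]
    by (intro integral_subset_le integrable_continuous_interval continuous_on_subset[OF _ sub])
       (auto simp: a_def intro!: mult_nonneg_nonneg)
  also have "\<dots> \<le> W \<sigma> a one"
  proof -
    have "0 \<le> integral {0..L e} (\<lambda>y. \<sigma> e y * (a e y * one e y))" if "e \<in> E" for e
      using \<sigma>_nonneg[OF that] edge_contD[OF \<sigma>_cont that] edge_contD[OF a that]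
      by (intro Henstock_Kurzweil_Integration.integral_nonneg integrable_continuous_interval
          continuous_on_mult) (auto simp: a_def)
    then show ?thesis
      unfolding W_def using member_le_sum[OF e, of "\<lambda>e. integral {0..L e} (\<lambda>y. \<sigma> e y * (a e y * one e y))"]
        finite_E by simp
  qed
  also have "\<dots> \<le> sqrt (mass * W \<sigma> f f)"
  proof (rule real_le_rsqrt)
    have "(W \<sigma> a one)\<^sup>2 \<le> W \<sigma> a a * mass"
      unfolding mass_def by (intro W_Cauchy_Schwarz \<sigma>_cont a \<sigma>_nonneg) auto
    also have "W \<sigma> a a = W \<sigma> f f" by (rule W_cong) (simp add: a_def)
    finally show "(W \<sigma> a one)\<^sup>2 \<le> mass * W \<sigma> f f" by (simp add: mult.commute)
  qed
  finally show ?thesis .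
qed

text \<open>\<open>prim2 f e (L e) / L e\<close> is the mean of \<open>prim1 f e\<close> over the
  edge and obeys the same bound as \<open>prim1\<close>; the two parts give the factor 2.\<close>

lemma green'_bound:
  assumes f: "edge_cont f" and e: "e \<in> E" and s: "s \<in> {0..L e}"
  shows "\<bar>green' f e s\<bar> \<le> 2 * sqrt (mass * W \<sigma> f f)"
proof -
  have "\<bar>prim2 f e (L e)\<bar> \<le> sqrt (mass * W \<sigma> f f) * (L e - 0)"
    unfolding prim2_def real_norm_def[symmetric]
    using L_pos[OF e] prim1_bound[OF f e] edge_contD[OF prim1_cont[OF f] e]
    by (intro integral_bound) auto
  then have "\<bar>prim2 f e (L e) / L e\<bar> \<le> sqrt (mass * W \<sigma> f f)"
    using L_pos[OF e] by (simp add: field_simps)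
  then show ?thesis
    using prim1_bound[OF f e s] unfolding green'_def by linarith
qed

text \<open>Only finiteness of the constant matters: it makes the supremum \<open>M\<close> finite
  and forces the form to vanish with the norm.\<close>

lemma form_bound:
  assumes f: "edge_cont f"
  shows "form f f \<le> (4 * mass * sum L E) * W \<sigma> f f"
proof -
  have nn: "0 \<le> W \<sigma> f f" using W_nonneg[OF \<sigma>_cont f \<sigma>_nonneg] .
  have "form f f = (\<Sum>e\<in>E. integral {0..L e} (\<lambda>s. green' f e s * green' f e s))"
    by (simp add: form_def W_def)
  also have "\<dots> \<le> (\<Sum>e\<in>E. (4 * (mass * W \<sigma> f f)) * (L e - 0))"
  proof (rule sum_mono)
    fix e assume e: "e \<in> E"
    have "norm (green' f e s * green' f e s) \<le> 4 * (mass * W \<sigma> f f)" if s: "s \<in> {0..L e}" for s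
    proof -
      have "\<bar>green' f e s\<bar>\<^sup>2 \<le> (2 * sqrt (mass * W \<sigma> f f))\<^sup>2"
        using green'_bound[OF f e s] by (intro power_mono) auto
      then show ?thesis
        using nn mass_pos by (simp add: power_mult_distrib abs_mult power2_eq_square)
    qed
    then have "norm (integral {0..L e} (\<lambda>s. green' f e s * green' f e s)) \<le> (4 * (mass * W \<sigma> f f)) * (L e - 0)"
      using L_pos[OF e] edge_contD[OF green'_cont[OF f] e]
      by (intro integral_bound) (auto intro!: continuous_intros)
    then show "integral {0..L e} (\<lambda>s. green' f e s * green' f e s) \<le> (4 * (mass * W \<sigma> f f)) * (L e - 0)"
      by simp
  qed
  also have "\<dots> = (4 * mass * sum L E) * W \<sigma> f f"
    by (simp add: sum_distrib_left[symmetric])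
  finally show ?thesis .
qed

end

section \<open>The extremal problem for the Green operator\<close>

context weighted_edges
begin

text \<open>\<open>1 / M\<close> is the first nonzero eigenvalue.\<close>

definition M where "M = Sup {form f f | f. mean_zero f \<and> W \<sigma> f f = 1}"

lemma bdd_above_form: "bdd_above {form f f | f. mean_zero f \<and> W \<sigma> f f = 1}"
proof (rule bdd_aboveI)
  fix x assume "x \<in> {form f f | f. mean_zero f \<and> W \<sigma> f f = 1}"
  then obtain f where "x = form f f" "edge_cont f" "W \<sigma> f f = 1"
    by (auto simp: mean_zero_def)
  then show "x \<le> 4 * mass * sum L E" using form_bound[of f] by simp
qed

lemma form_le_M:
  assumes f: "mean_zero f"
  shows "form f f \<le> M * W \<sigma> f f"
proof (cases "W \<sigma> f f = 0")
  case True
  then show ?thesis using form_bound[of f] f by (simp add: mean_zero_def)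
next
  case False
  have ec: "edge_cont f" using f by (simp add: mean_zero_def)
  have pos: "0 < W \<sigma> f f" using False W_nonneg[OF \<sigma>_cont ec \<sigma>_nonneg] by simp
  define c where "c = 1 / sqrt (W \<sigma> f f)"
  have c2: "c\<^sup>2 * W \<sigma> f f = 1" using pos by (simp add: c_def power_divide)
  \<comment> \<open>The zero term lets the lemmas on combinations of two functions do the
    rescaling.\<close>
  define g where "g = (\<lambda>e s. c * f e s + 0 * f e s)"
  have g: "mean_zero g" unfolding g_def using f by (intro mean_zero_lincomb)
  have "W \<sigma> g g = 1" unfolding g_def
    using W_lincomb_square[OF \<sigma>_cont ec ec, of c 0] c2 by simp
  moreover have fg: "form g g = c\<^sup>2 * form f f" unfolding g_def
    using form_lincomb_square[OF ec ec, of c 0] by simp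
  moreover have "form g g \<le> M" if "W \<sigma> g g = 1"
    unfolding M_def using g that by (intro cSup_upper bdd_above_form) auto
  ultimately have "c\<^sup>2 * form f f \<le> M" by simp
  then have "c\<^sup>2 * form f f * W \<sigma> f f \<le> M * W \<sigma> f f"
    using pos by (intro mult_right_mono) auto
  moreover have "c\<^sup>2 * form f f * W \<sigma> f f = form f f"
    using c2 by (metis mult.commute mult.left_commute mult_1)
  ultimately show ?thesis by simp
qed

text \<open>The Green identity writes the squared norm of \<open>u\<close> as the product of
  \<open>green' u\<close> and \<open>u'\<close>, and Cauchy-Schwarz separates the two. An upper
  bound for the form then bounds the energy from below, and a small energy makes the form
  large.\<close>

lemma W_square_le_form:
  assumes "vertex_C1 u u' w" "mean_zero u"
  shows "(W \<sigma> u u)\<^sup>2 \<le> form u u * W one u' u'"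
proof -
  have ec: "edge_cont u" "edge_cont u'" "W \<sigma> u one = 0"
    using assms by (auto simp: mean_zero_def vertex_C1_def)
  have "W \<sigma> u u = W one (green' u) u'"
    using green_identity[OF ec(1) assms(1)] ec(3) by simp
  then show ?thesis
    unfolding form_def using ec
    by (auto intro!: W_Cauchy_Schwarz green'_cont)
qed

text \<open>Keeps \<open>M\<close> from being zero or the supremum of an empty set. A centred
  parabola is nonzero, so \<open>W_square_le_form\<close> gives it a positive form.\<close>

lemma exists_mean_zero_positive: "\<exists>f. mean_zero f \<and> W \<sigma> f f = 1 \<and> 0 < form f f"
proof -
  obtain e where e: "e \<in> E" using E_nonempty by auto
  define p where "p e s = s * (L e - s)" for e s
  define p' where "p' e s = L e - 2 * s" for e s
  have p: "vertex_C1 p p' 0"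
    unfolding vertex_C1_def p_def p'_def edge_cont_def
    by (auto intro!: derivative_eq_intros continuous_intros)
  define c where "c = W \<sigma> p one / mass"
  have "vertex_C1 (\<lambda>e s. 1 * p e s + (-1) * c) (\<lambda>e s. 1 * p' e s + (-1) * 0) (1 * 0 + (-1) * c)"
    by (rule vertex_C1_lincomb[OF p vertex_C1_const])
  then have C1: "vertex_C1 (center p) p' (- c)"
    by (simp add: center_def[abs_def] c_def)
  have mz: "mean_zero (center p)"
    using mean_zero_center vertex_C1_edge_cont[OF p] by blast
  have ec: "edge_cont (center p)" using mz by (simp add: mean_zero_def)
  \<comment> \<open>Either the mean vanishes and the midpoint value is positive, or the end value
    \<open>- c\<close> is nonzero.\<close>
  have "0 < W \<sigma> (center p) (center p)"
  proof (cases "c = 0")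
    case True
    then have "center p e (L e / 2) = (L e)\<^sup>2 / 4"
      by (simp add: center_def c_def[symmetric] p_def power2_eq_square)
    then show ?thesis
      using L_pos[OF e] by (intro W_pos[OF \<sigma>_cont ec \<sigma>_pos e, of "L e / 2"]) auto
  next
    case False
    then show ?thesis
      using L_pos[OF e]
      by (intro W_pos[OF \<sigma>_cont ec \<sigma>_pos e, of 0]) (auto simp: center_def c_def p_def)
  qed
  moreover have "0 \<le> W one p' p'"
    using p by (intro W_nonneg) (auto simp: vertex_C1_def)
  ultimately have fpos: "0 < form (center p) (center p)"
    using W_square_le_form[OF C1 mz] form_nonneg[OF ec]
    by (metis less_eq_real_def mult_zero_left not_le power2_less_0 zero_eq_power2 less_irrefl zero_less_power2)
  define a where "a = 1 / sqrt (W \<sigma> (center p) (center p))"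
  have a: "a > 0" "a\<^sup>2 * W \<sigma> (center p) (center p) = 1"
    using \<open>0 < W \<sigma> (center p) (center p)\<close> by (auto simp: a_def power_divide)
  define g where "g = (\<lambda>e s. a * center p e s + 0 * center p e s)"
  have "mean_zero g" unfolding g_def using mz by (intro mean_zero_lincomb)
  moreover have "W \<sigma> g g = 1" unfolding g_def
    using W_lincomb_square[OF \<sigma>_cont ec ec, of a 0] a by simp
  moreover have "0 < form g g" unfolding g_def
    using form_lincomb_square[OF ec ec, of a 0] a fpos by simp
  ultimately show ?thesis by blast
qed

lemma M_pos: "0 < M"
proof -
  obtain f where "mean_zero f" "W \<sigma> f f = 1" "0 < form f f"
    using exists_mean_zero_positive by blast
  then show ?thesis using form_le_M[of f] by simp
qed

text \<open>Inserting \<open>form_le_M\<close> into \<open>W_square_le_form\<close> and cancelling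
  one factor of the squared norm turns the maximum of the Green form into the lower bound
  \<open>1 / M\<close> for Rayleigh quotients.\<close>

lemma poincare:
  assumes "vertex_C1 u u' w" "mean_zero u"
  shows "W \<sigma> u u \<le> M * W one u' u'"
proof -
  have ec: "edge_cont u" "edge_cont u'"
    using assms by (auto simp: mean_zero_def vertex_C1_def)
  have nn: "0 \<le> W \<sigma> u u" "0 \<le> W one u' u'"
    using W_nonneg[OF \<sigma>_cont ec(1) \<sigma>_nonneg] W_nonneg[of one u'] ec(2) by auto
  have "W \<sigma> u u * W \<sigma> u u \<le> form u u * W one u' u'"
    using W_square_le_form[OF assms] by (simp add: power2_eq_square)
  also have "\<dots> \<le> (M * W \<sigma> u u) * W one u' u'"
    using form_le_M[OF assms(2)] nn by (intro mult_right_mono) auto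
  finally have "W \<sigma> u u * W \<sigma> u u \<le> W \<sigma> u u * (M * W one u' u')" by (simp add: algebra_simps)
  then show ?thesis
    using nn M_pos by (cases "W \<sigma> u u = 0") (auto simp: mult_le_cancel_left)
qed

text \<open>The defect of \<open>f\<close> as an eigenfunction of the centred Green operator for its
  top value \<open>M\<close>.\<close>

definition residual where "residual f e s = M * f e s - center (green f) e s"

lemma residual_eq: "residual f = (\<lambda>e s. M * f e s + (-1) * center (green f) e s)"
  by (simp add: residual_def fun_eq_iff)

lemma mean_zero_residual: "mean_zero f \<Longrightarrow> mean_zero (residual f)"
  unfolding residual_eq
  by (intro mean_zero_lincomb mean_zero_center green_cont) (auto simp: mean_zero_def)

text \<open>Cauchy--Schwarz for the nonnegative form \<open>M W \<sigma> f g - form f g = W \<sigma> (residual f) g\<close>,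
  tested with \<open>g = residual f\<close>.\<close>

lemma residual_bound:
  assumes f: "mean_zero f"
  shows "W \<sigma> (residual f) (residual f) \<le> M * (M * W \<sigma> f f - form f f)"
proof -
  define g where "g = residual f"
  have g: "mean_zero g" unfolding g_def using mean_zero_residual[OF f] .
  have ec: "edge_cont f" "edge_cont g" "edge_cont (center (green f))"
    using f g mean_zero_center[OF green_cont, of f] by (auto simp: mean_zero_def)
  have cross: "M * W \<sigma> f g - form f g = W \<sigma> g g"
  proof -
    have "W \<sigma> (residual f) g = M * W \<sigma> f g + (-1) * W \<sigma> (center (green f)) g"
      unfolding residual_eq using ec by (intro W_lincomb_left \<sigma>_cont) auto
    then show ?thesis using form_eq[OF f g] by (simp add: g_def)
  qed
  have nn: "0 \<le> M * W \<sigma> h h - form h h" if "mean_zero h" for h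
    using form_le_M[OF that] by simp
  have "(W \<sigma> g g)\<^sup>2 \<le> (M * W \<sigma> f f - form f f) * (M * W \<sigma> g g - form g g)"
  proof (rule discriminant_le_0)
    fix t
    have "0 \<le> M * W \<sigma> (\<lambda>e s. 1 * f e s + t * g e s) (\<lambda>e s. 1 * f e s + t * g e s)
      - form (\<lambda>e s. 1 * f e s + t * g e s) (\<lambda>e s. 1 * f e s + t * g e s)"
      using f g by (intro nn mean_zero_lincomb)
    also have "\<dots> = M * W \<sigma> f f - form f f + 2 * t * (M * W \<sigma> f g - form f g) + t\<^sup>2 * (M * W \<sigma> g g - form g g)"
      unfolding W_lincomb_square[OF \<sigma>_cont ec(1,2)] form_lincomb_square[OF ec(1,2)]
      by (simp add: algebra_simps)
    finally show "0 \<le> M * W \<sigma> f f - form f f + 2 * t * W \<sigma> g g + t\<^sup>2 * (M * W \<sigma> g g - form g g)"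
      by (simp add: cross)
  qed (use nn[OF g] in simp)
  also have "\<dots> \<le> (M * W \<sigma> f f - form f f) * (M * W \<sigma> g g)"
    using nn[OF f] form_nonneg[OF ec(2)] by (intro mult_left_mono) auto
  finally have "W \<sigma> g g * W \<sigma> g g \<le> W \<sigma> g g * (M * (M * W \<sigma> f f - form f f))"
    by (simp add: power2_eq_square algebra_simps)
  moreover have "0 \<le> W \<sigma> g g" using W_nonneg[OF \<sigma>_cont ec(2) \<sigma>_nonneg] .
  moreover have "0 \<le> M * (M * W \<sigma> f f - form f f)"
    using nn[OF f] M_pos by simp
  ultimately show ?thesis
    unfolding g_def[symmetric] by (cases "W \<sigma> g g = 0") (auto simp: mult_le_cancel_left)
qed

definition eigen where
  "eigen \<mu> u u' w \<longleftrightarrow>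
     (\<forall>e\<in>E. \<forall>s\<in>{0..L e}.
        (u e has_real_derivative u' e s) (at s within {0..L e}) \<and>
        (u' e has_real_derivative - (\<mu> * \<sigma> e s * u e s)) (at s within {0..L e})) \<and>
     (\<forall>e\<in>E. u e 0 = w \<and> u e (L e) = w) \<and>
     (\<Sum>e\<in>E. u' e 0 - u' e (L e)) = 0"

lemma eigen_C1:
  assumes "eigen \<mu> u u' w" shows "vertex_C1 u u' w"
proof -
  have "edge_cont u'"
    using assms unfolding eigen_def edge_cont_def
    by (meson DERIV_continuous continuous_on_eq_continuous_within)
  then show ?thesis using assms unfolding eigen_def vertex_C1_def by auto
qed

lemma eigen_cont: "eigen \<mu> u u' w \<Longrightarrow> edge_cont u"
  using eigen_C1 vertex_C1_edge_cont by blast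

text \<open>Over all edges the end terms collect to \<open>z\<close> times the vertex sum in
  \<open>eigen\<close>, which is 0. Testing with the constant 1 gives mean zero, testing with
  \<open>u\<close> itself the energy identity.\<close>

lemma eigen_weak:
  assumes u: "eigen \<mu> u u' w" and v: "vertex_C1 v v' z"
  shows "W one u' v' = \<mu> * W \<sigma> u v"
proof -
  have "integral {0..L e} (\<lambda>s. u' e s * v' e s)
     = \<mu> * integral {0..L e} (\<lambda>s. \<sigma> e s * (u e s * v e s)) - z * (u' e 0 - u' e (L e))" if e: "e \<in> E" for e
  proof -
    have "integral {0..L e} (\<lambda>s. u' e s * v' e s)
        = u' e (L e) * v e (L e) - u' e 0 * v e 0
          - integral {0..L e} (\<lambda>s. - (\<mu> * \<sigma> e s * u e s) * v e s)"
    proof (rule integral_by_parts_vanishing)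
      show "0 \<le> L e" using L_pos[OF e] by simp
      show "(u' e has_real_derivative - (\<mu> * \<sigma> e s * u e s)) (at s within {0..L e})"
        if "s \<in> {0..L e}" for s using u e that by (auto simp: eigen_def)
      show "(v e has_real_derivative v' e s) (at s within {0..L e})"
        if "s \<in> {0..L e}" for s using v e that by (auto simp: vertex_C1_def)
      show "continuous_on {0..L e} (v' e)"
        using v e by (auto simp: vertex_C1_def edge_cont_def)
      show "continuous_on {0..L e} (\<lambda>s. - (\<mu> * \<sigma> e s * u e s))"
        using edge_contD[OF \<sigma>_cont e] edge_contD[OF eigen_cont[OF u] e]
        by (intro continuous_intros)
    qed
    also have "(\<lambda>s. - (\<mu> * \<sigma> e s * u e s) * v e s) = (\<lambda>s. - \<mu> * (\<sigma> e s * (u e s * v e s)))"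
      by (simp add: algebra_simps)
    also have "u' e (L e) * v e (L e) - u' e 0 * v e 0 - integral {0..L e} (\<lambda>s. - \<mu> * (\<sigma> e s * (u e s * v e s)))
       = \<mu> * integral {0..L e} (\<lambda>s. \<sigma> e s * (u e s * v e s)) - z * (u' e 0 - u' e (L e))"
      using v e unfolding vertex_C1_def
      by (simp add: algebra_simps)
    finally show ?thesis .
  qed
  then have "W one u' v' = \<mu> * W \<sigma> u v - z * (\<Sum>e\<in>E. u' e 0 - u' e (L e))"
    by (simp add: W_def sum_subtractf[of "\<lambda>e. \<mu> * _ e"] sum_distrib_left)
  then show ?thesis using u by (simp add: eigen_def)
qed

lemma eigen_mean: "eigen \<mu> u u' w \<Longrightarrow> \<mu> \<noteq> 0 \<Longrightarrow> mean_zero u"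
  using eigen_weak[OF _ vertex_C1_const[of 1], of \<mu> u u' w] eigen_cont
  by (auto simp: mean_zero_def W_def)

lemma eigen_energy: "eigen \<mu> u u' w \<Longrightarrow> W one u' u' = \<mu> * W \<sigma> u u"
  using eigen_weak eigen_C1 by blast

lemma eigen_ge:
  assumes u: "eigen \<mu> u u' w" and mu: "\<mu> > 0" and nz: "W \<sigma> u u \<noteq> 0"
  shows "1 / M \<le> \<mu>"
proof -
  have "W \<sigma> u u \<le> M * (\<mu> * W \<sigma> u u)"
    using poincare[OF eigen_C1[OF u]] eigen_mean[OF u] mu eigen_energy[OF u] by simp
  moreover have "0 < W \<sigma> u u"
    using nz W_nonneg[OF \<sigma>_cont eigen_cont[OF u] \<sigma>_nonneg] by simp
  ultimately have "1 \<le> M * \<mu>" by (simp add: mult.assoc[symmetric])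
  then show ?thesis using M_pos by (simp add: field_simps)
qed

text \<open>Maximality forces the residual to be 0 by \<open>residual_bound\<close>, so
  \<open>f\<close> equals \<open>(green f - c) / M\<close> pointwise and inherits two derivatives
  although it was only continuous. The slopes at the vertex balance because \<open>f\<close> has
  mean zero.\<close>

lemma maximizer_eigen:
  assumes f: "mean_zero f" and max: "M * W \<sigma> f f \<le> form f f"
  shows "\<exists>w. eigen (1 / M) f (\<lambda>e s. green' f e s / M) w"
proof -
  have ec: "edge_cont f" using f by (simp add: mean_zero_def)
  define c where "c = W \<sigma> (green f) one / mass"
  have rc: "edge_cont (residual f)" using mean_zero_residual[OF f] by (simp add: mean_zero_def)
  have "W \<sigma> (residual f) (residual f) = 0"
  proof -
    have "M * (M * W \<sigma> f f - form f f) \<le> 0"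
      using max M_pos by (simp add: mult_le_0_iff)
    then show ?thesis
      using residual_bound[OF f] W_nonneg[OF \<sigma>_cont rc \<sigma>_nonneg] by simp
  qed
  then have "residual f e s = 0" if "e \<in> E" "s \<in> {0..L e}" for e s
    using W_eq_0D[OF \<sigma>_cont rc \<sigma>_pos] that by blast
  then have feq: "f e s = (green f e s - c) / M" if "e \<in> E" "s \<in> {0..L e}" for e s
    using that M_pos by (force simp: residual_def center_def c_def field_simps)
  have "eigen (1 / M) f (\<lambda>e s. green' f e s / M) (- c / M)"
    unfolding eigen_def
  proof (intro conjI ballI)
    fix e s assume es: "e \<in> E" "s \<in> {0..L e}"
    have "((\<lambda>s. (green f e s - c) / M) has_real_derivative green' f e s / M) (at s within {0..L e})"
      using M_pos by (auto intro!: derivative_eq_intros green_deriv ec es)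
    then show "(f e has_real_derivative green' f e s / M) (at s within {0..L e})"
      by (rule has_field_derivative_transform_within[OF _ zero_less_one es(2)])
         (use feq es(1) in auto)
    show "((\<lambda>s. green' f e s / M) has_real_derivative - (1 / M * \<sigma> e s * f e s)) (at s within {0..L e})"
      using M_pos by (auto intro!: derivative_eq_intros green'_deriv ec es)
  next
    fix e assume e: "e \<in> E"
    show "f e 0 = - c / M" "f e (L e) = - c / M"
      using feq[OF e] green_vertex[OF e] L_pos[OF e] by auto
  next
    have "(\<Sum>e\<in>E. green' f e 0 / M - green' f e (L e) / M) = (\<Sum>e\<in>E. prim1 f e (L e)) / M"
      by (simp add: green'_def prim1_def sum_divide_distrib diff_divide_distrib)
    then show "(\<Sum>e\<in>E. green' f e 0 / M - green' f e (L e) / M) = 0"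
      using f prim1_L by (simp add: mean_zero_def)
  qed
  then show ?thesis by blast
qed

end

section \<open>Compactness of maximising sequences\<close>

context weighted_edges
begin

lemma green_lipschitz:
  assumes f: "edge_cont f" and e: "e \<in> E" and s: "s \<in> {0..L e}" "t \<in> {0..L e}"
  shows "\<bar>green f e s - green f e t\<bar> \<le> 2 * sqrt (mass * W \<sigma> f f) * \<bar>s - t\<bar>"
  using field_differentiable_bound[of "{0..L e}" "green f e" "green' f e" "2 * sqrt (mass * W \<sigma> f f)" s t]
    green_deriv[OF f e] green'_bound[OF f e] s by auto

text \<open>The parallelogram law with the square of \<open>a f - b g\<close> dropped.\<close>

lemma W_sum_square_le:
  assumes "edge_cont f" "edge_cont g"
  shows "W \<sigma> (\<lambda>e s. a * f e s + b * g e s) (\<lambda>e s. a * f e s + b * g e s)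
       \<le> 2 * a\<^sup>2 * W \<sigma> f f + 2 * b\<^sup>2 * W \<sigma> g g"
proof -
  have "0 \<le> W \<sigma> (\<lambda>e s. a * f e s + (- b) * g e s) (\<lambda>e s. a * f e s + (- b) * g e s)"
    using assms by (intro W_nonneg \<sigma>_cont \<sigma>_nonneg edge_cont_lincomb)
  then show ?thesis
    unfolding W_lincomb_square[OF \<sigma>_cont assms] by simp
qed

text \<open>Green images of a normalised sequence share the Lipschitz constant \<open>Q\<close> and
  vanish at the vertex, so Arzela-Ascoli applies on each edge and finitely many thinnings
  suffice.\<close>

lemma center_green_subsequence:
  assumes f: "\<And>n::nat. edge_cont (f n)" and norm: "\<And>n. W \<sigma> (f n) (f n) = 1"
  obtains r y where "strict_mono (r :: nat \<Rightarrow> nat)" "edge_cont y"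
    "\<And>\<epsilon>. 0 < \<epsilon> \<Longrightarrow> \<forall>\<^sub>F n in sequentially.
       \<forall>e\<in>E. \<forall>s\<in>{0..L e}. \<bar>center (green (f (r n))) e s - y e s\<bar> \<le> \<epsilon>"
proof -
  define v where "v n = center (green (f n))" for n
  define Q where "Q = 2 * sqrt mass"
  define B where "B = Q * sum L E"
  have Q: "0 < Q" using mass_pos by (simp add: Q_def)
  have L_le: "L e \<le> sum L E" if "e \<in> E" for e
    using that L_pos finite_E by (intro member_le_sum) (auto simp: less_imp_le)
  have lip: "\<bar>green (f n) e s - green (f n) e t\<bar> \<le> Q * \<bar>s - t\<bar>"
    if "e \<in> E" "s \<in> {0..L e}" "t \<in> {0..L e}" for n e s t
    using green_lipschitz[OF f that, of n] norm by (simp add: Q_def)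
  have gB: "\<bar>green (f n) e s\<bar> \<le> B" if "e \<in> E" "s \<in> {0..L e}" for n e s
  proof -
    have "\<bar>green (f n) e s\<bar> \<le> Q * \<bar>s\<bar>"
      using lip[OF that, of 0 n] green_vertex[OF that(1)] L_pos[OF that(1)] by simp
    also have "\<dots> \<le> B" unfolding B_def
      using that L_le[OF that(1)] Q by (intro mult_left_mono) auto
    finally show ?thesis .
  qed
  have B: "0 \<le> B" unfolding B_def using Q L_pos
    by (intro mult_nonneg_nonneg sum_nonneg) (auto simp: less_imp_le)
  \<comment> \<open>Centring subtracts a mean that is itself at most \<open>B\<close> in absolute
    value; this doubles the bound and leaves the Lipschitz constant.\<close>
  have vB: "\<bar>v n e s\<bar> \<le> 2 * B" if "e \<in> E" "s \<in> {0..L e}" for n e s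
  proof -
    have "\<bar>W \<sigma> (green (f n)) one\<bar> \<le> B * mass"
      by (rule W_one_bound[OF green_cont[OF f] gB B])
    then have "\<bar>W \<sigma> (green (f n)) one / mass\<bar> \<le> B"
      using mass_pos by (simp add: field_simps)
    then show ?thesis using gB[OF that, of n] unfolding v_def center_def by linarith
  qed
  have vlip: "\<bar>v n e s - v n e t\<bar> \<le> Q * \<bar>s - t\<bar>"
    if "e \<in> E" "s \<in> {0..L e}" "t \<in> {0..L e}" for n e s t
    using lip[OF that, of n] by (simp add: v_def center_def)
  define P where "P e r \<longleftrightarrow> (\<exists>g. continuous_on {0..L e} g \<and>
     (\<forall>\<epsilon>>0. \<exists>N. \<forall>n s. N \<le> n \<and> s \<in> {0..L e} \<longrightarrow> norm (v (r n) e s - g s) < \<epsilon>))"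
    for e and r :: "nat \<Rightarrow> nat"
  have "\<exists>r. strict_mono r \<and> (\<forall>e\<in>E. P e r)"
  proof (rule finite_common_subsequence[OF finite_E])
    fix e and r :: "nat \<Rightarrow> nat" assume e: "e \<in> E"
    obtain g k where "continuous_on {0..L e} g" "strict_mono (k :: nat \<Rightarrow> nat)"
      "\<And>\<epsilon>. 0 < \<epsilon> \<Longrightarrow> \<exists>N. \<forall>n s. N \<le> n \<and> s \<in> {0..L e} \<longrightarrow> norm (v (r (k n)) e s - g s) < \<epsilon>"
    proof (rule Arzela_Ascoli[of "{0..L e}" "\<lambda>n. v (r n) e" "2 * B"])
      show "norm (v (r n) e s) \<le> 2 * B" if "s \<in> {0..L e}" for n s
        using vB[OF e that] by simp
      show "\<exists>d>0. \<forall>n y. y \<in> {0..L e} \<and> norm (s - y) < d \<longrightarrow> norm (v (r n) e s - v (r n) e y) < \<epsilon>"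
        if s: "s \<in> {0..L e}" and "0 < \<epsilon>" for s \<epsilon>
      proof (intro exI[of _ "\<epsilon> / Q"] conjI allI impI)
        fix n y assume y: "y \<in> {0..L e} \<and> norm (s - y) < \<epsilon> / Q"
        then have "Q * \<bar>s - y\<bar> < \<epsilon>" using Q by (simp add: field_simps)
        then show "norm (v (r n) e s - v (r n) e y) < \<epsilon>"
          using vlip[OF e s, of y "r n"] y by simp
      qed (use Q \<open>0 < \<epsilon>\<close> in simp)
    qed auto
    then show "\<exists>k. strict_mono k \<and> P e (r \<circ> k)"
      unfolding P_def by (auto simp: o_def)
  next
    fix e and r k :: "nat \<Rightarrow> nat" assume "P e r" and k: "strict_mono k"
    then obtain g where g: "continuous_on {0..L e} g"
      "\<And>\<epsilon>. \<epsilon> > 0 \<Longrightarrow> \<exists>N. \<forall>n s. N \<le> n \<and> s \<in> {0..L e} \<longrightarrow> norm (v (r n) e s - g s) < \<epsilon>"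
      unfolding P_def by blast
    have "\<exists>N. \<forall>n s. N \<le> n \<and> s \<in> {0..L e} \<longrightarrow> norm (v (r (k n)) e s - g s) < \<epsilon>" if "\<epsilon> > 0" for \<epsilon>
    proof -
      obtain N where N: "\<forall>n s. N \<le> n \<and> s \<in> {0..L e} \<longrightarrow> norm (v (r n) e s - g s) < \<epsilon>"
        using g(2)[OF \<open>\<epsilon> > 0\<close>] by blast
      have "N \<le> k n" if "N \<le> n" for n
        using seq_suble[OF k, of n] that by linarith
      then show ?thesis using N by blast
    qed
    then show "P e (r \<circ> k)" unfolding P_def using g(1) by (auto simp: o_def)
  qed
  then obtain r where r: "strict_mono r" "\<forall>e\<in>E. P e r" by blast
  from r(2) obtain y where y: "\<And>e. e \<in> E \<Longrightarrow> continuous_on {0..L e} (y e)"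
    "\<And>e \<epsilon>. e \<in> E \<Longrightarrow> \<epsilon> > 0 \<Longrightarrow> \<exists>N. \<forall>n s. N \<le> n \<and> s \<in> {0..L e} \<longrightarrow> norm (v (r n) e s - y e s) < \<epsilon>"
    unfolding P_def by metis
  show thesis
  proof (rule that[OF r(1), of y])
    show "edge_cont y" using y(1) by (simp add: edge_cont_def)
    fix \<epsilon> :: real assume "0 < \<epsilon>"
    have "\<forall>\<^sub>F n in sequentially. \<forall>s\<in>{0..L e}. \<bar>v (r n) e s - y e s\<bar> \<le> \<epsilon>" if e: "e \<in> E" for e
    proof -
      obtain N where "\<forall>n s. N \<le> n \<and> s \<in> {0..L e} \<longrightarrow> norm (v (r n) e s - y e s) < \<epsilon>"
        using y(2)[OF e \<open>0 < \<epsilon>\<close>] by blast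
      then show ?thesis
        unfolding eventually_sequentially by (intro exI[of _ N]) (auto simp: less_imp_le)
    qed
    then show "\<forall>\<^sub>F n in sequentially.
       \<forall>e\<in>E. \<forall>s\<in>{0..L e}. \<bar>center (green (f (r n))) e s - y e s\<bar> \<le> \<epsilon>"
      unfolding v_def[symmetric] by (intro eventually_ball_finite finite_E) blast
  qed
qed

text \<open>\<open>M * f n\<close> is the residual plus the centred Green image. The residual tends
  to 0 by \<open>residual_bound\<close> and the image converges uniformly along a subsequence, hence
  \<open>f n\<close> itself converges in the weighted norm, to a limit that is continuous.\<close>

lemma maximizing_sequence_converges:
  assumes f: "\<And>n::nat. mean_zero (f n)" and norm: "\<And>n. W \<sigma> (f n) (f n) = 1"
    and lim: "(\<lambda>n. form (f n) (f n)) \<longlonglongrightarrow> M"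
  obtains r x where "strict_mono (r :: nat \<Rightarrow> nat)" "mean_zero x" "W \<sigma> x x = 1" "form x x = M"
    "(\<lambda>n. W \<sigma> (\<lambda>e s. f (r n) e s - x e s) (\<lambda>e s. f (r n) e s - x e s)) \<longlonglongrightarrow> 0"
proof -
  have ec: "edge_cont (f n)" for n using f by (simp add: mean_zero_def)
  obtain r y where r: "strict_mono (r :: nat \<Rightarrow> nat)" and y: "edge_cont y"
    and unif: "\<And>\<epsilon>. 0 < \<epsilon> \<Longrightarrow> \<forall>\<^sub>F n in sequentially.
       \<forall>e\<in>E. \<forall>s\<in>{0..L e}. \<bar>center (green (f (r n))) e s - y e s\<bar> \<le> \<epsilon>"
    by (rule center_green_subsequence[OF ec norm]) (rule that)
  define d where "d n e s = center (green (f (r n))) e s - y e s" for n e s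
  have dc: "edge_cont (d n)" for n
    unfolding d_def using mean_zero_center[OF green_cont[OF ec]] y
    by (intro edge_cont_diff) (auto simp: mean_zero_def)
  have d0: "(\<lambda>n. W \<sigma> (d n) (d n)) \<longlonglongrightarrow> 0"
  proof (rule LIMSEQ_I)
    fix \<delta> :: real assume "0 < \<delta>"
    define \<epsilon> where "\<epsilon> = sqrt (\<delta> / (2 * mass))"
    have \<epsilon>: "\<epsilon> > 0" "\<epsilon>\<^sup>2 * mass < \<delta>"
      using \<open>0 < \<delta>\<close> mass_pos by (auto simp: \<epsilon>_def)
    obtain N where N: "\<And>n e s. N \<le> n \<Longrightarrow> e \<in> E \<Longrightarrow> s \<in> {0..L e} \<Longrightarrow> \<bar>d n e s\<bar> \<le> \<epsilon>"
      using unif[OF \<epsilon>(1)] unfolding eventually_sequentially d_def by blast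
    have "norm (W \<sigma> (d n) (d n) - 0) < \<delta>" if "N \<le> n" for n
      using W_bound[OF dc N, OF that] W_nonneg[OF \<sigma>_cont dc[of n] \<sigma>_nonneg] \<epsilon>(2) by auto
    then show "\<exists>N. \<forall>n\<ge>N. norm (W \<sigma> (d n) (d n) - 0) < \<delta>" by blast
  qed
  have rc: "edge_cont (residual (f n))" for n
    using mean_zero_residual[OF f] by (simp add: mean_zero_def)
  have r0: "(\<lambda>n. W \<sigma> (residual (f (r n))) (residual (f (r n)))) \<longlonglongrightarrow> 0"
  proof (rule tendsto_sandwich)
    show "\<forall>\<^sub>F n in sequentially. 0 \<le> W \<sigma> (residual (f (r n))) (residual (f (r n)))"
      using W_nonneg[OF \<sigma>_cont rc \<sigma>_nonneg] by simp
    show "\<forall>\<^sub>F n in sequentially. W \<sigma> (residual (f (r n))) (residual (f (r n))) \<le> M * (M - form (f (r n)) (f (r n)))"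
      using residual_bound[OF f] norm by simp
    have "(\<lambda>n. M * (M - form (f (r n)) (f (r n)))) \<longlonglongrightarrow> M * (M - M)"
      using LIMSEQ_subseq_LIMSEQ[OF lim r] by (intro tendsto_intros) (simp add: o_def)
    then show "(\<lambda>n. M * (M - form (f (r n)) (f (r n)))) \<longlonglongrightarrow> 0" by simp
  qed simp
  define x where "x e s = y e s / M" for e s
  have x: "edge_cont x"
    using edge_cont_cmult[OF y, of "1 / M"] by (simp add: x_def[abs_def])
  define z where "z n e s = f (r n) e s - x e s" for n e s
  have z_eq: "z n = (\<lambda>e s. 1 / M * residual (f (r n)) e s + 1 / M * d n e s)" for n
    using M_pos by (simp add: z_def d_def residual_def x_def fun_eq_iff field_simps)
  have zc: "edge_cont (z n)" for n
    unfolding z_def using ec x by (intro edge_cont_diff)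
  have z0: "(\<lambda>n. W \<sigma> (z n) (z n)) \<longlonglongrightarrow> 0"
  proof (rule tendsto_sandwich)
    show "\<forall>\<^sub>F n in sequentially. 0 \<le> W \<sigma> (z n) (z n)"
      using W_nonneg[OF \<sigma>_cont zc \<sigma>_nonneg] by simp
    show "\<forall>\<^sub>F n in sequentially. W \<sigma> (z n) (z n)
       \<le> 2 * (1 / M)\<^sup>2 * W \<sigma> (residual (f (r n))) (residual (f (r n))) + 2 * (1 / M)\<^sup>2 * W \<sigma> (d n) (d n)"
      unfolding z_eq by (intro always_eventually allI W_sum_square_le rc dc)
    have "(\<lambda>n. 2 * (1 / M)\<^sup>2 * W \<sigma> (residual (f (r n))) (residual (f (r n))) + 2 * (1 / M)\<^sup>2 * W \<sigma> (d n) (d n))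
      \<longlonglongrightarrow> 2 * (1 / M)\<^sup>2 * 0 + 2 * (1 / M)\<^sup>2 * 0"
      by (intro tendsto_intros r0 d0)
    then show "(\<lambda>n. 2 * (1 / M)\<^sup>2 * W \<sigma> (residual (f (r n))) (residual (f (r n))) + 2 * (1 / M)\<^sup>2 * W \<sigma> (d n) (d n))
      \<longlonglongrightarrow> 0" by simp
  qed simp
  have z_eq2: "z n = (\<lambda>e s. 1 * f (r n) e s + (-1) * x e s)" for n
    by (simp add: z_def fun_eq_iff)
  \<comment> \<open>Each \<open>f n\<close> has mean zero, so the mean of \<open>x\<close> is up to
    sign that of \<open>z n\<close>, which tends to 0.\<close>
  have "W \<sigma> x one = 0"
  proof -
    have "(W \<sigma> x one)\<^sup>2 \<le> W \<sigma> (z n) (z n) * mass" for n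
    proof -
      have "W \<sigma> (z n) one = - W \<sigma> x one"
        unfolding z_eq2 using f[of "r n"] x ec
        by (subst W_lincomb_left) (auto simp: \<sigma>_cont mean_zero_def)
      then show ?thesis
        using W_Cauchy_Schwarz[OF \<sigma>_cont zc[of n] _ \<sigma>_nonneg, of one] by (simp add: mass_def)
    qed
    moreover have "(\<lambda>n. W \<sigma> (z n) (z n) * mass) \<longlonglongrightarrow> 0 * mass"
      by (intro tendsto_intros z0)
    ultimately have "(W \<sigma> x one)\<^sup>2 \<le> 0"
      by (intro LIMSEQ_le_const[of "\<lambda>n. W \<sigma> (z n) (z n) * mass"]) auto
    then show ?thesis by simp
  qed
  then have mx: "mean_zero x" using x by (simp add: mean_zero_def)
  have "(\<lambda>n. W \<sigma> (f (r n)) (f (r n))) \<longlonglongrightarrow> W \<sigma> x x"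
    using z0 unfolding z_def by (intro W_square_continuous \<sigma>_cont \<sigma>_nonneg ec x)
  then have Wx: "W \<sigma> x x = 1" using norm by (simp add: LIMSEQ_const_iff)
  \<comment> \<open>Written as a square of derivatives with weight \<open>one\<close>, the form
    passes to the limit by \<open>W_square_continuous\<close>.\<close>
  have formz: "form (z n) (z n) = W one (\<lambda>e s. green' (f (r n)) e s - green' x e s)
      (\<lambda>e s. green' (f (r n)) e s - green' x e s)" for n
    unfolding form_def z_eq2
    using green'_lincomb[OF ec[of "r n"] x, of _ _ 1 "-1"] by (intro W_cong) simp
  have "(\<lambda>n. form (z n) (z n)) \<longlonglongrightarrow> 0"
  proof (rule tendsto_sandwich)
    show "\<forall>\<^sub>F n in sequentially. 0 \<le> form (z n) (z n)"
      using form_nonneg[OF zc] by simp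
    have "mean_zero (z n)" for n
      unfolding z_eq2 by (intro mean_zero_lincomb f mx)
    then show "\<forall>\<^sub>F n in sequentially. form (z n) (z n) \<le> M * W \<sigma> (z n) (z n)"
      using form_le_M by simp
    show "(\<lambda>n. M * W \<sigma> (z n) (z n)) \<longlonglongrightarrow> 0"
      using tendsto_mult_left[OF z0, of M] by simp
  qed simp
  then have "(\<lambda>n. form (f (r n)) (f (r n))) \<longlonglongrightarrow> form x x"
    unfolding formz
    by (subst (1 2) form_def) (intro W_square_continuous green'_cont ec x; simp)
  moreover have "(\<lambda>n. form (f (r n)) (f (r n))) \<longlonglongrightarrow> M"
    using LIMSEQ_subseq_LIMSEQ[OF lim r] by (simp add: o_def)
  ultimately have "form x x = M" by (rule LIMSEQ_unique)
  then show thesis using z0 unfolding z_def by (intro that[OF r mx Wx])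
qed

lemma maximizer_exists: "\<exists>x. mean_zero x \<and> W \<sigma> x x = 1 \<and> form x x = M"
proof -
  let ?S = "{form f f | f. mean_zero f \<and> W \<sigma> f f = 1}"
  have "\<exists>f. mean_zero f \<and> W \<sigma> f f = 1 \<and> M - 1 / real (Suc n) < form f f" for n
  proof -
    have "?S \<noteq> {}" using exists_mean_zero_positive by blast
    moreover have "M - 1 / real (Suc n) < Sup ?S" by (simp add: M_def)
    ultimately show ?thesis
      using less_cSupE[of "M - 1 / real (Suc n)" ?S] by blast
  qed
  then obtain f where f: "\<And>n. mean_zero (f n)" "\<And>n. W \<sigma> (f n) (f n) = 1"
    "\<And>n. M - 1 / real (Suc n) < form (f n) (f n)" by metis
  have "(\<lambda>n. form (f n) (f n)) \<longlonglongrightarrow> M"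
  proof (rule tendsto_sandwich)
    show "\<forall>\<^sub>F n in sequentially. M - 1 / real (Suc n) \<le> form (f n) (f n)"
      using f(3) by (simp add: less_imp_le)
    show "\<forall>\<^sub>F n in sequentially. form (f n) (f n) \<le> M"
      using form_le_M[OF f(1)] f(2) by simp
    show "(\<lambda>n. M - 1 / real (Suc n)) \<longlonglongrightarrow> M"
      using tendsto_diff[OF tendsto_const[of M] LIMSEQ_inverse_real_of_nat]
      by (simp add: inverse_eq_divide)
  qed simp
  then show ?thesis
    by (rule maximizing_sequence_converges[OF f(1,2)]) (intro exI conjI)
qed

lemma eigen_exists: "\<exists>u u' w. eigen (1 / M) u u' w \<and> W \<sigma> u u = 1"
proof -
  obtain x where "mean_zero x" "W \<sigma> x x = 1" "form x x = M"
    using maximizer_exists by blast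
  then show ?thesis using maximizer_eigen[of x] by auto
qed

end

section \<open>Nodal domains of eigenfunctions\<close>

lemma DERIV_locally_constant:
  fixes f :: "real \<Rightarrow> real"
  assumes "(f has_real_derivative d) (at x within {a..b})" "a \<le> l" "l < x" "x < r" "r \<le> b"
    and "\<And>s. s \<in> {l..r} \<Longrightarrow> f s = c"
  shows "d = 0"
proof -
  have "(f has_real_derivative d) (at x)"
    using assms by (simp add: at_within_Icc_at)
  moreover have "(f has_real_derivative 0) (at x)"
    by (rule has_field_derivative_transform_within_open[of "\<lambda>_. c" _ _ "{l<..<r}"])
       (use assms in auto)
  ultimately show ?thesis by (rule DERIV_unique)
qed

text \<open>A positive slope at both end zeros makes \<open>f\<close> positive just after 0 and
  negative just before \<open>l\<close>.\<close>

lemma interior_zero_pos: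
  fixes f :: "real \<Rightarrow> real"
  assumes "0 < l" and deriv: "\<And>s. s \<in> {0..l} \<Longrightarrow> (f has_real_derivative f' s) (at s within {0..l})"
    and "f 0 = 0" "f l = 0" "0 < f' 0" "0 < f' l"
  shows "\<exists>z\<in>{0<..<l}. f z = 0"
proof -
  obtain d1 where d1: "0 < d1" "\<And>h. 0 < h \<Longrightarrow> h \<in> {0..l} \<Longrightarrow> h < d1 \<Longrightarrow> 0 < f h"
    using has_real_derivative_pos_inc_right[OF deriv[of 0]] assms by auto
  obtain d2 where d2: "0 < d2" "\<And>h. 0 < h \<Longrightarrow> l - h \<in> {0..l} \<Longrightarrow> h < d2 \<Longrightarrow> f (l - h) < 0"
    using has_real_derivative_pos_inc_left[OF deriv[of l]] assms by auto
  \<comment> \<open>Dividing by 3 puts \<open>h\<close> strictly below both radii and keeps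
    \<open>h\<close> to the left of \<open>l - h\<close>.\<close>
  define h where "h = min (min d1 d2) l / 3"
  have h: "0 < h" "h < d1" "h < d2" "3 * h \<le> l" using d1 d2 \<open>0 < l\<close> by (auto simp: h_def)
  have "0 < f h" "f (l - h) < 0" using d1(2)[of h] d2(2)[of h] h by auto
  have c: "continuous_on {h..l - h} f"
  proof (rule continuous_on_subset)
    show "continuous_on {0..l} f"
      using deriv by (meson DERIV_continuous continuous_on_eq_continuous_within)
  qed (use h in auto)
  obtain z where "h \<le> z" "z \<le> l - h" "f z = 0"
    using IVT2'[of f "l - h" 0 h] c \<open>0 < f h\<close> \<open>f (l - h) < 0\<close> h by auto
  then show ?thesis using h by (intro bexI[of _ z]) auto
qed

lemma interior_zero:
  fixes f :: "real \<Rightarrow> real"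
  assumes "0 < l" and deriv: "\<And>s. s \<in> {0..l} \<Longrightarrow> (f has_real_derivative f' s) (at s within {0..l})"
    and "f 0 = 0" "f l = 0" "f' 0 = f' l" "f' 0 \<noteq> 0"
  shows "\<exists>z\<in>{0<..<l}. f z = 0"
proof (cases "0 < f' 0")
  case True
  then show ?thesis using interior_zero_pos[of l f f'] assms by auto
next
  case False
  have "((\<lambda>s. - f s) has_real_derivative - f' s) (at s within {0..l})" if "s \<in> {0..l}" for s
    using deriv[OF that] by (rule DERIV_minus)
  then have "\<exists>z\<in>{0<..<l}. - f z = 0"
    using assms False by (intro interior_zero_pos[of l "\<lambda>s. - f s" "\<lambda>s. - f' s"]) auto
  then show ?thesis by simp
qed

lemma continuous_on_real_polynomial:
  fixes p :: "real \<Rightarrow> real"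
  shows "real_polynomial_function p \<Longrightarrow> continuous_on S p"
  using continuous_on_polymonial_function real_polynomial_function_eq by blast

text \<open>Up to a factor the deviation \<open>H\<close> of \<open>F\<close> from its mean would
  do, since the integral of \<open>H F\<close> is that of \<open>H^2\<close>. A polynomial
  approximation replaces it because the variation of the density must be smooth; a multiple then
  normalises the pairing to -1.\<close>

lemma polynomial_separating_from_constants:
  fixes F :: "real \<Rightarrow> real"
  assumes l: "0 < l" and F: "continuous_on {0..l} F" and nc: "\<exists>s\<in>{0..l}. F s \<noteq> F 0"
  shows "\<exists>p. real_polynomial_function p \<and> integral {0..l} p = 0 \<and> integral {0..l} (\<lambda>s. p s * F s) = -1"
proof -
  define m where "m = integral {0..l} F / l"
  define H where "H s = F s - m" for s
  have H: "continuous_on {0..l} H" unfolding H_def by (intro continuous_intros F)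
  have Hint: "integral {0..l} H = 0"
  proof -
    have "integral {0..l} H = integral {0..l} F - integral {0..l} (\<lambda>s. m)"
      unfolding H_def by (intro integral_diff integrable_continuous_interval continuous_intros F)
    then show ?thesis using l by (simp add: m_def)
  qed
  define D where "D = integral {0..l} (\<lambda>s. H s * H s)"
  have HH: "continuous_on {0..l} (\<lambda>s. H s * H s)" by (intro continuous_intros H)
  have "D \<noteq> 0"
  proof
    assume "D = 0"
    then have "\<forall>s\<in>{0..l}. H s * H s = 0"
      unfolding D_def using integral_eq_0_iff[OF HH l] by simp
    then have "F s = m" if "s \<in> {0..l}" for s using that by (auto simp: H_def)
    then show False using nc l by auto
  qed
  moreover have "0 \<le> D" unfolding D_def
    by (intro Henstock_Kurzweil_Integration.integral_nonneg integrable_continuous_interval HH) auto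
  ultimately have D: "0 < D" by simp
  have "bounded (H ` {0..l})" using H compact_continuous_image compact_imp_bounded by blast
  then obtain B where B: "0 < B" "\<And>s. s \<in> {0..l} \<Longrightarrow> \<bar>H s\<bar> \<le> B"
    unfolding bounded_pos by auto
  \<comment> \<open>Allows an error of at most \<open>D / 2\<close> in the pairing, which then
    cannot vanish.\<close>
  define \<epsilon> where "\<epsilon> = D / (2 * l * B)"
  have \<epsilon>: "0 < \<epsilon>" "\<epsilon> * B * l = D / 2" using D l B by (auto simp: \<epsilon>_def)
  obtain g where g: "real_polynomial_function g" "\<And>s. s \<in> {0..l} \<Longrightarrow> \<bar>F s - g s\<bar> < \<epsilon>"
    using Stone_Weierstrass_real_polynomial_function[of "{0..l}" F \<epsilon>] F \<epsilon> by auto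
  define a where "a = integral {0..l} g / l"
  define p where "p s = g s - a" for s
  have p: "real_polynomial_function p" unfolding p_def
    by (intro real_polynomial_function_diff g) auto
  have pint: "integral {0..l} p = 0"
  proof -
    have "integral {0..l} p = integral {0..l} g - integral {0..l} (\<lambda>s. a)"
      unfolding p_def by (intro integral_diff integrable_continuous_interval continuous_intros continuous_on_real_polynomial g)
    then show ?thesis using l by (simp add: a_def)
  qed
  have int: "(\<lambda>s. u s * v s) integrable_on {0..l}"
    if "continuous_on {0..l} u" "continuous_on {0..l} v" for u v :: "real \<Rightarrow> real"
    using that by (intro integrable_continuous_interval continuous_intros)
  have gF: "continuous_on {0..l} (\<lambda>s. g s - F s)" using continuous_on_real_polynomial[OF g(1)] F by (intro continuous_intros)
  \<comment> \<open>Written with \<open>F = H + m\<close> and \<open>g = p + a\<close>; the last two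
    terms integrate to 0.\<close>
  have "integral {0..l} (\<lambda>s. p s * F s)
      = integral {0..l} (\<lambda>s. H s * H s + ((g s - F s) * H s + (m * p s + (m - a) * H s)))"
    unfolding p_def H_def by (simp add: algebra_simps)
  also have "\<dots> = D + (integral {0..l} (\<lambda>s. (g s - F s) * H s) + (m * integral {0..l} p + (m - a) * integral {0..l} H))"
    unfolding D_def
    by (simp add: integral_add integrable_add int H gF integrable_continuous_interval continuous_on_real_polynomial p
        integrable_on_mult_right)
  finally have eq: "integral {0..l} (\<lambda>s. p s * F s) = D + integral {0..l} (\<lambda>s. (g s - F s) * H s)"
    using pint Hint by simp
  have "norm (integral {0..l} (\<lambda>s. (g s - F s) * H s)) \<le> (\<epsilon> * B) * (l - 0)"
  proof (rule integral_bound)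
    show "norm ((g s - F s) * H s) \<le> \<epsilon> * B" if "s \<in> {0..l}" for s
      using g(2)[OF that] B(2)[OF that] \<epsilon>(1) unfolding real_norm_def abs_mult
      by (intro mult_mono) auto
  qed (use l in \<open>auto intro!: continuous_intros gF H\<close>)
  then have "integral {0..l} (\<lambda>s. p s * F s) \<noteq> 0" using eq \<epsilon>(2) D by simp
  then have "integral {0..l} (\<lambda>s. (- 1 / integral {0..l} (\<lambda>s. p s * F s)) * p s * F s) = -1"
    by (simp add: mult.assoc)
  moreover have "integral {0..l} (\<lambda>s. (- 1 / integral {0..l} (\<lambda>s. p s * F s)) * p s) = 0"
    using pint by simp
  moreover have "real_polynomial_function (\<lambda>s. (- 1 / integral {0..l} (\<lambda>s. p s * F s)) * p s)"
    by (intro real_polynomial_function.intros p)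
  ultimately show ?thesis by blast
qed

context weighted_edges
begin

section \<open>Uniqueness and zeros for a fixed eigenvalue\<close>

lemma eigen_lincomb:
  assumes "eigen \<mu> u u' w" "eigen \<mu> v v' z"
  shows "eigen \<mu> (\<lambda>e s. a * u e s + b * v e s) (\<lambda>e s. a * u' e s + b * v' e s) (a * w + b * z)"
  unfolding eigen_def
proof (intro conjI ballI)
  fix e s assume "e \<in> E" "s \<in> {0..L e}"
  then have
    "(u e has_real_derivative u' e s) (at s within {0..L e})"
    "(v e has_real_derivative v' e s) (at s within {0..L e})"
    "(u' e has_real_derivative - (\<mu> * \<sigma> e s * u e s)) (at s within {0..L e})"
    "(v' e has_real_derivative - (\<mu> * \<sigma> e s * v e s)) (at s within {0..L e})"
    using assms by (auto simp: eigen_def)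
  then show "((\<lambda>s. a * u e s + b * v e s) has_real_derivative a * u' e s + b * v' e s) (at s within {0..L e})"
    and "((\<lambda>s. a * u' e s + b * v' e s) has_real_derivative - (\<mu> * \<sigma> e s * (a * u e s + b * v e s))) (at s within {0..L e})"
    by (auto intro!: derivative_eq_intros simp: algebra_simps)
next
  have "(\<Sum>e\<in>E. a * u' e 0 + b * v' e 0 - (a * u' e (L e) + b * v' e (L e)))
      = a * (\<Sum>e\<in>E. u' e 0 - u' e (L e)) + b * (\<Sum>e\<in>E. v' e 0 - v' e (L e))"
    unfolding sum_distrib_left sum.distrib[symmetric]
    by (intro sum.cong) (auto simp: algebra_simps)
  then show "(\<Sum>e\<in>E. a * u' e 0 + b * v' e 0 - (a * u' e (L e) + b * v' e (L e))) = 0"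
    using assms by (simp add: eigen_def)
qed (use assms in \<open>auto simp: eigen_def\<close>)

lemma eigen_zero_data:
  assumes u: "eigen \<mu> u u' w" and e: "e \<in> E" and z: "z \<in> {0..L e}" "u e z = 0" "u' e z = 0"
    and s: "s \<in> {0..L e}"
  shows "u e s = 0"
proof -
  have "u e s = 0 \<and> u' e s = 0"
  proof (rule linear_second_order_zero[of 0 "L e" "u e" "u' e" "\<lambda>s. - (\<mu> * \<sigma> e s)" z])
    show "(u' e has_real_derivative - (\<mu> * \<sigma> e s) * u e s) (at s within {0..L e})" if "s \<in> {0..L e}" for s
      using u e that by (auto simp: eigen_def)
    show "continuous_on {0..L e} (\<lambda>s. - (\<mu> * \<sigma> e s))"
      using edge_contD[OF \<sigma>_cont e] by (intro continuous_intros)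
  qed (use u e z s in \<open>auto simp: eigen_def\<close>)
  then show ?thesis by simp
qed

lemma eigen_zero_interval:
  assumes u: "eigen \<mu> u u' w" and e: "e \<in> E" and ab: "0 \<le> a" "a < b" "b \<le> L e"
    and zero: "\<And>s. s \<in> {a..b} \<Longrightarrow> u e s = 0" and s: "s \<in> {0..L e}"
  shows "u e s = 0"
proof -
  have "u' e ((a + b) / 2) = 0"
  proof (rule DERIV_locally_constant[of "u e" _ _ 0 "L e" a b 0, OF _ ab(1) _ _ ab(3) zero])
    have "(a + b) / 2 \<in> {0..L e}" using ab by auto
    then show "(u e has_real_derivative u' e ((a + b) / 2)) (at ((a + b) / 2) within {0..L e})"
      using u e unfolding eigen_def by blast
  qed (use ab in auto)
  then show ?thesis
    using ab zero[of "(a + b) / 2"] by (intro eigen_zero_data[OF u e _ _ _ s, of "(a + b) / 2"]) auto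
qed

text \<open>The Wronskian of \<open>u\<close> and \<open>v\<close> is constant, so \<open>u\<close> has the same slope at both ends.\<close>

lemma eigen_interior_zero:
  assumes v: "eigen \<mu> v v' 1" and u: "eigen \<mu> u u' 0" and e: "e \<in> E"
    and nz: "s \<in> {0..L e}" "u e s \<noteq> 0"
  shows "\<exists>z\<in>{0<..<L e}. u e z = 0"
proof (rule interior_zero[of "L e" "u e" "u' e"])
  have d: "(u e has_real_derivative u' e s) (at s within {0..L e})"
    "(v e has_real_derivative v' e s) (at s within {0..L e})"
    "(u' e has_real_derivative - (\<mu> * \<sigma> e s * u e s)) (at s within {0..L e})"
    "(v' e has_real_derivative - (\<mu> * \<sigma> e s * v e s)) (at s within {0..L e})"
    if "s \<in> {0..L e}" for s
    using u v e that by (auto simp: eigen_def)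
  show "0 < L e" using L_pos[OF e] .
  show "(u e has_real_derivative u' e s) (at s within {0..L e})" if "s \<in> {0..L e}" for s
    using d(1)[OF that] .
  have ends: "u e 0 = 0" "u e (L e) = 0" "v e 0 = 1" "v e (L e) = 1"
    using u v e unfolding eigen_def by blast+
  then show "u e 0 = 0" "u e (L e) = 0" by blast+
  define w where "w s = v e s * u' e s - v' e s * u e s" for s
  have "(w has_real_derivative 0) (at s within {0..L e})" if "s \<in> {0..L e}" for s
    unfolding w_def using that
    by (auto intro!: derivative_eq_intros d simp: algebra_simps)
  then have "w 0 = w (L e)"
    using has_field_derivative_zero_constant[of "{0..L e}" w] L_pos[OF e]
    by (metis atLeastAtMost_iff convex_closed_interval less_imp_le order_refl)
  then show "u' e 0 = u' e (L e)"
    using ends by (simp add: w_def)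
  show "u' e 0 \<noteq> 0"
  proof
    assume "u' e 0 = 0"
    then have "u e s = 0"
      using ends(1) L_pos[OF e] by (intro eigen_zero_data[OF u e _ _ _ nz(1), of 0]) auto
    then show False using nz by simp
  qed
qed

text \<open>On a nodal domain \<open>[0, z e]\<close> the energy of \<open>v\<close> is \<open>1 / M\<close> times its mass, so comparing
  \<open>green' f\<close> with \<open>M * v'\<close> there shows that \<open>f\<close> attains the maximum \<open>M\<close>.\<close>

lemma nodal_cut_maximizes:
  fixes v v' :: "'a \<Rightarrow> real \<Rightarrow> real" and z :: "'a \<Rightarrow> real"
  assumes z: "\<And>e. e \<in> E \<Longrightarrow> z e \<in> {0..L e}"
    and v: "\<And>e s. e \<in> E \<Longrightarrow> s \<in> {0..L e} \<Longrightarrow> (v e has_real_derivative v' e s) (at s within {0..L e})"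
    and v': "\<And>e s. e \<in> E \<Longrightarrow> s \<in> {0..L e} \<Longrightarrow>
      (v' e has_real_derivative - (1 / M * \<sigma> e s * v e s)) (at s within {0..L e})"
    and v0: "\<And>e. e \<in> E \<Longrightarrow> v e 0 = 0" and vz: "\<And>e. e \<in> E \<Longrightarrow> v e (z e) = 0"
  defines "f \<equiv> \<lambda>e s. if s \<le> z e then v e s else 0"
  shows "edge_cont f" and "M * W \<sigma> f f \<le> form f f"
proof -
  have vc: "continuous_on {0..L e} (v e)" "continuous_on {0..L e} (v' e)" if "e \<in> E" for e
    using v[OF that] v'[OF that] by (meson DERIV_continuous continuous_on_eq_continuous_within)+
  show fc: "edge_cont f"
    unfolding edge_cont_def
  proof
    fix e assume e: "e \<in> E"
    have eq: "{0..L e} = {0..z e} \<union> {z e..L e}" using z[OF e] by auto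
    show "continuous_on {0..L e} (f e)"
      unfolding eq f_def
      by (intro continuous_on_cases)
         (use vz[OF e] z[OF e] in \<open>auto intro!: continuous_on_subset[OF vc(1)[OF e]] continuous_on_const\<close>)
  qed
  have edge: "M * integral {0..L e} (\<lambda>s. \<sigma> e s * (f e s * f e s))
     \<le> integral {0..L e} (\<lambda>s. green' f e s * green' f e s)" if e: "e \<in> E" for e
  proof -
    define g where "g = green' f e"
    have sub: "{0..z e} \<subseteq> {0..L e}" using z[OF e] by auto
    have z0: "0 \<le> z e" "z e \<le> L e" using z[OF e] by auto
    note \<sigma>c = edge_contD[OF \<sigma>_cont e] and fce = edge_contD[OF fc e]
    have gc: "continuous_on {0..L e} g"
      unfolding g_def using edge_contD[OF green'_cont[OF fc] e] .
    define S where "S = integral {0..z e} (\<lambda>s. \<sigma> e s * (v e s * v e s))"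
    have "integral {0..L e} (\<lambda>s. \<sigma> e s * (f e s * f e s))
        = integral {0..z e} (\<lambda>s. \<sigma> e s * (f e s * f e s)) + integral {z e..L e} (\<lambda>s. \<sigma> e s * (f e s * f e s))"
      by (rule Henstock_Kurzweil_Integration.integral_combine[OF z0, symmetric])
         (intro integrable_continuous_interval continuous_intros \<sigma>c fce)
    also have "integral {z e..L e} (\<lambda>s. \<sigma> e s * (f e s * f e s)) = integral {z e..L e} (\<lambda>s. 0)"
      using vz[OF e] by (intro integral_cong) (auto simp: f_def)
    also have "integral {0..z e} (\<lambda>s. \<sigma> e s * (f e s * f e s)) = S"
      unfolding S_def by (intro integral_cong) (auto simp: f_def)
    finally have mass_f: "integral {0..L e} (\<lambda>s. \<sigma> e s * (f e s * f e s)) = S" by simp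
    have c: "continuous_on {0..z e} (\<sigma> e)" "continuous_on {0..z e} (v e)" "continuous_on {0..z e} (v' e)"
      "continuous_on {0..z e} g" "continuous_on {0..z e} (f e)"
      using \<sigma>c vc[OF e] gc fce sub by (auto intro: continuous_on_subset)
    have dv: "(v e has_real_derivative v' e s) (at s within {0..z e})"
      and dv': "(v' e has_real_derivative - (1 / M * \<sigma> e s * v e s)) (at s within {0..z e})"
      and dg: "(g has_real_derivative - (\<sigma> e s * f e s)) (at s within {0..z e})"
      if "s \<in> {0..z e}" for s
      using that sub v[OF e, of s] v'[OF e, of s] green'_deriv[OF fc e, of s] unfolding g_def
      by (auto intro: DERIV_subset)
    have gv: "integral {0..z e} (\<lambda>s. g s * v' e s) = S"
    proof -
      have "integral {0..z e} (\<lambda>s. g s * v' e s)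
          = g (z e) * v e (z e) - g 0 * v e 0 - integral {0..z e} (\<lambda>s. - (\<sigma> e s * f e s) * v e s)"
        by (rule integral_by_parts_vanishing[OF z0(1) dg dv c(3)]) (auto intro!: continuous_intros c)
      also have "integral {0..z e} (\<lambda>s. - (\<sigma> e s * f e s) * v e s)
          = integral {0..z e} (\<lambda>s. - (\<sigma> e s * (v e s * v e s)))"
        by (intro integral_cong) (auto simp: f_def)
      finally show ?thesis using v0[OF e] vz[OF e] by (simp add: S_def)
    qed
    have vv: "integral {0..z e} (\<lambda>s. v' e s * v' e s) = S / M"
    proof -
      have "integral {0..z e} (\<lambda>s. v' e s * v' e s)
          = v' e (z e) * v e (z e) - v' e 0 * v e 0 - integral {0..z e} (\<lambda>s. - (1 / M * \<sigma> e s * v e s) * v e s)"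
        using M_pos
        by (intro integral_by_parts_vanishing[OF z0(1) dv' dv c(3)]) (auto intro!: continuous_intros c)
      also have "(\<lambda>s. - (1 / M * \<sigma> e s * v e s) * v e s) = (\<lambda>s. (- 1 / M) * (\<sigma> e s * (v e s * v e s)))"
        by (simp add: algebra_simps)
      finally show ?thesis using v0[OF e] vz[OF e] by (simp add: S_def)
    qed
    have i: "(\<lambda>s. g s * g s) integrable_on {0..z e}" "(\<lambda>s. g s * v' e s) integrable_on {0..z e}"
      "(\<lambda>s. v' e s * v' e s) integrable_on {0..z e}"
      by (intro integrable_continuous_interval continuous_intros c)+
    \<comment> \<open>In general the cut has a kink at \<open>z e\<close>, so it is not a
      \<open>vertex_C1\<close> trial function. Instead the square of \<open>green' f - M v'\<close>
      is integrated: the cross term is \<open>S\<close> and the energy of \<open>v\<close> is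
      \<open>S / M\<close>, so the integral of \<open>g^2\<close> is at least
      \<open>2 M S - M S\<close>.\<close>
    have "0 \<le> integral {0..z e} (\<lambda>s. (g s - M * v' e s) * (g s - M * v' e s))"
      by (intro Henstock_Kurzweil_Integration.integral_nonneg integrable_continuous_interval
          continuous_intros c) auto
    also have "\<dots> = integral {0..z e} (\<lambda>s. g s * g s + ((- 2 * M) * (g s * v' e s) + M\<^sup>2 * (v' e s * v' e s)))"
      by (simp add: algebra_simps power2_eq_square)
    also have "\<dots> = integral {0..z e} (\<lambda>s. g s * g s) + ((- 2 * M) * S + M\<^sup>2 * (S / M))"
      by (intro integral_unique has_integral_add has_integral_mult_right
          integrable_integral[OF i(1)] integrable_integral[OF i(2), unfolded gv]
          integrable_integral[OF i(3), unfolded vv])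
    finally have "M * S \<le> integral {0..z e} (\<lambda>s. g s * g s)"
      using M_pos by (simp add: power2_eq_square mult.commute)
    also have "\<dots> \<le> integral {0..L e} (\<lambda>s. g s * g s)"
      using sub by (intro integral_subset_le integrable_continuous_interval continuous_intros c gc) auto
    finally show ?thesis by (simp add: mass_f g_def)
  qed
  show "M * W \<sigma> f f \<le> form f f"
    unfolding form_def W_def sum_distrib_left using edge by (intro sum_mono) simp
qed

lemma exists_edge_without_vertex_zero_eigenfunctions:
  assumes v: "eigen (1 / M) v v' 1" and e12: "e1 \<in> E" "e2 \<in> E" "e1 \<noteq> e2"
  shows "\<exists>e\<in>E. \<forall>u u'. eigen (1 / M) u u' 0 \<longrightarrow> (\<forall>s\<in>{0..L e}. u e s = 0)"
proof (rule ccontr)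
  assume neg: "\<not> ?thesis"
  have ex: "\<exists>u u' z s. eigen (1 / M) u u' 0 \<and> z \<in> {0<..<L e} \<and> u e z = 0 \<and> s \<in> {0..L e} \<and> u e s \<noteq> 0"
    if e: "e \<in> E" for e
  proof -
    obtain u u' s where "eigen (1 / M) u u' 0" "s \<in> {0..L e}" "u e s \<noteq> 0"
      using neg e by blast
    then show ?thesis using eigen_interior_zero[OF v, of u u' e s] e by blast
  qed
  obtain u1 u1' z1 s1 where u1: "eigen (1 / M) u1 u1' 0" "z1 \<in> {0<..<L e1}" "u1 e1 z1 = 0"
      "s1 \<in> {0..L e1}" "u1 e1 s1 \<noteq> 0"
    using ex[OF e12(1)] by blast
  obtain u2 u2' z2 s2 where u2: "eigen (1 / M) u2 u2' 0" "z2 \<in> {0<..<L e2}" "u2 e2 z2 = 0"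
      "s2 \<in> {0..L e2}" "u2 e2 s2 \<noteq> 0"
    using ex[OF e12(2)] by blast
  \<comment> \<open>Any interior zero will do, not just the first one. On the remaining edges
    \<open>V\<close> is 0, and there 0 satisfies the hypotheses of
    \<open>nodal_cut_maximizes\<close>.\<close>
  define z where "z e = (if e = e1 then z1 else if e = e2 then z2 else 0)" for e
  define V where "V a b e s = (if e = e1 then a * u1 e1 s else if e = e2 then b * u2 e2 s else 0)" for a b e s
  define V' where "V' a b e s = (if e = e1 then a * u1' e1 s else if e = e2 then b * u2' e2 s else 0)" for a b e s
  define f where "f a b e s = (if s \<le> z e then V a b e s else 0)" for a b e s
  have u12: "(u1 e has_real_derivative u1' e s) (at s within {0..L e})"
    "(u1' e has_real_derivative - (1 / M * \<sigma> e s * u1 e s)) (at s within {0..L e})"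
    "(u2 e has_real_derivative u2' e s) (at s within {0..L e})"
    "(u2' e has_real_derivative - (1 / M * \<sigma> e s * u2 e s)) (at s within {0..L e})"
    if "e \<in> E" "s \<in> {0..L e}" for e s
    using u1(1) u2(1) that unfolding eigen_def by blast+
  have dV: "(V a b e has_real_derivative V' a b e s) (at s within {0..L e})"
    and dV': "(V' a b e has_real_derivative - (1 / M * \<sigma> e s * V a b e s)) (at s within {0..L e})"
    if "e \<in> E" "s \<in> {0..L e}" for a b e s
    using u12[OF that] unfolding V_def[abs_def] V'_def[abs_def]
    by (auto intro!: derivative_eq_intros simp: algebra_simps)
  have zE: "z e \<in> {0..L e}" if "e \<in> E" for e
    using u1(2) u2(2) L_pos[OF that] by (auto simp: z_def)
  have V0: "V a b e 0 = 0" and Vz: "V a b e (z e) = 0" if "e \<in> E" for a b e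
  proof -
    have "u1 e1 0 = 0" "u2 e2 0 = 0"
      using u1(1) u2(1) e12 unfolding eigen_def by blast+
    then show "V a b e 0 = 0" "V a b e (z e) = 0"
      using u1(3) u2(3) that by (auto simp: V_def z_def)
  qed
  have fc: "edge_cont (f a b)" and fmax: "M * W \<sigma> (f a b) (f a b) \<le> form (f a b) (f a b)" for a b
    using nodal_cut_maximizes[where z = z and v = "V a b" and v' = "V' a b", OF zE dV dV' V0 Vz]
    unfolding f_def[abs_def] by simp_all
  have lin: "f a b = (\<lambda>e s. a * f 1 0 e s + b * f 0 1 e s)" for a b
    by (auto simp: f_def V_def fun_eq_iff)
  \<comment> \<open>Two parameters against the single condition of mean zero. Every combination
    attains \<open>M\<close>, since \<open>nodal_cut_maximizes\<close> applies to
    \<open>V a b\<close> itself.\<close>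
  obtain a b where ab: "a * W \<sigma> (f 1 0) one + b * W \<sigma> (f 0 1) one = 0" "a \<noteq> 0 \<or> b \<noteq> 0"
  proof (cases "W \<sigma> (f 1 0) one = 0 \<and> W \<sigma> (f 0 1) one = 0")
    case True
    then show thesis using that[of 1 0] by simp
  next
    case False
    then show thesis using that[of "W \<sigma> (f 0 1) one" "- W \<sigma> (f 1 0) one"] by auto
  qed
  have "W \<sigma> (f a b) one = a * W \<sigma> (f 1 0) one + b * W \<sigma> (f 0 1) one"
    unfolding lin[of a b] by (intro W_lincomb_left \<sigma>_cont fc edge_cont_const)
  then have "mean_zero (f a b)" using fc ab(1) by (simp add: mean_zero_def)
  then obtain f' w where fe: "eigen (1 / M) (f a b) f' w"
    using maximizer_eigen fmax by blast
  \<comment> \<open>The cut is 0 beyond \<open>z e\<close>, so uniqueness spreads the zero over the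
    whole edge.\<close>
  have fz: "f a b e s = 0" if e: "e \<in> {e1, e2}" and s: "s \<in> {0..L e}" for e s
  proof (rule eigen_zero_interval[OF fe, of e "(z e + L e) / 2" "L e"])
    have "z e < L e" "0 < z e" using e u1(2) u2(2) by (auto simp: z_def)
    then show "0 \<le> (z e + L e) / 2" "(z e + L e) / 2 < L e" by auto
    show "f a b e s = 0" if "s \<in> {(z e + L e) / 2..L e}" for s
      using that \<open>z e < L e\<close> by (auto simp: f_def)
  qed (use e e12 s in auto)
  show False
  proof (cases "a = 0")
    case False
    have "u1 e1 s = 0" if "s \<in> {0..z1}" for s
      using fz[of e1 s] that u1(2) False by (auto simp: f_def V_def z_def)
    then have "u1 e1 s1 = 0"
      using u1(2) by (intro eigen_zero_interval[OF u1(1) e12(1) _ _ _ _ u1(4), of 0 z1]) auto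
    then show False using u1(5) by simp
  next
    case True
    then have "b \<noteq> 0" using ab by simp
    have "u2 e2 s = 0" if "s \<in> {0..z2}" for s
      using fz[of e2 s] that u2(2) \<open>b \<noteq> 0\<close> e12(3) by (auto simp: f_def V_def z_def)
    then have "u2 e2 s2 = 0"
      using u2(2) by (intro eigen_zero_interval[OF u2(1) e12(2) _ _ _ _ u2(4), of 0 z2]) auto
    then show False using u2(5) by simp
  qed
qed

end

section \<open>A direction that decreases every Rayleigh quotient\<close>

text \<open>A rescaled Beta density: a polynomial, hence smooth, with integral \<open>l\<close> for
  every \<open>n\<close> and first moment \<open>l^2 / (n + 2)\<close>. It keeps its mass while
  concentrating at the end \<open>s = 0\<close>.\<close>

definition bump :: "real \<Rightarrow> nat \<Rightarrow> real \<Rightarrow> real" where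
  "bump l n s = real (n + 1) * (1 - s / l) ^ n"

lemma bump_nonneg: "0 < l \<Longrightarrow> s \<in> {0..l} \<Longrightarrow> 0 \<le> bump l n s"
  by (simp add: bump_def field_simps)

lemma polynomial_bump: "real_polynomial_function (bump l n)"
proof -
  have "real_polynomial_function (\<lambda>s. (1 - s / l) ^ n)"
  proof (intro real_polynomial_function_power real_polynomial_function_diff)
    show "real_polynomial_function (\<lambda>s. s / l)"
      by (intro real_polynomial_function.intros(1) bounded_linear_divide)
  qed auto
  then show ?thesis
    unfolding bump_def[abs_def] by (intro real_polynomial_function.intros(2,4))
qed

lemma continuous_on_bump: "continuous_on S (bump l n)"
  unfolding bump_def[abs_def] divide_inverse by (intro continuous_intros)

lemma integral_bump:
  assumes l: "0 < l"
  shows "integral {0..l} (bump l n) = l"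
proof -
  have "((bump l n) has_integral (- l * (1 - l / l) ^ Suc n - (- l * (1 - 0 / l) ^ Suc n))) {0..l}"
  proof (rule fundamental_theorem_of_calculus)
    fix s assume "s \<in> {0..l}"
    have "((\<lambda>s. - l * (1 - s / l) ^ Suc n) has_real_derivative bump l n s) (at s within {0..l})"
      unfolding bump_def using l by (auto intro!: derivative_eq_intros simp del: power_Suc)
    then show "((\<lambda>s. - l * (1 - s / l) ^ Suc n) has_vector_derivative bump l n s) (at s within {0..l})"
      by (simp add: has_real_derivative_iff_has_vector_derivative)
  qed (use l in simp)
  then show ?thesis using l by (simp add: integral_unique)
qed

lemma integral_bump_times:
  assumes l: "0 < l"
  shows "integral {0..l} (\<lambda>s. bump l n s * s) = l\<^sup>2 / real (n + 2)"
proof -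
  \<comment> \<open>Integration by parts: \<open>s\<close> times the antiderivative
    \<open>- l (1 - s / l)^(n + 1)\<close> of the bump, minus an antiderivative of that
    function.\<close>
  define G where "G s = - l * (s * (1 - s / l) ^ Suc n) - l\<^sup>2 / real (n + 2) * (1 - s / l) ^ Suc (Suc n)" for s
  have "((\<lambda>s. bump l n s * s) has_integral (G l - G 0)) {0..l}"
  proof (rule fundamental_theorem_of_calculus)
    fix s assume "s \<in> {0..l}"
    define a where "a = 1 - s / l"
    have pow: "((\<lambda>s. (1 - s / l) ^ Suc m) has_real_derivative real (Suc m) * a ^ m * (- 1 / l))
        (at s within {0..l})" for m
      unfolding a_def using l by (auto intro!: derivative_eq_intros simp del: power_Suc)
    have "(G has_real_derivative
        - l * (1 * a ^ Suc n + real (Suc n) * a ^ n * (- 1 / l) * s)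
        - l\<^sup>2 / real (n + 2) * (real (Suc (Suc n)) * a ^ Suc n * (- 1 / l))) (at s within {0..l})"
      unfolding G_def[abs_def] a_def
      by (intro DERIV_diff DERIV_cmult DERIV_mult DERIV_ident pow[unfolded a_def])
    moreover have "- l * (1 * a ^ Suc n + real (Suc n) * a ^ n * (- 1 / l) * s)
        - l\<^sup>2 / real (n + 2) * (real (Suc (Suc n)) * a ^ Suc n * (- 1 / l)) = bump l n s * s"
    proof -
      have "l\<^sup>2 / real (n + 2) * (real (Suc (Suc n)) * a ^ Suc n * (- 1 / l)) = - l * a ^ Suc n"
        using l by (simp add: power2_eq_square del: power_Suc)
      moreover have "- l * (1 * a ^ Suc n + real (Suc n) * a ^ n * (- 1 / l) * s)
         = - l * a ^ Suc n + s * (real (Suc n) * a ^ n)"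
        using l by (simp add: algebra_simps del: power_Suc)
      ultimately show ?thesis by (simp add: bump_def a_def)
    qed
    ultimately show "(G has_vector_derivative bump l n s * s) (at s within {0..l})"
      by (simp add: has_real_derivative_iff_has_vector_derivative)
  qed (use l in simp)
  then have "integral {0..l} (\<lambda>s. bump l n s * s) = G l - G 0" by (rule integral_unique)
  then show ?thesis using l by (simp add: G_def)
qed

context edge_family
begin

lemma W_single_edge:
  assumes "a \<in> E"
  shows "W (\<lambda>e s. if e = a then A s else 0) f g = integral {0..L a} (\<lambda>s. A s * (f a s * g a s))"
proof -
  have "W (\<lambda>e s. if e = a then A s else 0) f g
      = (\<Sum>e\<in>E. if e = a then integral {0..L a} (\<lambda>s. A s * (f a s * g a s)) else 0)"
    unfolding W_def by (intro sum.cong) auto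
  then show ?thesis using assms finite_E by simp
qed

text \<open>Cauchy-Schwarz for the integral of \<open>u'\<close> over \<open>[0, s]\<close>, in the
  form that the square of \<open>u'\<close> minus its mean slope \<open>k\<close> has nonnegative
  integral.\<close>

lemma vertex_C1_pointwise:
  assumes u: "vertex_C1 u u' w" and e: "e \<in> E" and s: "s \<in> {0..L e}"
  shows "(u e s - w)\<^sup>2 \<le> s * W one u' u'"
proof (cases "s = 0")
  case True
  then show ?thesis using u e by (simp add: vertex_C1_def)
next
  case False
  then have s0: "0 < s" using s by auto
  have sub: "{0..s} \<subseteq> {0..L e}" using s by auto
  have c: "continuous_on {0..L e} (u' e)"
    using u e by (simp add: vertex_C1_def edge_cont_def)
  have cs: "continuous_on {0..s} (u' e)" using c sub by (rule continuous_on_subset)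
  define d where "d = u e s - w"
  define Q where "Q = integral {0..s} (\<lambda>y. u' e y * u' e y)"
  have du: "(u e has_real_derivative u' e y) (at y within {0..s})" if "y \<in> {0..s}" for y
  proof (rule DERIV_subset[OF _ sub])
    show "(u e has_real_derivative u' e y) (at y within {0..L e})"
      using u e that sub unfolding vertex_C1_def by blast
  qed
  then have "(u' e has_integral (u e s - u e 0)) {0..s}"
    using s0 by (intro fundamental_theorem_of_calculus)
      (auto simp: has_real_derivative_iff_has_vector_derivative[symmetric])
  then have i1: "(u' e has_integral d) {0..s}"
    using u e by (simp add: d_def vertex_C1_def)
  have i2: "((\<lambda>y. u' e y * u' e y) has_integral Q) {0..s}"
    unfolding Q_def by (intro integrable_integral integrable_continuous_interval continuous_intros cs)
  define k where "k = d / s"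
  have "((\<lambda>y. u' e y * u' e y + ((- 2 * k) * u' e y + k\<^sup>2)) has_integral
      (Q + ((- 2 * k) * d + s * k\<^sup>2))) {0..s}"
    using has_integral_const_real[of "k\<^sup>2" 0 s] s0
    by (intro has_integral_add has_integral_mult_right i1 i2) simp
  moreover have "0 \<le> u' e y * u' e y + ((- 2 * k) * u' e y + k\<^sup>2)" for y
    using zero_le_power2[of "u' e y - k"] by (simp add: power2_eq_square algebra_simps)
  ultimately have "0 \<le> Q + ((- 2 * k) * d + s * k\<^sup>2)"
    by (rule has_integral_nonneg)
  moreover have "(- 2 * k) * d + s * k\<^sup>2 = - (d\<^sup>2 / s)"
    using s0 by (simp add: k_def power2_eq_square)
  ultimately have "d\<^sup>2 / s \<le> Q" by simp
  then have "d\<^sup>2 \<le> s * Q" using s0 by (simp add: field_simps)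
  also have "\<dots> \<le> s * W one u' u'"
  proof (intro mult_left_mono)
    have "Q \<le> integral {0..L e} (\<lambda>y. u' e y * u' e y)"
      unfolding Q_def using sub
      by (intro integral_subset_le integrable_continuous_interval continuous_intros c cs) auto
    also have "\<dots> = W (\<lambda>e' s. if e' = e then 1 else 0) u' u'"
      using W_single_edge[OF e, of "\<lambda>_. 1" u' u'] by simp
    also have "\<dots> \<le> W one u' u'"
      using u by (intro W_mono_weight) (auto simp: vertex_C1_def edge_cont_def)
    finally show "Q \<le> W one u' u'" .
  qed (use s0 in simp)
  finally show ?thesis by (simp add: d_def)
qed

text \<open>Split \<open>u\<close> into its vertex value and a deviation whose square grows at most
  linearly in \<open>s\<close>; the two moments of the bump do the rest. The energy part fades with
  \<open>n\<close>, the \<open>w^2\<close> part does not and has to be compensated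
  elsewhere.\<close>

lemma bump_concentrates:
  assumes u: "vertex_C1 u u' w" and e: "e \<in> E"
  shows "integral {0..L e} (\<lambda>s. bump (L e) n s * (u e s * u e s))
      \<le> 2 * w\<^sup>2 * L e + 2 * W one u' u' * (L e)\<^sup>2 / real (n + 2)"
proof -
  note c = edge_contD[OF vertex_C1_edge_cont[OF u] e]
  have ib: "(bump (L e) n has_integral L e) {0..L e}"
    "((\<lambda>s. bump (L e) n s * s) has_integral (L e)\<^sup>2 / real (n + 2)) {0..L e}"
    using integral_bump[OF L_pos[OF e], of n] integral_bump_times[OF L_pos[OF e], of n]
    by (auto simp only: has_integral_iff intro!: integrable_continuous_interval continuous_intros
        continuous_on_bump)
  have G: "((\<lambda>s. (2 * w\<^sup>2) * bump (L e) n s + (2 * W one u' u') * (bump (L e) n s * s)) has_integral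
     ((2 * w\<^sup>2) * L e + (2 * W one u' u') * ((L e)\<^sup>2 / real (n + 2)))) {0..L e}"
    by (intro has_integral_add has_integral_mult_right ib)
  have F: "((\<lambda>s. bump (L e) n s * (u e s * u e s)) has_integral
      integral {0..L e} (\<lambda>s. bump (L e) n s * (u e s * u e s))) {0..L e}"
    by (intro integrable_integral integrable_continuous_interval continuous_intros continuous_on_bump c)
  have le: "bump (L e) n s * (u e s * u e s)
      \<le> (2 * w\<^sup>2) * bump (L e) n s + (2 * W one u' u') * (bump (L e) n s * s)" if s: "s \<in> {0..L e}" for s
  proof -
    have "0 \<le> (u e s - 2 * w)\<^sup>2" by simp
    then have "u e s * u e s \<le> 2 * w\<^sup>2 + 2 * (u e s - w)\<^sup>2"
      by (simp add: power2_eq_square algebra_simps)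
    also have "\<dots> \<le> 2 * w\<^sup>2 + 2 * (s * W one u' u')"
      using vertex_C1_pointwise[OF u e s] by simp
    finally have "bump (L e) n s * (u e s * u e s) \<le> bump (L e) n s * (2 * w\<^sup>2 + 2 * (s * W one u' u'))"
      by (rule mult_left_mono) (rule bump_nonneg[OF L_pos[OF e] s])
    then show ?thesis by (simp add: algebra_simps)
  qed
  have "integral {0..L e} (\<lambda>s. bump (L e) n s * (u e s * u e s))
      \<le> (2 * w\<^sup>2) * L e + (2 * W one u' u') * ((L e)\<^sup>2 / real (n + 2))"
    by (rule has_integral_le[OF F G le])
  then show ?thesis by simp
qed

end

context weighted_edges
begin

text \<open>A constant square would make \<open>u'\<close> vanish inside the edge, while the
  equation makes its derivative \<open>- \<mu> \<sigma> u\<close> nonzero.\<close>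

lemma eigen_square_nonconstant:
  assumes u: "eigen \<mu> u u' 1" and \<mu>: "\<mu> \<noteq> 0" and e: "e \<in> E"
  shows "\<exists>s\<in>{0..L e}. u e s * u e s \<noteq> 1"
proof (rule ccontr)
  assume "\<not> ?thesis"
  then have one: "u e s * u e s = 1" if "s \<in> {0..L e}" for s using that by blast
  have d: "(u e has_real_derivative u' e s) (at s within {0..L e})"
    "(u' e has_real_derivative - (\<mu> * \<sigma> e s * u e s)) (at s within {0..L e})" if "s \<in> {0..L e}" for s
    using u e that unfolding eigen_def by blast+
  have u'0: "u' e s = 0" if s: "0 < s" "s < L e" for s
  proof -
    have "((\<lambda>s. u e s * u e s) has_real_derivative u' e s * u e s + u' e s * u e s) (at s within {0..L e})"
      using s by (intro DERIV_mult d) auto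
    then have "u' e s * u e s + u' e s * u e s = 0"
      using s one by (intro DERIV_locally_constant[of "\<lambda>s. u e s * u e s" _ s 0 "L e" 0 "L e" 1]) auto
    then show ?thesis using one[of s] s by auto
  qed
  define m where "m = L e / 2"
  have m: "0 < m" "m < L e" using L_pos[OF e] by (auto simp: m_def)
  have "- (\<mu> * \<sigma> e m * u e m) = 0"
  proof (rule DERIV_locally_constant[of "u' e" _ m 0 "L e" "m / 2" "(m + L e) / 2" 0])
    show "(u' e has_real_derivative - (\<mu> * \<sigma> e m * u e m)) (at m within {0..L e})"
      using m by (intro d) auto
  qed (use m u'0 in auto)
  then show False using \<mu> \<sigma>_pos[OF e, of m] one[of m] m by auto
qed

text \<open>Subtracting \<open>w v\<close> from an eigenfunction leaves one that vanishes at the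
  vertex and hence on the edge \<open>a\<close>; there \<open>u^2 = w^2 v^2\<close>, so pairing with
  one fixed function reads off \<open>w^2\<close>.\<close>

lemma exists_edge_weight_detecting_vertex_value:
  assumes e12: "e1 \<in> E" "e2 \<in> E" "e1 \<noteq> e2" and C: "0 \<le> (C::real)"
  shows "\<exists>a\<in>E. \<exists>p. real_polynomial_function p \<and> integral {0..L a} p = 0 \<and>
     (\<forall>u u' w. eigen (1 / M) u u' w \<longrightarrow> integral {0..L a} (\<lambda>s. p s * (u a s * u a s)) = - (C * w\<^sup>2))"
proof (cases "\<exists>u u' w. eigen (1 / M) u u' w \<and> w \<noteq> 0")
  case False
  \<comment> \<open>All vertex values are 0, so the zero weight works.\<close>
  then show ?thesis
    using e12(1) by (intro bexI[of _ e1] exI[of _ "\<lambda>s. 0"]) auto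
next
  case True
  then obtain v0 v0' w0 where v0: "eigen (1 / M) v0 v0' w0" "w0 \<noteq> 0" by blast
  define v where "v = (\<lambda>e s. 1 / w0 * v0 e s + 0 * v0 e s)"
  obtain v' where v: "eigen (1 / M) v v' 1"
    using eigen_lincomb[OF v0(1) v0(1), of "1 / w0" 0] v0(2) unfolding v_def by auto
  obtain a where a: "a \<in> E" "\<And>u u' s. eigen (1 / M) u u' 0 \<Longrightarrow> s \<in> {0..L a} \<Longrightarrow> u a s = 0"
    using exists_edge_without_vertex_zero_eigenfunctions[OF v e12] by blast
  have c: "continuous_on {0..L a} (\<lambda>s. v a s * v a s)"
    using edge_contD[OF eigen_cont[OF v] a(1)] by (intro continuous_intros)
  have "v a 0 = 1" using v a(1) by (simp add: eigen_def)
  then have "\<exists>s\<in>{0..L a}. v a s * v a s \<noteq> v a 0 * v a 0"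
    using eigen_square_nonconstant[OF v _ a(1)] M_pos by simp
  then obtain p where p: "real_polynomial_function p" "integral {0..L a} p = 0"
    "integral {0..L a} (\<lambda>s. p s * (v a s * v a s)) = -1"
    using polynomial_separating_from_constants[OF L_pos[OF a(1)] c] by blast
  have "integral {0..L a} (\<lambda>s. C * p s * (u a s * u a s)) = - (C * w\<^sup>2)" if u: "eigen (1 / M) u u' w" for u u' w
  proof -
    have "eigen (1 / M) (\<lambda>e s. 1 * u e s + (- w) * v e s) (\<lambda>e s. 1 * u' e s + (- w) * v' e s) 0"
      using eigen_lincomb[OF u v, of 1 "- w"] by simp
    from a(2)[OF this] have "u a s = w * v a s" if "s \<in> {0..L a}" for s
      using that by simp
    then have "integral {0..L a} (\<lambda>s. C * p s * (u a s * u a s))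
       = integral {0..L a} (\<lambda>s. (C * w\<^sup>2) * (p s * (v a s * v a s)))"
      by (intro integral_cong) (simp add: power2_eq_square)
    then show ?thesis by (simp add: p(3))
  qed
  moreover have "real_polynomial_function (\<lambda>s. C * p s)"
    by (intro real_polynomial_function.intros(2,4) p(1))
  moreover have "integral {0..L a} (\<lambda>s. C * p s) = 0" using p(2) by simp
  ultimately show ?thesis using a(1) by blast
qed

text \<open>\<open>q\<close> is a bump near the vertex on \<open>e1\<close> plus, on the edge \<open>a\<close>, a term of mean zero that cancels the
  contribution \<open>u(v)\<^sup>2\<close> of the bump.\<close>

lemma exists_decreasing_direction:
  assumes e12: "e1 \<in> E" "e2 \<in> E" "e1 \<noteq> e2" and \<kappa>: "\<And>e. e \<in> E \<Longrightarrow> 0 < \<kappa> e"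
  shows "\<exists>q. (\<forall>e. real_polynomial_function (q e)) \<and>
     (\<Sum>e\<in>E. \<kappa> e * integral {0..L e} (\<lambda>s. q e s - \<sigma> e s)) = 0 \<and>
     (\<forall>u u' w. eigen (1 / M) u u' w \<longrightarrow> W \<sigma> u u = 1 \<longrightarrow> W (\<lambda>e s. q e s - \<sigma> e s) u u < 0)"
proof -
  define V where "V = (\<Sum>e\<in>E. \<kappa> e * integral {0..L e} (\<sigma> e))"
  have "0 \<le> V" unfolding V_def
    using \<kappa> \<sigma>_nonneg edge_contD[OF \<sigma>_cont]
    by (intro sum_nonneg mult_nonneg_nonneg Henstock_Kurzweil_Integration.integral_nonneg
        integrable_continuous_interval) (auto simp: less_imp_le)
  \<comment> \<open>With this factor the bump carries the whole volume \<open>V\<close> of the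
    density.\<close>
  define c where "c = V / (\<kappa> e1 * L e1)"
  have c: "0 \<le> c" using \<open>0 \<le> V\<close> \<kappa>[OF e12(1)] L_pos[OF e12(1)] by (simp add: c_def)
  \<comment> \<open>The energy term of \<open>bump_concentrates\<close> is then below 1/2, a margin
    against the -1 contributed by \<open>- \<sigma>\<close>.\<close>
  obtain n :: nat where n: "4 * c * (1 / M) * (L e1)\<^sup>2 < real n"
    using reals_Archimedean2 by blast
  have n': "c * (2 * (1 / M) * (L e1)\<^sup>2 / real (n + 2)) < 1 / 2"
  proof -
    define N where "N = real (n + 2)"
    have "0 < N" by (simp add: N_def)
    then have "c * (2 * (1 / M) * (L e1)\<^sup>2 / N) = 4 * c * (1 / M) * (L e1)\<^sup>2 / (2 * N)"
      using M_pos by (simp add: field_simps)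
    also have "\<dots> < N / (2 * N)"
      using n by (intro divide_strict_right_mono) (auto simp: N_def)
    also have "\<dots> = 1 / 2" using \<open>0 < N\<close> by simp
    finally show ?thesis unfolding N_def .
  qed
  \<comment> \<open>The constant is the coefficient of \<open>w^2\<close> in \<open>c\<close> times
    the bump estimate.\<close>
  obtain a p where a: "a \<in> E" and p: "real_polynomial_function p" "integral {0..L a} p = 0"
    "\<And>u u' w. eigen (1 / M) u u' w \<Longrightarrow> integral {0..L a} (\<lambda>s. p s * (u a s * u a s)) = - (c * 2 * L e1 * w\<^sup>2)"
    using exists_edge_weight_detecting_vertex_value[OF e12, of "c * 2 * L e1"] c L_pos[OF e12(1)]
    by (auto simp: less_imp_le)
  define q1 where "q1 e s = (if e = e1 then c * bump (L e1) n s else 0)" for e s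
  define q2 where "q2 e s = (if e = a then p s else 0)" for e s
  define q where "q e s = q1 e s + q2 e s" for e s
  have qp: "real_polynomial_function (q1 e)" "real_polynomial_function (q2 e)" for e
    unfolding q1_def[abs_def] q2_def[abs_def]
    by (cases "e = e1"; cases "e = a";
        simp add: real_polynomial_function.intros(2,4) polynomial_bump p(1))+
  have qc: "edge_cont q1" "edge_cont q2"
    unfolding edge_cont_def using qp continuous_on_real_polynomial by auto
  have "real_polynomial_function (q e)" for e
    unfolding q_def by (intro real_polynomial_function.intros(3) qp)
  moreover have "(\<Sum>e\<in>E. \<kappa> e * integral {0..L e} (\<lambda>s. q e s - \<sigma> e s)) = 0"
  proof -
    have eq: "integral {0..L e} (\<lambda>s. q e s - \<sigma> e s)
       = (if e = e1 then c * L e1 else 0) - integral {0..L e} (\<sigma> e)" if e: "e \<in> E" for e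
    proof -
      have "integral {0..L e} (\<lambda>s. q e s - \<sigma> e s)
         = integral {0..L e} (q1 e) + integral {0..L e} (q2 e) - integral {0..L e} (\<sigma> e)"
        unfolding q_def using edge_contD[OF qc(1) e] edge_contD[OF qc(2) e] edge_contD[OF \<sigma>_cont e]
        by (simp add: integral_add integral_diff integrable_add integrable_continuous_interval)
      also have "integral {0..L e} (q1 e) = (if e = e1 then c * L e1 else 0)"
        using integral_bump[OF L_pos[OF e12(1)], of n]
        by (cases "e = e1") (simp_all add: q1_def[abs_def])
      also have "integral {0..L e} (q2 e) = 0"
        using p(2) by (cases "e = a") (simp_all add: q2_def[abs_def])
      finally show ?thesis by simp
    qed
    have "(\<Sum>e\<in>E. \<kappa> e * integral {0..L e} (\<lambda>s. q e s - \<sigma> e s))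
        = (\<Sum>e\<in>E. if e = e1 then \<kappa> e1 * (c * L e1) else 0) - V"
      unfolding V_def sum_subtractf[symmetric]
      by (intro sum.cong) (auto simp: eq algebra_simps)
    then show ?thesis
      using finite_E e12(1) \<kappa>[OF e12(1)] L_pos[OF e12(1)] by (simp add: c_def)
  qed
  moreover have "W (\<lambda>e s. q e s - \<sigma> e s) u u < 0" if u: "eigen (1 / M) u u' w" and 1: "W \<sigma> u u = 1" for u u' w
  proof -
    note uc = eigen_cont[OF u]
    have q12: "q = (\<lambda>e s. 1 * q1 e s + 1 * q2 e s)" by (simp add: q_def fun_eq_iff)
    have "W (\<lambda>e s. 1 * q e s + (-1) * \<sigma> e s) u u = 1 * W q u u + (-1) * W \<sigma> u u"
      using edge_cont_lincomb[OF qc, of 1 1] by (intro W_lincomb_weight \<sigma>_cont uc) (simp add: q12)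
    moreover have "W q u u = 1 * W q1 u u + 1 * W q2 u u"
      unfolding q12 by (intro W_lincomb_weight qc uc)
    moreover have "W q2 u u = - (c * 2 * L e1 * w\<^sup>2)"
      unfolding q2_def[abs_def] W_single_edge[OF a] using p(3)[OF u] .
    moreover have "W q1 u u \<le> c * 2 * L e1 * w\<^sup>2 + c * (2 * (1 / M) * (L e1)\<^sup>2 / real (n + 2))"
    proof -
      have "W q1 u u = c * integral {0..L e1} (\<lambda>s. bump (L e1) n s * (u e1 s * u e1 s))"
        unfolding q1_def[abs_def] W_single_edge[OF e12(1)] by (simp add: mult.assoc)
      also have "\<dots> \<le> c * (2 * w\<^sup>2 * L e1 + 2 * W one u' u' * (L e1)\<^sup>2 / real (n + 2))"
        by (intro mult_left_mono bump_concentrates eigen_C1[OF u] e12(1) c)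
      also have "\<dots> = c * 2 * L e1 * w\<^sup>2 + c * (2 * W one u' u' * (L e1)\<^sup>2 / real (n + 2))"
        by (simp only: distrib_left mult_ac)
      finally show ?thesis using eigen_energy[OF u] 1 by simp
    qed
    ultimately have "W (\<lambda>e s. 1 * q e s + (-1) * \<sigma> e s) u u < 0" using n' 1 by linarith
    then show ?thesis by simp
  qed
  ultimately show ?thesis by blast
qed

end

section \<open>First-order perturbation of the density\<close>

context weighted_edges
begin

section \<open>Signed weights compared with the density\<close>

lemma weight_dominates:
  assumes h: "edge_cont h"
  obtains K where "0 < K" "\<And>e s. e \<in> E \<Longrightarrow> s \<in> {0..L e} \<Longrightarrow> \<bar>h e s\<bar> \<le> K * \<sigma> e s"
proof -
  have "\<exists>B. \<forall>s\<in>{0..L e}. \<bar>h e s\<bar> \<le> B * \<sigma> e s" if e: "e \<in> E" for e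
  proof -
    have "continuous_on {0..L e} (\<lambda>s. h e s / \<sigma> e s)"
      using \<sigma>_pos[OF e] by (intro continuous_on_divide edge_contD[OF h e] edge_contD[OF \<sigma>_cont e]) force
    then have "bounded ((\<lambda>s. h e s / \<sigma> e s) ` {0..L e})"
      using compact_continuous_image compact_imp_bounded by blast
    then obtain B where "\<And>s. s \<in> {0..L e} \<Longrightarrow> \<bar>h e s / \<sigma> e s\<bar> \<le> B"
      unfolding bounded_iff by force
    then have "\<bar>h e s\<bar> \<le> B * \<sigma> e s" if "s \<in> {0..L e}" for s
      using \<sigma>_pos[OF e that] that by (force simp: abs_divide divide_le_eq)
    then show ?thesis by blast
  qed
  then obtain B where B: "\<And>e s. e \<in> E \<Longrightarrow> s \<in> {0..L e} \<Longrightarrow> \<bar>h e s\<bar> \<le> B e * \<sigma> e s" by metis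
  define K where "K = 1 + (\<Sum>e\<in>E. \<bar>B e\<bar>)"
  show thesis
  proof (rule that[of K])
    show "0 < K" unfolding K_def by (simp add: add_pos_nonneg sum_nonneg)
    fix e s assume es: "e \<in> E" "s \<in> {0..L e}"
    have "\<bar>B e\<bar> \<le> (\<Sum>e\<in>E. \<bar>B e\<bar>)" using es finite_E by (intro member_le_sum) auto
    then have "B e \<le> K" unfolding K_def by linarith
    then have "B e * \<sigma> e s \<le> K * \<sigma> e s" using \<sigma>_nonneg[OF es] by (rule mult_right_mono)
    then show "\<bar>h e s\<bar> \<le> K * \<sigma> e s" using B[OF es] by linarith
  qed
qed

text \<open>Adding \<open>K * \<sigma>\<close> makes the weight nonnegative and at most
  \<open>2 K \<sigma>\<close>, so \<open>W_square_continuous\<close> applies. The added part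
  contributes the same number for every \<open>f n\<close> and for \<open>x\<close>, because their
  norms agree.\<close>

lemma W_signed_continuous:
  assumes h: "edge_cont h" and f: "\<And>n::nat. edge_cont (f n)" and x: "edge_cont x"
    and norm: "\<And>n. W \<sigma> (f n) (f n) = W \<sigma> x x"
    and lim: "(\<lambda>n. W \<sigma> (\<lambda>e s. f n e s - x e s) (\<lambda>e s. f n e s - x e s)) \<longlonglongrightarrow> 0"
  shows "(\<lambda>n. W h (f n) (f n)) \<longlonglongrightarrow> W h x x"
proof -
  obtain K where K: "0 < K" "\<And>e s. e \<in> E \<Longrightarrow> s \<in> {0..L e} \<Longrightarrow> \<bar>h e s\<bar> \<le> K * \<sigma> e s"
    using weight_dominates[OF h] by blast
  define k where "k = (\<lambda>e s. 1 * h e s + K * \<sigma> e s)"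
  have k: "edge_cont k" unfolding k_def by (intro edge_cont_lincomb h \<sigma>_cont)
  have k_nonneg: "0 \<le> k e s" and k_le: "k e s \<le> 2 * K * \<sigma> e s + 0 * \<sigma> e s"
    if "e \<in> E" "s \<in> {0..L e}" for e s
    using K(2)[OF that] by (auto simp: k_def abs_le_iff)
  have Wk: "W k u u = 1 * W h u u + K * W \<sigma> u u" if "edge_cont u" for u
    unfolding k_def using that by (intro W_lincomb_weight h \<sigma>_cont)
  define d where "d n e s = f n e s - x e s" for n e s
  have d: "edge_cont (d n)" for n unfolding d_def by (intro edge_cont_diff f x)
  have "(\<lambda>n. W k (d n) (d n)) \<longlonglongrightarrow> 0"
  proof (rule tendsto_sandwich)
    show "\<forall>\<^sub>F n in sequentially. 0 \<le> W k (d n) (d n)"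
      by (intro always_eventually allI W_nonneg k d k_nonneg)
    have "W k (d n) (d n) \<le> 2 * K * W \<sigma> (d n) (d n)" for n
    proof -
      have "W k (d n) (d n) \<le> W (\<lambda>e s. 2 * K * \<sigma> e s + 0 * \<sigma> e s) (d n) (d n)"
        by (intro W_mono_weight k d k_le edge_cont_lincomb \<sigma>_cont)
      also have "\<dots> = 2 * K * W \<sigma> (d n) (d n)"
        by (subst W_lincomb_weight) (auto intro: \<sigma>_cont d)
      finally show ?thesis .
    qed
    then show "\<forall>\<^sub>F n in sequentially. W k (d n) (d n) \<le> 2 * K * W \<sigma> (d n) (d n)" by simp
    show "(\<lambda>n. 2 * K * W \<sigma> (d n) (d n)) \<longlonglongrightarrow> 0"
      using tendsto_mult_left[OF lim, of "2 * K"] by (simp add: d_def[abs_def])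
  qed simp
  then have "(\<lambda>n. W k (f n) (f n)) \<longlonglongrightarrow> W k x x"
    unfolding d_def by (intro W_square_continuous k k_nonneg f x)
  then have "(\<lambda>n. W k (f n) (f n) - K * W \<sigma> x x) \<longlonglongrightarrow> W k x x - K * W \<sigma> x x"
    by (intro tendsto_intros)
  then show ?thesis by (simp add: Wk f x norm)
qed

definition perturbed where "perturbed h t = (\<lambda>e s. \<sigma> e s + t * h e s)"

lemma perturbed_eq: "perturbed h t = (\<lambda>e s. 1 * \<sigma> e s + t * h e s)"
  by (simp add: perturbed_def)

lemma perturbed_weighted_edges:
  assumes h: "edge_cont h"
  obtains b where "0 < b" "\<And>t. \<bar>t\<bar> < b \<Longrightarrow> weighted_edges E L (perturbed h t)"
proof -
  obtain K where K: "0 < K" "\<And>e s. e \<in> E \<Longrightarrow> s \<in> {0..L e} \<Longrightarrow> \<bar>h e s\<bar> \<le> K * \<sigma> e s"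
    using weight_dominates[OF h] by blast
  show thesis
  proof (rule that[of "1 / K"])
    fix t :: real assume t: "\<bar>t\<bar> < 1 / K"
    show "weighted_edges E L (perturbed h t)"
    proof
      show "edge_cont (perturbed h t)"
        unfolding perturbed_eq by (intro edge_cont_lincomb \<sigma>_cont h)
      fix e s assume es: "e \<in> E" "s \<in> {0..L e}"
      have "\<bar>t * h e s\<bar> \<le> \<bar>t\<bar> * (K * \<sigma> e s)"
        unfolding abs_mult using K(2)[OF es] by (intro mult_left_mono) auto
      also have "\<dots> = (\<bar>t\<bar> * K) * \<sigma> e s" by simp
      also have "\<dots> < 1 * \<sigma> e s"
        using t K(1) \<sigma>_pos[OF es] by (intro mult_strict_right_mono) (auto simp: field_simps)
      finally show "0 < perturbed h t e s" by (simp add: perturbed_def abs_less_iff)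
    qed
  qed (use K in simp)
qed

lemma W_perturbed:
  assumes "edge_cont h" "edge_cont f" "edge_cont g"
  shows "W (perturbed h t) f g = W \<sigma> f g + t * W h f g"
  unfolding perturbed_eq using W_lincomb_weight[OF \<sigma>_cont assms(1-3), of 1 t] by simp

lemma vertex_C1_center: "vertex_C1 u u' w \<Longrightarrow> vertex_C1 (center u) u' (w - W \<sigma> u one / mass)"
  using vertex_C1_lincomb[OF _ vertex_C1_const[of "W \<sigma> u one / mass"], of u u' w 1 "-1"]
  by (simp add: center_def[abs_def])

text \<open>Its reciprocal is the first nonzero eigenvalue of the density
  \<open>\<sigma> + t h\<close>, as long as this is positive.\<close>

definition M_at where "M_at h t = weighted_edges.M E L (perturbed h t)"

text \<open>The unperturbed eigenfunction, recentred for the new weight, is put into the new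
  Poincare inequality. Its energy is unchanged and its new integral is \<open>t * W h u one\<close>,
  so recentring costs only a term of order \<open>t^2\<close>.\<close>

lemma M_at_lower_bound:
  assumes h: "edge_cont h" and u: "eigen (1 / M) u u' w" and norm: "W \<sigma> u u = 1"
    and P: "weighted_edges E L (perturbed h t)" and m: "0 < mass + t * W h one one"
  shows "1 + t * W h u u - (t * W h u one)\<^sup>2 / (mass + t * W h one one) \<le> M_at h t / M"
proof -
  interpret P: weighted_edges E L "perturbed h t" by (rule P)
  note uc = eigen_cont[OF u]
  have "W (perturbed h t) (P.center u) (P.center u) \<le> P.M * W one u' u'"
    by (rule P.poincare[OF P.vertex_C1_center[OF eigen_C1[OF u]] P.mean_zero_center[OF uc]])
  moreover have "W one u' u' = 1 / M" using eigen_energy[OF u] norm by simp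
  moreover have "W \<sigma> u one = 0"
    using eigen_mean[OF u] M_pos by (simp add: mean_zero_def)
  moreover have "P.mass = mass + t * W h one one"
    unfolding P.mass_def mass_def by (simp add: W_perturbed h)
  ultimately show ?thesis
    unfolding P.W_center_square[OF uc] by (simp add: W_perturbed h uc norm M_at_def)
qed

text \<open>Negative times and one eigenfunction suffice: at \<open>t = - s\<close>,
  \<open>M_at_lower_bound\<close> makes \<open>M_at / M\<close> at least
  \<open>1 + s \<kappa>\<close> up to order \<open>s^2\<close>, so the eigenvalue falls at a
  definite rate.\<close>

lemma not_eventually_ge:
  assumes h: "edge_cont h"
    and dir: "\<And>u u' w. eigen (1 / M) u u' w \<Longrightarrow> W \<sigma> u u = 1 \<Longrightarrow> W h u u < 0"
    and ev: "\<And>\<epsilon>. 0 < \<epsilon> \<Longrightarrow> \<forall>\<^sub>F t in at 0. 1 / M - \<epsilon> * \<bar>t\<bar> \<le> 1 / M_at h t"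
  shows False
proof -
  obtain u u' w where u: "eigen (1 / M) u u' w" and norm: "W \<sigma> u u = 1"
    using eigen_exists by blast
  define \<kappa> where "\<kappa> = - W h u u"
  have \<kappa>: "0 < \<kappa>" using dir[OF u norm] by (simp add: \<kappa>_def)
  define m where "m t = mass + t * W h one one" for t
  obtain b where b: "0 < b" "\<And>t. \<bar>t\<bar> < b \<Longrightarrow> weighted_edges E L (perturbed h t)"
    using perturbed_weighted_edges[OF h] by blast
  have "((\<lambda>t. \<bar>t\<bar> * (W h u one)\<^sup>2 / m t) \<longlongrightarrow> \<bar>0\<bar> * (W h u one)\<^sup>2 / (mass + 0 * W h one one)) (at 0)"
    unfolding m_def using mass_pos by (intro tendsto_intros) auto
  then have "\<forall>\<^sub>F t in at 0. \<bar>t\<bar> * (W h u one)\<^sup>2 / m t < \<kappa> / 2"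
    using \<kappa> by (intro order_tendstoD) auto
  moreover have "(m \<longlongrightarrow> mass + 0 * W h one one) (at 0)"
    unfolding m_def[abs_def] by (intro tendsto_intros)
  then have "\<forall>\<^sub>F t in at 0. 0 < m t"
    using mass_pos by (intro order_tendstoD) auto
  moreover have "((\<lambda>t. \<bar>t\<bar>) \<longlongrightarrow> \<bar>0\<bar>) (at (0::real))" by (intro tendsto_intros)
  then have "\<forall>\<^sub>F t in at (0::real). \<bar>t\<bar> < min b (1 / \<kappa>)"
    using b \<kappa> by (intro order_tendstoD) auto
  \<comment> \<open>An eighth leaves room: the second-order term takes half of the slope
    \<open>\<kappa>\<close>, and \<open>(1 - x / 8) (1 + x / 2) > 1\<close> for
    \<open>0 < x < 1\<close>.\<close>
  moreover have "\<forall>\<^sub>F t in at 0. 1 / M - \<kappa> / (8 * M) * \<bar>t\<bar> \<le> 1 / M_at h t"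
    using \<kappa> M_pos by (intro ev) auto
  ultimately have "\<forall>\<^sub>F t in at 0. \<bar>t\<bar> * (W h u one)\<^sup>2 / m t < \<kappa> / 2 \<and> 0 < m t \<and>
      \<bar>t\<bar> < min b (1 / \<kappa>) \<and> 1 / M - \<kappa> / (8 * M) * \<bar>t\<bar> \<le> 1 / M_at h t"
    by eventually_elim blast
  then obtain \<delta> where \<delta>: "0 < \<delta>" "\<And>t. t \<noteq> 0 \<Longrightarrow> \<bar>t\<bar> < \<delta> \<Longrightarrow> \<bar>t\<bar> * (W h u one)\<^sup>2 / m t < \<kappa> / 2 \<and>
      0 < m t \<and> \<bar>t\<bar> < min b (1 / \<kappa>) \<and> 1 / M - \<kappa> / (8 * M) * \<bar>t\<bar> \<le> 1 / M_at h t"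
    unfolding eventually_at by (auto simp: dist_real_def)
  define s where "s = \<delta> / 2"
  have s: "0 < s" using \<delta> by (simp add: s_def)
  have t: "s * (W h u one)\<^sup>2 / m (- s) < \<kappa> / 2" "0 < m (- s)" "s < b" "s < 1 / \<kappa>"
      "1 / M - \<kappa> / (8 * M) * s \<le> 1 / M_at h (- s)"
    using \<delta>(2)[of "- s"] \<delta>(1) by (auto simp: s_def)
  have P: "weighted_edges E L (perturbed h (- s))" using b(2)[of "- s"] t(3) s by simp
  have Mt: "0 < M_at h (- s)" unfolding M_at_def by (rule weighted_edges.M_pos[OF P])
  define y where "y = M_at h (- s) / M"
  have "1 + s * \<kappa> - s * (s * (W h u one)\<^sup>2 / m (- s)) \<le> y"
    using M_at_lower_bound[OF h u norm P] t(2)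
    by (simp add: m_def \<kappa>_def y_def power2_eq_square mult_ac)
  moreover have "s * (s * (W h u one)\<^sup>2 / m (- s)) \<le> s * (\<kappa> / 2)"
    using t(1) s by (intro mult_left_mono) auto
  ultimately have y: "1 + s * \<kappa> / 2 \<le> y" by simp
  have k1: "s * \<kappa> < 1" using t(4) \<kappa> by (simp add: field_simps)
  have "(1 - s * \<kappa> / 8) * y \<le> 1"
  proof -
    have "(1 / M - \<kappa> / (8 * M) * s) * M_at h (- s) \<le> 1"
      using mult_right_mono[OF t(5), of "M_at h (- s)"] Mt by simp
    moreover have "(1 / M - \<kappa> / (8 * M) * s) * M_at h (- s) = (1 - s * \<kappa> / 8) * y"
      using M_pos by (simp add: y_def field_simps)
    ultimately show ?thesis by simp
  qed
  moreover have "(1 - s * \<kappa> / 8) * (1 + s * \<kappa> / 2) \<le> (1 - s * \<kappa> / 8) * y"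
    using y k1 by (intro mult_left_mono) auto
  moreover have "(1 - s * \<kappa> / 8) * (1 + s * \<kappa> / 2) = 1 + s * \<kappa> * (3 / 8 - s * \<kappa> / 16)"
    by (simp add: field_simps)
  moreover have "0 < s * \<kappa> * (3 / 8 - s * \<kappa> / 16)"
  proof (rule mult_pos_pos)
    show "0 < s * \<kappa>" using s \<kappa> by simp
    show "0 < 3 / 8 - s * \<kappa> / 16" using k1 by linarith
  qed
  ultimately show False by linarith
qed

text \<open>The perturbed eigenfunction, recentred and normalised for the old weight, is a trial
  function for the old problem. Before recentring it has mean zero for the new weight, so
  subtracting a constant only enlarges its new norm, and the bound has no second-order
  error.\<close>

lemma perturbed_test_function:
  assumes h: "edge_cont h" and P: "weighted_edges E L (perturbed h t)"
  shows "\<exists>f f' w. vertex_C1 f f' w \<and> mean_zero f \<and> W \<sigma> f f = 1 \<and>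
    W one f' f' \<le> (1 + t * W h f f) / M_at h t"
proof -
  interpret P: weighted_edges E L "perturbed h t" by (rule P)
  obtain u u' w where u: "P.eigen (1 / P.M) u u' w" and norm: "W (perturbed h t) u u = 1"
    using P.eigen_exists by blast
  note uc = P.eigen_cont[OF u]
  define c where "c = W \<sigma> u one / mass"
  define g where "g = center u"
  have g: "mean_zero g" unfolding g_def by (rule mean_zero_center[OF uc])
  have gc: "edge_cont g" using g by (simp add: mean_zero_def)
  have gC1: "vertex_C1 g u' (w - c)"
    unfolding g_def c_def by (rule vertex_C1_center[OF P.eigen_C1[OF u]])
  have "W (perturbed h t) u one = 0"
    using P.eigen_mean[OF u] P.M_pos by (simp add: P.mean_zero_def)
  moreover have "g = (\<lambda>e s. 1 * u e s + (- c) * one e s)"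
    by (simp add: g_def center_def c_def fun_eq_iff)
  ultimately have "W (perturbed h t) g g = 1 + c\<^sup>2 * P.mass"
    using W_lincomb_square[OF P.\<sigma>_cont uc edge_cont_const, of 1 "- c" 1] norm
    by (simp add: P.mass_def)
  then have gt: "1 \<le> W (perturbed h t) g g" using P.mass_pos by simp
  have gpos: "0 < W \<sigma> g g"
  proof (rule ccontr)
    assume "\<not> 0 < W \<sigma> g g"
    then have "W \<sigma> g g = 0" using W_nonneg[OF \<sigma>_cont gc \<sigma>_nonneg] by simp
    then have "g e s = 0" if "e \<in> E" "s \<in> {0..L e}" for e s
      using W_eq_0D[OF \<sigma>_cont gc \<sigma>_pos] that by blast
    then have "W (perturbed h t) g g = W (perturbed h t) (\<lambda>e s. 0) (\<lambda>e s. 0)"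
      by (intro W_cong) simp
    then show False using gt by (simp add: W_def)
  qed
  define a where "a = 1 / sqrt (W \<sigma> g g)"
  have a: "a\<^sup>2 * W \<sigma> g g = 1" using gpos by (simp add: a_def power_divide)
  define f where "f = (\<lambda>e s. a * g e s + 0 * g e s)"
  have "vertex_C1 f (\<lambda>e s. a * u' e s + 0 * u' e s) (a * (w - c) + 0 * (w - c))"
    unfolding f_def by (rule vertex_C1_lincomb[OF gC1 gC1])
  then have fC1: "vertex_C1 f (\<lambda>e s. a * u' e s) (a * (w - c))" by simp
  have f: "mean_zero f" unfolding f_def by (intro mean_zero_lincomb g)
  have Wf: "W k f f = a\<^sup>2 * W k g g" for k
    unfolding f_def using W_cmult_square[of k a g] by simp
  have "W one (\<lambda>e s. a * u' e s) (\<lambda>e s. a * u' e s) = a\<^sup>2 * (1 / P.M)"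
    unfolding W_cmult_square P.eigen_energy[OF u] norm by simp
  also have "\<dots> \<le> (a\<^sup>2 * W (perturbed h t) g g) / P.M"
    using gt P.M_pos mult_left_mono[OF gt, of "a\<^sup>2"] by (simp add: divide_right_mono)
  also have "a\<^sup>2 * W (perturbed h t) g g = 1 + t * W h f f"
    using f a by (simp add: Wf W_perturbed[OF h gc gc] algebra_simps)
  finally show ?thesis
    using fC1 f a unfolding M_at_def by (intro exI[of _ f] exI conjI) (auto simp: Wf)
qed

text \<open>Along positive times tending to 0, an eigenvalue that hardly grows makes the functions
  of \<open>perturbed_test_function\<close> a maximising sequence. The limit \<open>x\<close> of a
  subsequence is an eigenfunction, and \<open>W h x x < 0\<close> pushes the energy bound below
  \<open>1 / M\<close>, against \<open>poincare\<close>. Which eigenfunction arises is not under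
  control, hence the sign condition on the whole eigenspace.\<close>

lemma not_eventually_le:
  assumes h: "edge_cont h"
    and dir: "\<And>u u' w. eigen (1 / M) u u' w \<Longrightarrow> W \<sigma> u u = 1 \<Longrightarrow> W h u u < 0"
    and ev: "\<And>\<epsilon>. 0 < \<epsilon> \<Longrightarrow> \<forall>\<^sub>F t in at 0. 1 / M_at h t \<le> 1 / M + \<epsilon> * \<bar>t\<bar>"
  shows False
proof -
  obtain b where b: "0 < b" "\<And>t. \<bar>t\<bar> < b \<Longrightarrow> weighted_edges E L (perturbed h t)"
    using perturbed_weighted_edges[OF h] by blast
  obtain K where K: "0 < K" "\<And>e s. e \<in> E \<Longrightarrow> s \<in> {0..L e} \<Longrightarrow> \<bar>h e s\<bar> \<le> K * \<sigma> e s"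
    using weight_dominates[OF h] by blast
  define t where "t n = b / real (n + 2)" for n
  have t: "0 < t n" "t n < b" for n using b(1) by (auto simp: t_def field_simps add_pos_nonneg)
  have t0: "t \<longlonglongrightarrow> 0"
  proof -
    have "(\<lambda>n. b * inverse (real (Suc (Suc n)))) \<longlonglongrightarrow> b * 0"
      using LIMSEQ_Suc[OF LIMSEQ_inverse_real_of_nat] by (intro tendsto_intros) 
    then show ?thesis by (simp add: t_def[abs_def] inverse_eq_divide)
  qed
  have Pt: "weighted_edges E L (perturbed h (t n))" for n
    using b(2)[of "t n"] t[of n] by simp
  have "\<exists>f f' w. vertex_C1 f f' w \<and> mean_zero f \<and> W \<sigma> f f = 1 \<and>
      W one f' f' \<le> (1 + t n * W h f f) / M_at h (t n)" for n
    by (rule perturbed_test_function[OF h Pt])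
  then obtain f f' w where f: "\<And>n. vertex_C1 (f n) (f' n) (w n)" "\<And>n. mean_zero (f n)"
    "\<And>n. W \<sigma> (f n) (f n) = 1"
    "\<And>n. W one (f' n) (f' n) \<le> (1 + t n * W h (f n) (f n)) / M_at h (t n)"
    by metis
  have fc: "edge_cont (f n)" for n using f(2) by (simp add: mean_zero_def)
  define \<Lambda> where "\<Lambda> n = 1 / M_at h (t n)" for n
  have \<Lambda>: "0 < \<Lambda> n" for n
    unfolding \<Lambda>_def M_at_def using weighted_edges.M_pos[OF Pt] by simp
  define D where "D n = W one (f' n) (f' n)" for n
  define H where "H n = W h (f n) (f n)" for n
  have D_le: "D n \<le> \<Lambda> n * (1 + t n * H n)" for n
    using f(4)[of n] by (simp add: D_def H_def \<Lambda>_def)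
  have D_ge: "1 / M \<le> D n" for n
    using poincare[OF f(1,2), of n] f(3)[of n] M_pos by (simp add: D_def field_simps)
  then have D_pos: "0 < D n" for n using M_pos by (meson less_le_trans zero_less_divide_1_iff)
  have \<Lambda>_le: "\<forall>\<^sub>F n in sequentially. \<Lambda> n \<le> 1 / M + \<epsilon> * t n" if "0 < \<epsilon>" for \<epsilon>
  proof -
    have "t n \<noteq> 0" for n using t(1)[of n] by simp
    then have "filterlim t (at 0) sequentially" using t0 by (simp add: filterlim_at)
    from eventually_compose_filterlim[OF ev[OF that] this]
    show ?thesis using t(1) by (simp add: \<Lambda>_def less_imp_le)
  qed
  have H_le: "H n \<le> K" for n
  proof -
    have "H n \<le> W (\<lambda>e s. K * \<sigma> e s + 0 * \<sigma> e s) (f n) (f n)"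
      unfolding H_def using K(2)
      by (intro W_mono_weight h fc edge_cont_lincomb \<sigma>_cont) (auto simp: abs_le_iff)
    also have "\<dots> = K * W \<sigma> (f n) (f n) + 0 * W \<sigma> (f n) (f n)"
      by (intro W_lincomb_weight \<sigma>_cont fc)
    finally show ?thesis by (simp add: f(3))
  qed
  \<comment> \<open>\<open>W_square_le_form\<close> gives \<open>form * D \<ge> 1\<close>, and
    \<open>D\<close> is eventually at most \<open>U\<close>, which tends to
    \<open>1 / M\<close>.\<close>
  have "(\<lambda>n. form (f n) (f n)) \<longlonglongrightarrow> M"
  proof (rule tendsto_sandwich)
    define U where "U n = (1 / M + 1 * t n) * (1 + t n * K)" for n
    show "\<forall>\<^sub>F n in sequentially. 1 / U n \<le> form (f n) (f n)"
      using \<Lambda>_le[OF zero_less_one]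
    proof eventually_elim
      case (elim n)
      have "D n \<le> \<Lambda> n * (1 + t n * K)"
        using D_le[of n] H_le[of n] t(1)[of n] \<Lambda>[of n]
        by (smt (verit, best) mult_left_mono)
      also have "\<dots> \<le> U n"
        unfolding U_def using elim t(1)[of n] K(1) by (intro mult_right_mono) auto
      finally have "D n \<le> U n" .
      have "1 \<le> form (f n) (f n) * D n"
        using W_square_le_form[OF f(1,2), of n] f(3)[of n] by (simp add: D_def)
      then have "1 / D n \<le> form (f n) (f n)"
        using D_pos[of n] by (simp add: field_simps)
      moreover have "1 / U n \<le> 1 / D n"
        using \<open>D n \<le> U n\<close> D_pos[of n] by (intro divide_left_mono) auto
      ultimately show ?case by linarith
    qed
    show "\<forall>\<^sub>F n in sequentially. form (f n) (f n) \<le> M"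
      using form_le_M[OF f(2)] f(3) by simp
    have "(\<lambda>n. 1 / U n) \<longlonglongrightarrow> 1 / ((1 / M + 1 * 0) * (1 + 0 * K))"
      unfolding U_def using M_pos by (intro tendsto_intros t0) auto
    then show "(\<lambda>n. 1 / U n) \<longlonglongrightarrow> M" by simp
  qed simp
  then obtain r x where r: "strict_mono (r :: nat \<Rightarrow> nat)" and x: "mean_zero x" "W \<sigma> x x = 1" "form x x = M"
    and lim: "(\<lambda>n. W \<sigma> (\<lambda>e s. f (r n) e s - x e s) (\<lambda>e s. f (r n) e s - x e s)) \<longlonglongrightarrow> 0"
    by (rule maximizing_sequence_converges[OF f(2,3)]) (rule that)
  have xc: "edge_cont x" using x(1) by (simp add: mean_zero_def)
  obtain wx where "eigen (1 / M) x (\<lambda>e s. green' x e s / M) wx"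
    using maximizer_eigen[OF x(1)] x(2,3) by auto
  then have Hx: "W h x x < 0" using dir x(2) by blast
  define \<kappa> where "\<kappa> = - W h x x"
  have \<kappa>: "0 < \<kappa>" using Hx by (simp add: \<kappa>_def)
  have "(\<lambda>n. H (r n)) \<longlonglongrightarrow> W h x x"
    unfolding H_def using f(3) x(2) by (intro W_signed_continuous h fc xc lim) simp
  then have "\<forall>\<^sub>F n in sequentially. H (r n) < - \<kappa> / 2"
    using \<kappa> by (intro order_tendstoD) (auto simp: \<kappa>_def)
  \<comment> \<open>Half of the rate \<open>\<kappa> / 2\<close> gained from \<open>H\<close>. The
    tolerance is fixed only once the limit \<open>x\<close> is known, so \<open>ev\<close> is stated
    for every \<open>\<epsilon>\<close>.\<close>
  moreover have "\<forall>\<^sub>F n in sequentially. \<Lambda> (r n) \<le> 1 / M + \<kappa> / (4 * M) * t (r n)"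
    using eventually_subseq[OF r \<Lambda>_le[of "\<kappa> / (4 * M)"]] \<kappa> M_pos by simp
  ultimately have "\<forall>\<^sub>F n in sequentially. False"
  proof eventually_elim
    case (elim n)
    define \<tau> where "\<tau> = t (r n)"
    have \<tau>: "0 < \<tau>" by (simp add: \<tau>_def t)
    have "\<tau> * H (r n) \<le> \<tau> * (- \<kappa> / 2)"
      using elim(1) \<tau> by (intro mult_left_mono) auto
    then have "\<Lambda> (r n) * (1 + \<tau> * H (r n)) \<le> \<Lambda> (r n) * (1 + \<tau> * (- \<kappa> / 2))"
      using \<Lambda>[of "r n"] by (intro mult_left_mono) auto
    then have 1: "1 / M \<le> \<Lambda> (r n) * (1 + \<tau> * (- \<kappa> / 2))"
      using D_ge[of "r n"] D_le[of "r n"] unfolding \<tau>_def by linarith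
    then have "0 < \<Lambda> (r n) * (1 + \<tau> * (- \<kappa> / 2))"
      using M_pos by (meson less_le_trans zero_less_divide_1_iff)
    then have "0 < 1 + \<tau> * (- \<kappa> / 2)"
      using \<Lambda>[of "r n"] by (simp add: zero_less_mult_iff)
    then have "\<Lambda> (r n) * (1 + \<tau> * (- \<kappa> / 2)) \<le> (1 / M + \<kappa> / (4 * M) * \<tau>) * (1 + \<tau> * (- \<kappa> / 2))"
      using elim(2) unfolding \<tau>_def by (intro mult_right_mono) auto
    then have "1 / M \<le> (1 / M + \<kappa> / (4 * M) * \<tau>) * (1 + \<tau> * (- \<kappa> / 2))" using 1 by linarith
    then have "1 / M * M \<le> (1 / M + \<kappa> / (4 * M) * \<tau>) * (1 + \<tau> * (- \<kappa> / 2)) * M"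
      using M_pos by (intro mult_right_mono) auto
    moreover have "(1 / M + \<kappa> / (4 * M) * \<tau>) * (1 + \<tau> * (- \<kappa> / 2)) * M
        = 1 - \<kappa> * \<tau> / 4 - (\<kappa> * \<tau>)\<^sup>2 / 8"
      using M_pos by (simp add: field_simps power2_eq_square)
    moreover have "0 < \<kappa> * \<tau>" using \<kappa> \<tau> by simp
    ultimately show False using M_pos by simp (smt (verit) zero_le_power2)
  qed
  then show False by simp
qed

end

section \<open>Flower graphs\<close>

lemma smooth_within_lincomb:
  assumes "smooth_within S f" "smooth_within S g"
  shows "smooth_within S (\<lambda>x. a * f x + b * g x)"
proof -
  obtain D where D: "\<And>x. x \<in> S \<Longrightarrow> D 0 x = f x"
    "\<And>n x. x \<in> S \<Longrightarrow> (D n has_real_derivative D (Suc n) x) (at x within S)"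
    using assms(1) unfolding smooth_within_def by blast
  obtain D' where D': "\<And>x. x \<in> S \<Longrightarrow> D' 0 x = g x"
    "\<And>n x. x \<in> S \<Longrightarrow> (D' n has_real_derivative D' (Suc n) x) (at x within S)"
    using assms(2) unfolding smooth_within_def by blast
  show ?thesis
    unfolding smooth_within_def
  proof (intro exI conjI ballI allI)
    fix x assume "x \<in> S"
    then show "(\<lambda>n x. a * D n x + b * D' n x) 0 x = a * f x + b * g x" using D D' by simp
    show "((\<lambda>n x. a * D n x + b * D' n x) n has_real_derivative
        (\<lambda>n x. a * D n x + b * D' n x) (Suc n) x) (at x within S)" for n
      using D(2)[OF \<open>x \<in> S\<close>] D'(2)[OF \<open>x \<in> S\<close>] by (auto intro!: DERIV_add DERIV_cmult)
  qed
qed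

text \<open>Derivatives of polynomials are polynomials, so iterating one choice of derivative gives
  all orders. The factor \<open>l\<close> serves to pull functions of arclength back to
  \<open>[0, 1]\<close>.\<close>

lemma smooth_within_polynomial_scaled:
  assumes "real_polynomial_function p"
  shows "smooth_within S (\<lambda>x. p (l * x))"
proof -
  obtain d where d: "\<And>p x. real_polynomial_function p \<Longrightarrow> real_polynomial_function (d p)"
    "\<And>p x. real_polynomial_function p \<Longrightarrow> (p has_real_derivative d p x) (at x)"
    using has_real_derivative_polynomial_function by metis
  have poly: "real_polynomial_function ((d ^^ n) p)" for n
    by (induction n) (use assms d(1) in auto)
  have "((\<lambda>x. l ^ n * (d ^^ n) p (l * x)) has_real_derivative l ^ Suc n * (d ^^ Suc n) p (l * x)) (at x within S)" for n x
  proof -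
    have "((\<lambda>x. (d ^^ n) p (l * x)) has_real_derivative d ((d ^^ n) p) (l * x) * l) (at x within S)"
      by (rule DERIV_chain2[OF d(2)[OF poly]]) (auto intro!: derivative_eq_intros)
    from DERIV_cmult[OF this, of "l ^ n"] show ?thesis by (simp add: mult_ac)
  qed
  then show ?thesis
    unfolding smooth_within_def by (intro exI[of _ "\<lambda>n x. l ^ n * (d ^^ n) p (l * x)"]) auto
qed

lemma smooth_within_const: "smooth_within S (\<lambda>x. c)"
  using smooth_within_polynomial_scaled[OF real_polynomial_function.intros(2), of S c] by simp

lemma smooth2_within_affine:
  assumes "smooth_within T f" "smooth_within T g"
  shows "smooth2_within S T (\<lambda>t x. f x + t * g x)"
proof -
  obtain D where D: "\<And>x. x \<in> T \<Longrightarrow> D 0 x = f x"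
    "\<And>n x. x \<in> T \<Longrightarrow> (D n has_real_derivative D (Suc n) x) (at x within T)"
    using assms(1) unfolding smooth_within_def by blast
  obtain D' where D': "\<And>x. x \<in> T \<Longrightarrow> D' 0 x = g x"
    "\<And>n x. x \<in> T \<Longrightarrow> (D' n has_real_derivative D' (Suc n) x) (at x within T)"
    using assms(2) unfolding smooth_within_def by blast
  have c: "continuous_on T (D n)" "continuous_on T (D' n)" for n
    using D(2) D'(2) by (meson DERIV_continuous continuous_on_eq_continuous_within)+
  have cs: "continuous_on (S \<times> T) (\<lambda>p. h (snd p))" if "continuous_on T h" for h :: "real \<Rightarrow> real"
    by (rule continuous_on_compose2[OF that]) (auto intro!: continuous_intros)
  \<comment> \<open>The family is affine in \<open>t\<close>, so only the orders 0 and 1 in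
    \<open>t\<close> can be nonzero.\<close>
  define F where "F i j t x = (if i = 0 then D j x + t * D' j x else if i = Suc 0 then D' j x else 0)"
    for i j :: nat and t x :: real
  show ?thesis
    unfolding smooth2_within_def
  proof (intro exI[of _ F] conjI ballI allI)
    fix t x assume "t \<in> S" "x \<in> T"
    then show "F 0 0 t x = f x + t * g x" using D D' by (simp add: F_def)
  next
    fix i j
    show "continuous_on (S \<times> T) (\<lambda>(t, x). F i j t x)"
      unfolding F_def case_prod_unfold
      by (cases "i = 0"; cases "i = Suc 0") (auto intro!: continuous_intros cs c)
  next
    fix i j t x assume "t \<in> S" and x: "x \<in> T"
    show "((\<lambda>s. F i j s x) has_real_derivative F (Suc i) j t x) (at t within S)"
      by (cases "i = 0"; cases "i = Suc 0") (auto simp: F_def intro!: derivative_eq_intros)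
    show "((\<lambda>y. F i j t y) has_real_derivative F i (Suc j) t x) (at x within T)"
      using D(2)[OF x, of j] D'(2)[OF x, of j]
      by (cases "i = 0"; cases "i = Suc 0") (auto simp: F_def intro!: DERIV_add DERIV_cmult)
  qed
qed

lemma smooth_within_continuous_on: "smooth_within S f \<Longrightarrow> continuous_on S f"
proof -
  assume "smooth_within S f"
  then obtain D where D: "\<And>x. x \<in> S \<Longrightarrow> D 0 x = f x"
    "\<And>n x. x \<in> S \<Longrightarrow> (D n has_real_derivative D (Suc n) x) (at x within S)"
    unfolding smooth_within_def by blast
  have "continuous_on S (D 0)"
    using D(2) by (meson DERIV_continuous continuous_on_eq_continuous_within)
  then show ?thesis using D(1) continuous_on_cong by force
qed

definition edge_density :: "('e \<Rightarrow> real) \<Rightarrow> ('e \<Rightarrow> real \<Rightarrow> real) \<Rightarrow> 'e \<Rightarrow> real \<Rightarrow> real" where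
  "edge_density g \<rho> e s = \<rho> e (s / edge_length g e)"

lemma integral_edge_density:
  assumes "0 < g e" and "continuous_on {0..1} (\<rho> e)"
  shows "integral {0..edge_length g e} (edge_density g \<rho> e) = edge_length g e * integral {0..1} (\<rho> e)"
proof -
  define l where "l = edge_length g e"
  have l: "0 < l" using assms by (simp add: l_def edge_length_def)
  have "(\<rho> e has_integral integral {0..1} (\<rho> e)) {0..1}"
    using assms by (intro integrable_integral integrable_continuous_interval)
  then have "((\<lambda>s. \<rho> e (1 / l * s)) has_integral (1 / \<bar>1 / l\<bar>) *\<^sub>R integral {0..1} (\<rho> e)) ((\<lambda>s. s / (1 / l)) ` {0..1})"
    using l by (intro has_integral_stretch_real) auto
  moreover have "(\<lambda>s. s / (1 / l)) ` {0..1} = {0..l}"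
  proof -
    have "(\<lambda>s. s / (1 / l)) ` {0..1} = (*) l ` {0..1}" by (intro image_cong) auto
    also have "\<dots> = {0..l}" using l image_mult_atLeastAtMost[of l 0 1] by simp
    finally show ?thesis .
  qed
  ultimately have "((\<lambda>s. \<rho> e (1 / l * s)) has_integral l * integral {0..1} (\<rho> e)) {0..l}"
    using l by simp
  then show ?thesis
    by (auto simp: edge_density_def[abs_def] l_def intro!: integral_unique)
qed

section \<open>From flower graphs to weighted edges\<close>

context
  fixes G :: "('v, 'e) pre_digraph"
  assumes flower: "flower_graph G" and nonempty: "arcs G \<noteq> {}"
begin

lemma finite_flower_arcs: "finite (arcs G)"
  using flower by (auto simp: flower_graph_def fin_digraph_def fin_digraph_axioms_def)

lemma flower_arcs_at:
  obtains v where "verts G = {v}" "\<And>e. e \<in> arcs G \<Longrightarrow> tail G e = v \<and> head G e = v"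
    "out_arcs G v = arcs G" "in_arcs G v = arcs G"
proof -
  obtain v where v: "verts G = {v}" using flower by (auto simp: flower_graph_def)
  have "wf_digraph G" using flower by (simp add: flower_graph_def fin_digraph_def)
  then have th: "tail G e = v \<and> head G e = v" if "e \<in> arcs G" for e
    using that v by (auto simp: wf_digraph_def)
  then show thesis using that[OF v] by (auto simp: out_arcs_def in_arcs_def)
qed

lemma weighted_edges_admissible:
  assumes "(g, \<rho>) \<in> admissible G"
  shows "weighted_edges (arcs G) (edge_length g) (edge_density g \<rho>)"
proof -
  have g: "0 < g e" and \<rho>: "smooth_within {0..1} (\<rho> e)" "\<And>x. x \<in> {0..1} \<Longrightarrow> 0 < \<rho> e x"
    if "e \<in> arcs G" for e
    using assms that by (auto simp: admissible_def metrics_def densities_def)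
  interpret edge_family "arcs G" "edge_length g"
    by unfold_locales (use finite_flower_arcs nonempty g in \<open>auto simp: edge_length_def\<close>)
  show ?thesis
  proof
    show "edge_cont (edge_density g \<rho>)"
      unfolding edge_cont_def
    proof
      fix e assume e: "e \<in> arcs G"
      show "continuous_on {0..edge_length g e} (edge_density g \<rho> e)"
        unfolding edge_density_def[abs_def]
        by (rule continuous_on_compose2[OF smooth_within_continuous_on[OF \<rho>(1)[OF e]]])
           (use L_pos[OF e] in \<open>auto intro!: continuous_intros\<close>)
    qed
    fix e s assume es: "e \<in> arcs G" "s \<in> {0..edge_length g e}"
    then have "s / edge_length g e \<in> {0..1}" using L_pos[OF es(1)] by auto
    then show "0 < edge_density g \<rho> e s"
      unfolding edge_density_def by (rule \<rho>(2)[OF es(1)])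
  qed
qed

text \<open>Every arc is a loop, so the outgoing and the incoming sum at the vertex both run over
  all arcs and merge into the one sum of \<open>eigen\<close>.\<close>

lemma eigenspace_iff_eigen:
  assumes "(g, \<rho>) \<in> admissible G"
  shows "u \<in> eigenspace G g \<rho> \<mu> \<longleftrightarrow>
    (\<exists>u' w. weighted_edges.eigen (arcs G) (edge_length g) (edge_density g \<rho>) \<mu> u u' w)"
proof -
  interpret weighted_edges "arcs G" "edge_length g" "edge_density g \<rho>"
    by (rule weighted_edges_admissible[OF assms])
  obtain v where v: "verts G = {v}" "\<And>e. e \<in> arcs G \<Longrightarrow> tail G e = v \<and> head G e = v"
    "out_arcs G v = arcs G" "in_arcs G v = arcs G" by (rule flower_arcs_at) (rule that)
  show ?thesis
  proof
    assume "u \<in> eigenspace G g \<rho> \<mu>"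
    then obtain u' w where u: "\<forall>e\<in>arcs G. \<forall>s\<in>{0..edge_length g e}.
           (u e has_real_derivative u' e s) (at s within {0..edge_length g e}) \<and>
           (u' e has_real_derivative - (\<mu> * \<rho> e (s / edge_length g e) * u e s))
             (at s within {0..edge_length g e})"
        "\<forall>e\<in>arcs G. u e 0 = w (tail G e) \<and> u e (edge_length g e) = w (head G e)"
        "\<forall>v\<in>verts G. (\<Sum>e\<in>out_arcs G v. u' e 0) + (\<Sum>e\<in>in_arcs G v. - u' e (edge_length g e)) = 0"
      unfolding eigenspace_def by blast
    have "(\<Sum>e\<in>arcs G. u' e 0 - u' e (edge_length g e)) = 0"
      using u(3) v by (simp add: sum_subtractf sum_negf)
    moreover have "\<forall>e\<in>arcs G. u e 0 = w v \<and> u e (edge_length g e) = w v"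
      using u(2) v(2) by auto
    ultimately have "eigen \<mu> u u' (w v)"
      using u(1) unfolding eigen_def edge_density_def by blast
    then show "\<exists>u' w. eigen \<mu> u u' w" by blast
  next
    assume "\<exists>u' w. eigen \<mu> u u' w"
    then obtain u' w where u: "eigen \<mu> u u' w" by blast
    have "(\<Sum>e\<in>out_arcs G v. u' e 0) + (\<Sum>e\<in>in_arcs G v. - u' e (edge_length g e)) = 0" if "v \<in> verts G" for v
      using u that v by (simp add: eigen_def sum_subtractf sum_negf)
    then show "u \<in> eigenspace G g \<rho> \<mu>"
      using u unfolding eigenspace_def eigen_def edge_density_def
      by (intro CollectI exI[of _ u'] exI[of _ "\<lambda>_. w"]) blast
  qed
qed

text \<open>Index 1 asks for two independent eigenfunctions. The constant 1 and a normalised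
  eigenfunction for \<open>1 / M\<close> show that \<open>1 / M\<close> qualifies; below it all
  eigenfunctions are constant, so no two are independent.\<close>

lemma eigenvalue_1_eq:
  assumes adm: "(g, \<rho>) \<in> admissible G"
  shows "eigenvalue G 1 g \<rho> = 1 / weighted_edges.M (arcs G) (edge_length g) (edge_density g \<rho>)"
proof -
  interpret weighted_edges "arcs G" "edge_length g" "edge_density g \<rho>"
    by (rule weighted_edges_admissible[OF adm])
  let ?\<sigma> = "edge_density g \<rho>"
  let ?S = "{lam. \<exists>u. lin_indep_on_graph G g (Suc 1) u \<and> (\<forall>i<Suc 1. \<exists>\<mu>\<le>lam. u i \<in> eigenspace G g \<rho> \<mu>)}"
  note es = eigenspace_iff_eigen[OF adm]
  have mem: "1 / M \<in> ?S"
  proof -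
    obtain u1 u1' w where u1: "eigen (1 / M) u1 u1' w" and norm: "W ?\<sigma> u1 u1 = 1"
      using eigen_exists by blast
    define u where "u i = (if i = 0 then one else u1)" for i :: nat
    have "eigen 0 one (\<lambda>e s. 0) 1" by (auto simp: eigen_def)
    then have "one \<in> eigenspace G g \<rho> 0" "u1 \<in> eigenspace G g \<rho> (1 / M)"
      using u1 es by blast+
    then have "(if i = 0 then 0 else 1 / M) \<le> 1 / M \<and> u i \<in> eigenspace G g \<rho> (if i = 0 then 0 else 1 / M)" for i
      using M_pos by (simp add: u_def)
    then have "\<forall>i<Suc 1. \<exists>\<mu>\<le>1 / M. u i \<in> eigenspace G g \<rho> \<mu>" by blast
    moreover have "lin_indep_on_graph G g (Suc 1) u"
      unfolding lin_indep_on_graph_def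
    proof (intro allI impI)
      fix c :: "nat \<Rightarrow> real" and i :: nat
      assume "\<forall>e\<in>arcs G. \<forall>s\<in>{0..edge_length g e}. (\<Sum>i<Suc 1. c i * u i e s) = 0" and i: "i < Suc 1"
      then have 0: "c 0 * one e s + c 1 * u1 e s = 0" if "e \<in> arcs G" "s \<in> {0..edge_length g e}" for e s
        using that by (auto simp: u_def)
      have "W ?\<sigma> (\<lambda>e s. c 0 * one e s + c 1 * u1 e s) u1 = c 0 * W ?\<sigma> one u1 + c 1 * W ?\<sigma> u1 u1"
        by (intro W_lincomb_left \<sigma>_cont eigen_cont[OF u1] edge_cont_const)
      moreover have "W ?\<sigma> (\<lambda>e s. c 0 * one e s + c 1 * u1 e s) u1 = W ?\<sigma> (\<lambda>e s. 0) u1"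
        by (rule W_cong) (simp only: 0)
      moreover have "W ?\<sigma> one u1 = 0"
        using eigen_mean[OF u1] M_pos by (simp add: mean_zero_def W_commute)
      ultimately have c1: "c 1 = 0" using norm by (simp add: W_def)
      obtain e where "e \<in> arcs G" using nonempty by blast
      then have "c 0 = 0" using 0[of e 0] c1 L_pos[of e] by simp
      then show "c i = 0" using c1 i by (auto simp: less_Suc_eq)
    qed
    ultimately show ?thesis by blast
  qed
  have lower: "1 / M \<le> lam" if "lam \<in> ?S" for lam
  proof (rule ccontr)
    assume less: "\<not> 1 / M \<le> lam"
    obtain u where li: "lin_indep_on_graph G g (Suc 1) u"
      and u: "\<forall>i<Suc 1. \<exists>\<mu>\<le>lam. u i \<in> eigenspace G g \<rho> \<mu>"
      using \<open>lam \<in> ?S\<close> by blast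
    have const: "\<exists>w. \<forall>e\<in>arcs G. \<forall>s\<in>{0..edge_length g e}. u i e s = w" if i: "i < Suc 1" for i
    proof -
      obtain \<mu> v' w where \<mu>: "\<mu> \<le> lam" and ei: "eigen \<mu> (u i) v' w"
        using u i es by blast
      note uc = eigen_cont[OF ei]
      have v'c: "edge_cont v'" using eigen_C1[OF ei] by (simp add: vertex_C1_def)
      show ?thesis
      proof (cases "W ?\<sigma> (u i) (u i) = 0")
        case True
        then show ?thesis using W_eq_0D[OF \<sigma>_cont uc \<sigma>_pos] by blast
      next
        case False
        then have pos: "0 < W ?\<sigma> (u i) (u i)"
          using W_nonneg[OF \<sigma>_cont uc \<sigma>_nonneg] by simp
        \<comment> \<open>\<open>eigen_ge\<close> excludes values strictly between 0 and
          \<open>1 / M\<close>; for the others, negative ones included, the energy identity forces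
          zero energy.\<close>
        have "\<mu> \<le> 0" using eigen_ge[OF ei _ False] \<mu> less by linarith
        then have "\<mu> * W ?\<sigma> (u i) (u i) \<le> 0" using pos by (simp add: mult_nonpos_nonneg)
        then have "W one v' v' = 0"
          using eigen_energy[OF ei] W_nonneg[of one v'] v'c by simp
        then have "(u i e s - w)\<^sup>2 \<le> 0" if "e \<in> arcs G" "s \<in> {0..edge_length g e}" for e s
          using vertex_C1_pointwise[OF eigen_C1[OF ei] that] by simp
        then show ?thesis by (intro exI[of _ w]) auto
      qed
    qed
    obtain w0 w1 where w: "\<And>e s. e \<in> arcs G \<Longrightarrow> s \<in> {0..edge_length g e} \<Longrightarrow> u 0 e s = w0"
      "\<And>e s. e \<in> arcs G \<Longrightarrow> s \<in> {0..edge_length g e} \<Longrightarrow> u 1 e s = w1"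
      using const[of 0] const[of 1] by auto
    have li': "c 0 = 0 \<and> c 1 = 0" if "c 0 * w0 + c 1 * w1 = 0" for c :: "nat \<Rightarrow> real"
    proof -
      have "\<forall>i<Suc 1. c i = 0"
        using li that w unfolding lin_indep_on_graph_def by simp
      then show ?thesis by simp
    qed
    have "w1 = 0 \<and> w0 = 0"
      using li'[of "\<lambda>i. if i = 0 then w1 else - w0"] by simp
    then show False using li'[of "\<lambda>i. 1"] by simp
  qed
  show ?thesis
    unfolding eigenvalue_def by (rule cInf_eq_minimum[OF mem lower])
qed

text \<open>The metric stays fixed and the variation preserves the volume factor, so along the
  family the functional is a positive constant \<open>C\<close> times \<open>1 / M_at\<close>;
  \<open>not_eventually_le\<close> and \<open>not_eventually_ge\<close> refute the two alternatives
  of extremality.\<close>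

lemma no_extremal_pair:
  assumes two: "card (arcs G) \<ge> 2"
  shows "\<not> extremal G (normalized_eigenvalue G 1 \<alpha>) p"
proof
  assume ext: "extremal G (normalized_eigenvalue G 1 \<alpha>) p"
  obtain g \<rho> where p: "p = (g, \<rho>)" by fastforce
  have adm: "(g, \<rho>) \<in> admissible G" using ext p by (simp add: extremal_def)
  have g: "0 < g e" and \<rho>: "smooth_within {0..1} (\<rho> e)" if "e \<in> arcs G" for e
    using adm that by (auto simp: admissible_def metrics_def densities_def)
  define L where "L = edge_length g"
  define \<sigma> where "\<sigma> = edge_density g \<rho>"
  interpret weighted_edges "arcs G" L \<sigma>
    unfolding L_def \<sigma>_def by (rule weighted_edges_admissible[OF adm])
  have Lp: "0 < L e" if "e \<in> arcs G" for e using L_pos[OF that] .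
  obtain e1 e2 where e12: "e1 \<in> arcs G" "e2 \<in> arcs G" "e1 \<noteq> e2"
    using two card_le_Suc0_iff_eq[OF finite_flower_arcs] by force
  \<comment> \<open>Arclength integrals over an edge are \<open>L e\<close> times those over
    \<open>[0, 1]\<close>, so these weights turn the constraint of
    \<open>exists_decreasing_direction\<close> into the volume constraint of the functional.\<close>
  define \<kappa> where "\<kappa> e = g e powr \<alpha> / L e" for e
  have \<kappa>: "0 < \<kappa> e" if "e \<in> arcs G" for e using g[OF that] Lp[OF that] by (simp add: \<kappa>_def)
  obtain q where q: "\<And>e. real_polynomial_function (q e)"
    "(\<Sum>e\<in>arcs G. \<kappa> e * integral {0..L e} (\<lambda>s. q e s - \<sigma> e s)) = 0"
    "\<And>u u' w. eigen (1 / M) u u' w \<Longrightarrow> W \<sigma> u u = 1 \<Longrightarrow> W (\<lambda>e s. q e s - \<sigma> e s) u u < 0"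
    using exists_decreasing_direction[OF e12, of \<kappa>] \<kappa> by blast
  define \<eta> where "\<eta> e x = 1 * q e (L e * x) + (-1) * \<rho> e x" for e x
  have \<eta>: "smooth_within {0..1} (\<eta> e)" if "e \<in> arcs G" for e
    unfolding \<eta>_def by (intro smooth_within_lincomb smooth_within_polynomial_scaled q(1) \<rho> that)
  define h where "h = edge_density g \<eta>"
  have h_eq: "h e s = q e s - \<sigma> e s" if "e \<in> arcs G" for e s
    using Lp[OF that] by (simp add: h_def edge_density_def \<eta>_def \<sigma>_def L_def)
  have h: "edge_cont h"
  proof -
    have "continuous_on {0..L e} (q e)" for e by (rule continuous_on_real_polynomial[OF q(1)])
    then have "edge_cont (\<lambda>e s. q e s - \<sigma> e s)"
      by (intro edge_cont_diff \<sigma>_cont) (simp add: edge_cont_def)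
    then show ?thesis unfolding edge_cont_def using h_eq by (simp cong: continuous_on_cong)
  qed
  have dir: "W h u u < 0" if "eigen (1 / M) u u' w" "W \<sigma> u u = 1" for u u' w
  proof -
    have "W h u u = W (\<lambda>e s. q e s - \<sigma> e s) u u" by (rule W_cong) (simp add: h_eq)
    then show ?thesis using q(3)[OF that] by simp
  qed
  define \<rho>t where "\<rho>t t e x = \<rho> e x + t * \<eta> e x" for t e x
  have dens: "edge_density g (\<rho>t t) = perturbed h t" for t
    unfolding perturbed_def by (simp add: fun_eq_iff edge_density_def \<rho>t_def \<sigma>_def h_def)
  obtain b where b: "0 < b" "\<And>t. \<bar>t\<bar> < b \<Longrightarrow> weighted_edges (arcs G) L (perturbed h t)"
    using perturbed_weighted_edges[OF h] by blast
  have adm_t: "(g, \<rho>t t) \<in> admissible G" if t: "\<bar>t\<bar> < b" for t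
  proof -
    have "smooth_within {0..1} (\<rho>t t e)" if "e \<in> arcs G" for e
      using smooth_within_lincomb[OF \<rho>[OF that] \<eta>[OF that], of 1 t] by (simp add: \<rho>t_def[abs_def])
    moreover have "0 < \<rho>t t e x" if e: "e \<in> arcs G" and x: "x \<in> {0..1}" for e x
    proof -
      have "0 < edge_density g (\<rho>t t) e (L e * x)"
        unfolding dens using Lp[OF e] x e
        by (intro weighted_edges.\<sigma>_pos[OF b(2)[OF t]]) (auto simp: mult_left_le)
      then show ?thesis using Lp[OF e] by (simp add: edge_density_def L_def)
    qed
    ultimately show ?thesis using g by (auto simp: admissible_def metrics_def densities_def)
  qed
  define A where "A = (\<Sum>e\<in>arcs G. g e powr (1 - \<alpha>))"
  define V where "V = (\<Sum>e\<in>arcs G. g e powr \<alpha> * integral {0..1} (\<rho> e))"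
  have \<rho>_int: "\<rho> e integrable_on {0..1}" and \<eta>_int: "\<eta> e integrable_on {0..1}" if "e \<in> arcs G" for e
    using smooth_within_continuous_on \<rho>[OF that] \<eta>[OF that] integrable_continuous_interval by blast+
  have V_t: "(\<Sum>e\<in>arcs G. g e powr \<alpha> * integral {0..1} (\<rho>t t e)) = V" for t
  proof -
    have "(\<Sum>e\<in>arcs G. g e powr \<alpha> * integral {0..1} (\<eta> e)) = 0"
    proof -
      have "g e powr \<alpha> * integral {0..1} (\<eta> e) = \<kappa> e * integral {0..L e} (\<lambda>s. q e s - \<sigma> e s)" if e: "e \<in> arcs G" for e
      proof -
        have "integral {0..L e} (\<lambda>s. q e s - \<sigma> e s) = integral {0..L e} (h e)"
          by (intro integral_cong) (simp add: h_eq e)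
        also have "\<dots> = L e * integral {0..1} (\<eta> e)"
          unfolding h_def L_def
          using smooth_within_continuous_on[OF \<eta>[OF e]] by (intro integral_edge_density g e)
        finally show ?thesis using Lp[OF e] by (simp add: \<kappa>_def)
      qed
      then show ?thesis using q(2) by simp
    qed
    moreover have "g e powr \<alpha> * integral {0..1} (\<rho>t t e)
        = g e powr \<alpha> * integral {0..1} (\<rho> e) + t * (g e powr \<alpha> * integral {0..1} (\<eta> e))" if "e \<in> arcs G" for e
    proof -
      have "integral {0..1} (\<rho>t t e) = integral {0..1} (\<rho> e) + t * integral {0..1} (\<eta> e)"
        unfolding \<rho>t_def using \<rho>_int[OF that] \<eta>_int[OF that]
        by (simp add: integral_add integrable_on_mult_right)
      then show ?thesis by (simp add: algebra_simps)
    qed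
    ultimately show ?thesis
      by (simp add: V_def sum.distrib sum_distrib_left[symmetric])
  qed
  have A: "0 < A"
    unfolding A_def
  proof (intro sum_pos finite_flower_arcs nonempty)
    show "0 < g e powr (1 - \<alpha>)" if "e \<in> arcs G" for e using g[OF that] by simp
  qed
  have V: "0 < V"
    unfolding V_def
  proof (intro sum_pos mult_pos_pos finite_flower_arcs nonempty)
    fix e assume e: "e \<in> arcs G"
    show "0 < g e powr \<alpha>" using g[OF e] by simp
    have c: "continuous_on {0..1} (\<rho> e)" using smooth_within_continuous_on[OF \<rho>[OF e]] .
    have pos: "0 < \<rho> e x" if "x \<in> {0..1}" for x
      using adm e that by (auto simp: admissible_def densities_def)
    have "0 \<le> integral {0..1} (\<rho> e)"
      using pos by (intro Henstock_Kurzweil_Integration.integral_nonneg \<rho>_int e) (auto simp: less_imp_le)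
    moreover have "integral {0..1} (\<rho> e) \<noteq> 0"
      using integral_eq_0_iff[OF c] pos by (force simp: less_imp_le)
    ultimately show "0 < integral {0..1} (\<rho> e)" by simp
  qed
  define C where "C = A * V"
  have C: "0 < C" using A V by (simp add: C_def)
  define F where "F = normalized_eigenvalue G 1 \<alpha>"
  have F_t: "F (g, \<rho>t t) = C / M_at h t" if "\<bar>t\<bar> < b" for t
    unfolding F_def normalized_eigenvalue_def
    using eigenvalue_1_eq[OF adm_t[OF that]] V_t[of t]
    by (simp add: dens M_at_def A_def[symmetric] C_def L_def[symmetric])
  have F_p: "F p = C / M"
    unfolding F_def normalized_eigenvalue_def p
    using eigenvalue_1_eq[OF adm] by (simp add: A_def V_def C_def L_def \<sigma>_def)
  define \<gamma> where "\<gamma> t = (g, \<rho>t t)" for t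
  have "smooth_family G {-b<..<b} \<gamma>"
    unfolding smooth_family_def
  proof (intro conjI ballI)
    show "\<gamma> t \<in> admissible G" if "t \<in> {-b<..<b}" for t
      using adm_t[of t] that by (auto simp: \<gamma>_def)
    fix e assume e: "e \<in> arcs G"
    show "smooth_within {-b<..<b} (\<lambda>t. fst (\<gamma> t) e)"
      by (simp add: \<gamma>_def smooth_within_const)
    show "smooth2_within {-b<..<b} {0..1} (\<lambda>t. snd (\<gamma> t) e)"
      using smooth2_within_affine[OF \<rho>[OF e] \<eta>[OF e]] by (simp add: \<gamma>_def \<rho>t_def[abs_def])
  qed
  moreover have "\<gamma> 0 = p" by (simp add: \<gamma>_def p \<rho>t_def[abs_def])
  ultimately have "- b < 0 \<and> 0 < b \<and> smooth_family G {-b<..<b} \<gamma> \<and> \<gamma> 0 = p"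
    using b(1) by simp
  then have "(\<exists>r. r \<in> o[at 0](\<lambda>t. t) \<and> (\<forall>\<^sub>F t in at 0. F (\<gamma> t) \<le> F p + r t)) \<or>
        (\<exists>r. r \<in> o[at 0](\<lambda>t. t) \<and> (\<forall>\<^sub>F t in at 0. F (\<gamma> t) \<ge> F p + r t))"
    using ext[folded F_def, unfolded extremal_def, THEN conjunct2, rule_format, of "- b" b \<gamma>] by blast
  moreover have near: "\<forall>\<^sub>F t in at 0. \<bar>t\<bar> < b"
    using b(1) unfolding eventually_at by (intro exI[of _ b]) (auto simp: dist_real_def)
  \<comment> \<open>The factor \<open>C\<close> sits in the tolerance so that it cancels when the
    estimates for \<open>F\<close> are divided by \<open>C\<close>.\<close>
  have small: "\<forall>\<^sub>F t in at 0. \<bar>r t\<bar> \<le> C * \<epsilon> * \<bar>t\<bar>" if "r \<in> o[at 0](\<lambda>t. t)" "0 < \<epsilon>" for r :: "real \<Rightarrow> real" and \<epsilon>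
    using landau_o.smallD[OF that(1), of "C * \<epsilon>"] C that(2) by simp
  ultimately show False
  proof (elim disjE exE conjE)
    fix r assume r: "r \<in> o[at 0](\<lambda>t. t)" and le: "\<forall>\<^sub>F t in at 0. F (\<gamma> t) \<le> F p + r t"
    show False
    proof (rule not_eventually_le[OF h dir])
      fix \<epsilon> :: real assume "0 < \<epsilon>"
      show "\<forall>\<^sub>F t in at 0. 1 / M_at h t \<le> 1 / M + \<epsilon> * \<bar>t\<bar>"
        using le near small[OF r \<open>0 < \<epsilon>\<close>]
      proof eventually_elim
        case (elim t)
        then have "C * (1 / M_at h t) \<le> C * (1 / M + \<epsilon> * \<bar>t\<bar>)"
          by (simp add: F_t F_p \<gamma>_def algebra_simps)
        then show ?case using C by (simp only: mult_le_cancel_left_pos)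
      qed
    qed
  next
    fix r assume r: "r \<in> o[at 0](\<lambda>t. t)" and ge: "\<forall>\<^sub>F t in at 0. F (\<gamma> t) \<ge> F p + r t"
    show False
    proof (rule not_eventually_ge[OF h dir])
      fix \<epsilon> :: real assume "0 < \<epsilon>"
      show "\<forall>\<^sub>F t in at 0. 1 / M - \<epsilon> * \<bar>t\<bar> \<le> 1 / M_at h t"
        using ge near small[OF r \<open>0 < \<epsilon>\<close>]
      proof eventually_elim
        case (elim t)
        then have "C * (1 / M - \<epsilon> * \<bar>t\<bar>) \<le> C * (1 / M_at h t)"
          by (simp add: F_t F_p \<gamma>_def algebra_simps)
        then show ?case using C by (simp only: mult_le_cancel_left_pos)
      qed
    qed
  qed
qed

end

text \<open>At a minimum the lower alternative of extremality holds with remainder 0.\<close>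

lemma is_arg_min_imp_extremal:
  assumes "is_arg_min F (\<lambda>p. p \<in> admissible G) p"
  shows "extremal G F p"
  unfolding extremal_def
proof (intro conjI allI impI disjI2)
  show "p \<in> admissible G" using assms by (simp add: is_arg_min_def)
  fix a b :: real and \<gamma>
  assume \<gamma>: "a < 0 \<and> 0 < b \<and> smooth_family G {a<..<b} \<gamma> \<and> \<gamma> 0 = p"
  have "\<forall>\<^sub>F t in at 0. t \<in> {a<..<b}"
    using \<gamma> eventually_at_in_open'[of "{a<..<b}" 0] by auto
  then have "\<forall>\<^sub>F t in at 0. F p + 0 \<le> F (\<gamma> t)"
  proof eventually_elim
    case (elim t)
    then have "\<gamma> t \<in> admissible G" using \<gamma> by (simp add: smooth_family_def)
    then have "\<not> F (\<gamma> t) < F p" using assms unfolding is_arg_min_def by blast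
    then show ?case by simp
  qed
  then show "\<exists>r. r \<in> o[at 0](\<lambda>t. t) \<and> (\<forall>\<^sub>F t in at 0. F p + r t \<le> F (\<gamma> t))"
    by (intro exI[of _ "\<lambda>t. 0"]) simp
qed

theorem corollary6p2:
  fixes G :: "('v, 'e) pre_digraph" and \<alpha> :: real
  assumes "flower_graph G"
    and "card (arcs G) \<ge> 2"
    and "\<alpha> \<notin> {1/2, 1}"
  shows "(\<nexists>p. extremal G (normalized_eigenvalue G 1 \<alpha>) p) \<and>
         (\<nexists>p. is_arg_min (normalized_eigenvalue G 1 \<alpha>) (\<lambda>p. p \<in> admissible G) p)"
proof -
  have "arcs G \<noteq> {}" using assms(2) by auto
  then have "\<nexists>p. extremal G (normalized_eigenvalue G 1 \<alpha>) p"
    using no_extremal_pair[OF assms(1) _ assms(2)] by blast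
  then show ?thesis using is_arg_min_imp_extremal by blast
qed

end
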